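(* Let $0\le m\le n$, let $\lambda=(\lambda_1,\dotsc,\lambda_m)\in(\mathbb{Z}_{\ge 0})^m$ with $\lambda_1\ge\dotsm\ge\lambda_m$, and let $\gamma=(\gamma_1,\dotsc,\gamma_{n-m})\in(\mathbb{Z}_{\ge 0})^{n-m}$. Then, under the Kazhdan–Lusztig involution $*$ on $\mathbb{Q}(q,t)[x_1,\dotsc,x_n]^{S_m}$, $$P_{\lambda|\gamma}^*=t^{\mathrm{inv}(\lambda|\gamma)}P_{\lambda|\gamma},\qquad (\mathrm{A})$$ where $\mathrm{inv}(\lambda|\gamma)=\mathrm{inv}(\gamma)+|\{(i,j)\in[m]\times[n-m]:\lambda_i>\gamma_j\}|$. Furthermore, identity (A) is equivalent to the identity $$P_{\lambda|\gamma}(x_1,\dotsc,x_m,qx_n,\dotsc,qx_{m+1};q^{-1},t^{-1})=q^{\gamma_1+\dotsm+\gamma_{n-m}}\,t^{\mathrm{inv}(\gamma)-\ell(\omega_0^{[m+1,n]})}\,T_{\omega_0^{[m+1,n]}}P_{\lambda|\gamma}(x_1,\dotsc,x_n;q,t),\qquad(\mathrm{B})$$ where $\omega_0^{[m+1,n]}$ is the longest element of the symmetric group $S_{[m+1,n]}$ of $\{m+1,\dotsc,n\}$ (viewed inside $S_n$) and $\ell$ denotes Coxeter length.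
   Context: Notation: $[a,b]=\{a,\dotsc,b\}$, $[b]=[1,b]$. $S_n$ acts on $\mathbb{Q}(q,t^{1/2})[x_1,\dotsc,x_n]$ by algebra automorphisms with $\pi(x_i)=x_{\pi(i)}$; $S_m\subset S_n$ fixes $m+1,\dotsc,n$. For a composition $\gamma$, $\mathrm{inv}(\gamma)=|\{i<j:\gamma_i>\gamma_j\}|$. Demazure–Lusztig operators: for $1\le i\le n-1$, with $\sigma_i=(i,i+1)$, $T_if=t\,\sigma_i(f)+(t-1)x_{i+1}\frac{\sigma_i(f)-f}{x_i-x_{i+1}}$; for $\pi\in S_n$ with reduced word $\pi=\sigma_{i_1}\cdots\sigma_{i_\ell}$, $T_\pi=T_{i_1}\cdots T_{i_\ell}$ (independent of the reduced word). Nonsymmetric Macdonald polynomials $E_\mu$ (Haglund–Haiman–Loehr conventions), for $\mu\in(\mathbb{Z}_{\ge0})^n$: the column diagram is $\mathrm{dg}'(\mu)=\{(i,j):1\le i\le n,\ 1\le j\le\mu_i\}$ ($i$ = column, $j$ = row), the augmented diagram is $\hat{\mathrm{dg}}(\mu)=\mathrm{dg}'(\mu)\cup\{(i,0):1\le i\le n\}$. For $u=(i,j)\in\mathrm{dg}'(\mu)$: $d(u)=(i,j-1)$, $l(u)=\mu_i-j$, and $a(u)$ is the number of boxes $(i',j)\in\mathrm{dg}'(\mu)$ with $i'<i$, $\mu_{i'}\le\mu_i$, plus the number of boxes $(i',j-1)\in\hat{\mathrm{dg}}(\mu)$ with $i'>i$, $\mu_{i'}<\mu_i$. For $\pi\in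 S_n$, an augmented filling with basement $\pi$ is a map $\hat\sigma:\hat{\mathrm{dg}}(\mu)\to[n]$ with $\hat\sigma(i,0)=\pi(i)$. Two distinct boxes attack each other if they lie in the same row, or have the form $(i,j),(i',j-1)$ with $i'>i$. $\mathrm{NAF}^\pi_\mu$ is the set of such fillings taking distinct values on every attacking pair. A box $u\in\mathrm{dg}'(\mu)$ is a descent if $\hat\sigma(u)>\hat\sigma(d(u))$; $\mathrm{maj}(\hat\sigma)=\sum_{u\text{ descent}}(l(u)+1)$. The reading order lists boxes row by row from the top row down, right to left within each row. An inversion is a pair of attacking boxes $u,v$ with $u$ before $v$ in reading order and $\hat\sigma(u)>\hat\sigma(v)$. Set $\mathrm{inv}(\hat\sigma)=|\mathrm{Inv}(\hat\sigma)|-|\{i<j:\mu_i\le\mu_j,\ \pi(i)<\pi(j)\}|-\sum_{u\text{ descent}}a(u)$ and $\mathrm{coinv}(\hat\sigma)=\sum_{u\in\mathrm{dg}'(\mu)}a(u)-\mathrm{inv}(\hat\sigma)$. Then $E_\mu(x;q,t)=\sum_{\hat\sigma\in\mathrm{NAF}^{\mathrm{id}}_\mu}x^{\hat\sigma}q^{\mathrm{maj}(\hat\sigma)}t^{\mathrm{coinv}(\hat\sigma)}\prod_{u\in\mathrm{dg}'(\mu),\ \hat\sigma(u)\ne\hat\sigma(d(u))}\frac{1-t}{1-q^{l(u)+1}t^{a(u)+1}}$, where $x^{\hat\sigma}=\prod_{u\in\mathrm{dg}'(\mu)}x_{\hat\sigma(u)}$. Partially symmetric Macdonald polynomials: $P_{\lambda|\gamma}=\sum_{\pi\in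 S_m^\lambda}T_\pi E_\mu$ where $\mu=(\lambda,\gamma)\in(\mathbb{Z}_{\ge0})^n$ is the concatenation and $S_m^\lambda$ is the set of minimal length coset representatives of $S_m/(S_m)_\lambda$, $(S_m)_\lambda$ the stabilizer of $\lambda$. Kazhdan–Lusztig involution: on $\mathcal{M}=\mathbb{Q}(q,t^{1/2})[x_1,\dotsc,x_n]$, $f^*=t^{\ell(\omega_0)}T_{\omega_0}^{-1}\,\omega_0\big(f(q^{-1},t^{-1})\big)$, where $\omega_0$ is the longest element of $S_n$ and $f(q^{-1},t^{-1})$ is the image of $f$ under the $\mathbb{Q}$-algebra automorphism $q\mapsto q^{-1}$, $t^{1/2}\mapsto t^{-1/2}$, $x_i\mapsto x_i$. This $\mathbb{Q}$-linear involution preserves $\mathbb{Q}(q,t)[x_1,\dotsc,x_n]^{S_m}$ and restricts to it. *)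

theory Defs
  imports Complex_Main
    "HOL-Library.Poly_Mapping"
    "HOL-Library.FuncSet"
    "HOL-Combinatorics.Permutations"
    "HOL-Computational_Algebra.Computational_Algebra"
    "HOL-Computational_Algebra.Field_as_Ring"
begin

section \<open>The coefficient field and the polynomial ring\<close>

text \<open>The field \<open>\<rat>(q, t\<^sup>1\<^sup>/\<^sup>2)\<close> is the fraction field of \<open>\<rat>[q][s]\<close>, where \<open>s = t\<^sup>1\<^sup>/\<^sup>2\<close>.\<close>

type_synonym coef = "rat poly poly fract"

text \<open>Polynomials in the variables \<open>x\<^sub>0, x\<^sub>1, x\<^sub>2, \<dots>\<close> over this field; only
  \<open>x\<^sub>1, \<dots>, x\<^sub>n\<close> are used, see \<open>poly_ring\<close>.\<close>

type_synonym mpol = "(nat \<Rightarrow>\<^sub>0 nat) \<Rightarrow>\<^sub>0 coef"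

definition const_K :: "rat \<Rightarrow> coef" where
  "const_K r = Fract [:[:r:]:] 1"

definition q_K :: coef where
  "q_K = Fract [:[:0, 1:]:] 1"

definition thalf_K :: coef where
  "thalf_K = Fract [:0, 1:] 1"

definition t_K :: coef where
  "t_K = thalf_K ^ 2"

text \<open>The substitution \<open>q \<mapsto> q\<inverse>\<close>, \<open>t\<^sup>1\<^sup>/\<^sup>2 \<mapsto> t\<^sup>-\<^sup>1\<^sup>/\<^sup>2\<close>, first on \<open>\<rat>[q][s]\<close> and then on its
  fraction field by applying it to numerator and denominator.\<close>

definition bar_num :: "rat poly poly \<Rightarrow> coef" where
  "bar_num p =
     poly (map_poly (\<lambda>c. poly (map_poly const_K c) (inverse q_K)) p) (inverse thalf_K)"

definition bar_K :: "coef \<Rightarrow> coef" where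
  "bar_K r = (case quot_of_fract r of (a, b) \<Rightarrow> bar_num a / bar_num b)"

definition Cst :: "coef \<Rightarrow> mpol" where
  "Cst c = Poly_Mapping.single 0 c"

definition X :: "nat \<Rightarrow> mpol" where
  "X i = Poly_Mapping.single (Poly_Mapping.single i 1) 1"

definition poly_ring :: "nat \<Rightarrow> mpol set" where
  "poly_ring n = {f. \<forall>e \<in> Poly_Mapping.keys f. Poly_Mapping.keys e \<subseteq> {1..n}}"

definition bar :: "mpol \<Rightarrow> mpol" where
  "bar f = Poly_Mapping.map bar_K f"

text \<open>\<open>subst g f\<close> is \<open>f\<close> with \<open>g i\<close> substituted for \<open>x\<^sub>i\<close>, for all \<open>i\<close>.\<close>

definition subst :: "(nat \<Rightarrow> mpol) \<Rightarrow> mpol \<Rightarrow> mpol" where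
  "subst g f = (\<Sum>e \<in> Poly_Mapping.keys f. Cst (Poly_Mapping.lookup f e) *
     (\<Prod>i \<in> Poly_Mapping.keys e. g i ^ Poly_Mapping.lookup e i))"

definition act :: "(nat \<Rightarrow> nat) \<Rightarrow> mpol \<Rightarrow> mpol" where
  "act \<pi> = subst (\<lambda>i. X (\<pi> i))"

section \<open>Symmetric groups and Demazure--Lusztig operators\<close>

text \<open>Elements of \<open>S\<^sub>n\<close> are functions permuting \<open>{1..n}\<close>, so that \<open>S\<^sub>m\<close> and \<open>S\<^bsub>[m+1,n]\<^esub>\<close> are
  literally subsets of \<open>S\<^sub>n\<close>. The word \<open>[i\<^sub>1, \<dots>, i\<^sub>l]\<close> stands for
  \<open>\<sigma>\<^bsub>i\<^sub>1\<^esub> \<circ> \<dots> \<circ> \<sigma>\<^bsub>i\<^sub>l\<^esub>\<close>.\<close>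

definition simple_refl :: "nat \<Rightarrow> nat \<Rightarrow> nat" where
  "simple_refl i = transpose i (i + 1)"

definition word_perm :: "nat list \<Rightarrow> nat \<Rightarrow> nat" where
  "word_perm w = foldr (\<lambda>i \<pi>. simple_refl i \<circ> \<pi>) w id"

definition cox_length :: "nat \<Rightarrow> (nat \<Rightarrow> nat) \<Rightarrow> nat" where
  "cox_length n \<pi> = (LEAST k. \<exists>w. set w \<subseteq> {1..<n} \<and> word_perm w = \<pi> \<and> length w = k)"

definition reduced_word :: "nat \<Rightarrow> (nat \<Rightarrow> nat) \<Rightarrow> nat list \<Rightarrow> bool" where
  "reduced_word n \<pi> w \<longleftrightarrow>
     set w \<subseteq> {1..<n} \<and> word_perm w = \<pi> \<and> length w = cox_length n \<pi>"

text \<open>The longest element of the symmetric group of \<open>{a..b} \<subseteq> {1..n}\<close>.\<close>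

definition longest_elt :: "nat \<Rightarrow> nat \<Rightarrow> nat \<Rightarrow> nat \<Rightarrow> nat" where
  "longest_elt n a b = arg_max (cox_length n) (\<lambda>\<pi>. \<pi> permutes {a..b})"

text \<open>The exact quotient \<open>(\<sigma>\<^sub>i(f) - f) / (x\<^sub>i - x\<^sub>i\<^sub>+\<^sub>1)\<close>.\<close>

definition div_diff :: "nat \<Rightarrow> mpol \<Rightarrow> mpol" where
  "div_diff i f = (THE g. (X i - X (i + 1)) * g = act (simple_refl i) f - f)"

definition T_simple :: "nat \<Rightarrow> mpol \<Rightarrow> mpol" where
  "T_simple i f =
     Cst t_K * act (simple_refl i) f + Cst (t_K - 1) * X (i + 1) * div_diff i f"

text \<open>\<open>T\<^sub>\<pi>\<close> does not depend on the reduced word, so an arbitrary one is chosen.\<close>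

definition T_op :: "nat \<Rightarrow> (nat \<Rightarrow> nat) \<Rightarrow> mpol \<Rightarrow> mpol" where
  "T_op n \<pi> f = foldr T_simple (SOME w. reduced_word n \<pi> w) f"

definition KL_inv :: "nat \<Rightarrow> mpol \<Rightarrow> mpol" where
  "KL_inv n f = (let w0 = longest_elt n 1 n in
     Cst (t_K ^ cox_length n w0) *
     inv_into (poly_ring n) (T_op n w0) (act w0 (bar f)))"

section \<open>Nonsymmetric Macdonald polynomials\<close>

text \<open>Compositions are lists; their parts are indexed from 1. A box \<open>(i, j)\<close> is in
  column \<open>i\<close> and row \<open>j\<close>.\<close>

definition part :: "nat list \<Rightarrow> nat \<Rightarrow> nat" where
  "part \<mu> i = \<mu> ! (i - 1)"

definition dg :: "nat list \<Rightarrow> (nat \<times> nat) set" where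
  "dg \<mu> = {(i, j). 1 \<le> i \<and> i \<le> length \<mu> \<and> 1 \<le> j \<and> j \<le> part \<mu> i}"

definition aug_dg :: "nat list \<Rightarrow> (nat \<times> nat) set" where
  "aug_dg \<mu> = dg \<mu> \<union> {(i, 0) | i. 1 \<le> i \<and> i \<le> length \<mu>}"

definition below :: "nat \<times> nat \<Rightarrow> nat \<times> nat" where
  "below u = (fst u, snd u - 1)"

definition leg :: "nat list \<Rightarrow> nat \<times> nat \<Rightarrow> nat" where
  "leg \<mu> u = part \<mu> (fst u) - snd u"

definition arm :: "nat list \<Rightarrow> nat \<times> nat \<Rightarrow> nat" where
  "arm \<mu> u = (case u of (i, j) \<Rightarrow>
     card {i'. (i', j) \<in> dg \<mu> \<and> i' < i \<and> part \<mu> i' \<le> part \<mu> i} +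
     card {i'. (i', j - 1) \<in> aug_dg \<mu> \<and> i' > i \<and> part \<mu> i' < part \<mu> i})"

text \<open>In the second disjunct \<open>u\<close> is the upper box, in the third one \<open>v\<close> is.\<close>

definition attack :: "nat \<times> nat \<Rightarrow> nat \<times> nat \<Rightarrow> bool" where
  "attack u v \<longleftrightarrow> u \<noteq> v \<and>
     (snd u = snd v \<or>
      (snd u = snd v + 1 \<and> fst v > fst u) \<or>
      (snd v = snd u + 1 \<and> fst u > fst v))"

definition NAF :: "(nat \<Rightarrow> nat) \<Rightarrow> nat list \<Rightarrow> (nat \<times> nat \<Rightarrow> nat) set" where
  "NAF \<pi> \<mu> = {\<sigma> \<in> aug_dg \<mu> \<rightarrow>\<^sub>E {1..length \<mu>}.
     (\<forall>i \<in> {1..length \<mu>}. \<sigma> (i, 0) = \<pi> i) \<and>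
     (\<forall>u \<in> aug_dg \<mu>. \<forall>v \<in> aug_dg \<mu>. attack u v \<longrightarrow> \<sigma> u \<noteq> \<sigma> v)}"

definition descents :: "nat list \<Rightarrow> (nat \<times> nat \<Rightarrow> nat) \<Rightarrow> (nat \<times> nat) set" where
  "descents \<mu> \<sigma> = {u \<in> dg \<mu>. \<sigma> u > \<sigma> (below u)}"

definition maj :: "nat list \<Rightarrow> (nat \<times> nat \<Rightarrow> nat) \<Rightarrow> nat" where
  "maj \<mu> \<sigma> = (\<Sum>u \<in> descents \<mu> \<sigma>. leg \<mu> u + 1)"

definition reads_before :: "nat \<times> nat \<Rightarrow> nat \<times> nat \<Rightarrow> bool" where
  "reads_before u v \<longleftrightarrow> snd u > snd v \<or> (snd u = snd v \<and> fst u > fst v)"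

text \<open>Inversions may involve boxes of the basement (row 0).\<close>

definition Inv_set ::
  "nat list \<Rightarrow> (nat \<times> nat \<Rightarrow> nat) \<Rightarrow> ((nat \<times> nat) \<times> (nat \<times> nat)) set" where
  "Inv_set \<mu> \<sigma> = {(u, v). u \<in> aug_dg \<mu> \<and> v \<in> aug_dg \<mu> \<and>
     attack u v \<and> reads_before u v \<and> \<sigma> u > \<sigma> v}"

definition fill_inv :: "(nat \<Rightarrow> nat) \<Rightarrow> nat list \<Rightarrow> (nat \<times> nat \<Rightarrow> nat) \<Rightarrow> int" where
  "fill_inv \<pi> \<mu> \<sigma> = int (card (Inv_set \<mu> \<sigma>))
     - int (card {(i, j). 1 \<le> i \<and> i < j \<and> j \<le> length \<mu> \<and>
                          part \<mu> i \<le> part \<mu> j \<and> \<pi> i < \<pi> j})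
     - int (\<Sum>u \<in> descents \<mu> \<sigma>. arm \<mu> u)"

definition fill_coinv :: "(nat \<Rightarrow> nat) \<Rightarrow> nat list \<Rightarrow> (nat \<times> nat \<Rightarrow> nat) \<Rightarrow> int" where
  "fill_coinv \<pi> \<mu> \<sigma> = int (\<Sum>u \<in> dg \<mu>. arm \<mu> u) - fill_inv \<pi> \<mu> \<sigma>"

definition E_mac :: "nat list \<Rightarrow> mpol" where
  "E_mac \<mu> = (\<Sum>\<sigma> \<in> NAF id \<mu>.
     Cst (q_K ^ maj \<mu> \<sigma> * t_K powi fill_coinv id \<mu> \<sigma> *
          (\<Prod>u \<in> {u \<in> dg \<mu>. \<sigma> u \<noteq> \<sigma> (below u)}.
             (1 - t_K) / (1 - q_K ^ (leg \<mu> u + 1) * t_K ^ (arm \<mu> u + 1)))) *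
     (\<Prod>u \<in> dg \<mu>. X (\<sigma> u)))"

section \<open>Partially symmetric Macdonald polynomials\<close>

definition stabilizer :: "nat list \<Rightarrow> (nat \<Rightarrow> nat) set" where
  "stabilizer lam = {\<rho>. \<rho> permutes {1..length lam} \<and>
     (\<forall>i \<in> {1..length lam}. part lam (\<rho> i) = part lam i)}"

text \<open>The elements of \<open>S\<^sub>m\<close> that have minimal length in their left coset of the stabilizer.\<close>

definition min_coset_reps :: "nat list \<Rightarrow> (nat \<Rightarrow> nat) set" where
  "min_coset_reps lam = {\<pi>. \<pi> permutes {1..length lam} \<and>
     (\<forall>\<rho> \<in> stabilizer lam. cox_length (length lam) \<pi> \<le> cox_length (length lam) (\<pi> \<circ> \<rho>))}"

definition P_mac :: "nat list \<Rightarrow> nat list \<Rightarrow> mpol" where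
  "P_mac lam \<gamma> =
     (\<Sum>\<pi> \<in> min_coset_reps lam. T_op (length lam + length \<gamma>) \<pi> (E_mac (lam @ \<gamma>)))"

definition comp_inv :: "nat list \<Rightarrow> nat" where
  "comp_inv \<gamma> =
     card {(i, j). 1 \<le> i \<and> i < j \<and> j \<le> length \<gamma> \<and> part \<gamma> i > part \<gamma> j}"

definition pair_inv :: "nat list \<Rightarrow> nat list \<Rightarrow> nat" where
  "pair_inv lam \<gamma> = comp_inv \<gamma> +
     card {(i, j). i \<in> {1..length lam} \<and> j \<in> {1..length \<gamma>} \<and> part lam i > part \<gamma> j}"

end

theory Submission
  imports Defs
begin

text \<open>Allow an arbitrary basement permutation \<open>b\<close> in the combinatorial formula and write \<open>E\<^sub>b\<close> for the
  resulting polynomial. Removing the lowest box of the first nonempty column, and moving the rest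
  of that column to the right end, expresses \<open>E\<^sub>b\<close> for a shape as a sum of terms
  \<open>c x\<^sub>v E\<^bsub>b'\<^esub>\<close> for a shape with one box less, where \<open>v\<close> runs over the basement values of the empty
  columns in front and of the column itself. Induction on this recursion gives three facts:
  \<open>T\<^sub>i\<close> maps \<open>E\<^sub>b\<close> to \<open>E\<close> with basement \<open>\<sigma>\<^sub>i b\<close>, up to a power of \<open>t\<close>, whenever \<open>i\<close> is to the left of
  \<open>i + 1\<close> in \<open>b\<close>; exchanging the basement values of two neighbouring columns of equal height does not
  change \<open>E\<^sub>b\<close>; and inverting \<open>q\<close> and \<open>t\<close> while reversing \<open>x\<^sub>1, \<dots>, x\<^sub>m\<close> and \<open>x\<^sub>m\<^sub>+\<^sub>1, \<dots>, x\<^sub>n\<close> (and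
  scaling the latter by \<open>q\<close>) turns \<open>E\<^sub>b\<close> into \<open>E\<close> with the correspondingly reversed basement, up to a
  power of \<open>q\<close>. Up to a scalar, \<open>P\<close> is the sum of \<open>E\<^sub>b\<close> over \<open>b\<close> in \<open>S\<^sub>m\<close>. The last fact for \<open>m = n\<close> gives
  (A), and for the given \<open>m\<close> it gives (B).\<close>

section \<open>The involution on coefficients\<close>

text \<open>Arbitrary basements let one recursion serve every operator: up to scalars,
  \<open>P\<close>, its images under the T_w and its bar conjugate are weighted sums of E_b over b
  in a coset of S_m, so all identities reduce to comparing powers of q and t. Peeling respects the
  attack relation because it rotates the diagram, viewed periodically, by one column. The weight of
  a term depends on the basement only through the cyclic order of its values and a factor q for
  passing the cut between n and 1. Reversing the two blocks is the reflection i \<mapsto> m + 1 - i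
  modulo n; it reverses this cyclic order, and the factor q on the second block accounts for the
  moved cut. The obstacle is symmetrization: whether T_i multiplies E_b by t depends on the heights
  of two columns, so T_i does not act uniformly on a plain sum over S_m. Summands therefore carry
  extra powers of t, and basements that differ within the first m columns are paired. Replacing
  minimal coset representatives by all of S_m costs the order of the stabilizer, a nonzero
  constant.\<close>

lemma poly_map_poly_ring_hom:
  fixes f :: "'a::comm_ring_1 \<Rightarrow> 'b::comm_ring_1"
  assumes f0: "f 0 = 0" and f1: "f 1 = 1"
    and fa: "\<And>a b. f (a + b) = f a + f b" and fm: "\<And>a b. f (a * b) = f a * f b"
  shows "poly (map_poly f 1) x = 1"
    and "poly (map_poly f (p + q)) x = poly (map_poly f p) x + poly (map_poly f q) x"
    and "poly (map_poly f (p * q)) x = poly (map_poly f p) x * poly (map_poly f q) x"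
proof -
  have fs: "f (sum g A) = (\<Sum>a\<in>A. f (g a))" for g :: "nat \<Rightarrow> 'a" and A
    by (induction A rule: infinite_finite_induct) (auto simp: f0 fa)
  show "poly (map_poly f 1) x = 1" by (simp add: f1)
  have "map_poly f (p + q) = map_poly f p + map_poly f q"
    by (rule poly_eqI) (simp add: coeff_map_poly f0 fa)
  then show "poly (map_poly f (p + q)) x = poly (map_poly f p) x + poly (map_poly f q) x"
    by simp
  have "map_poly f (p * q) = map_poly f p * map_poly f q"
    by (rule poly_eqI) (simp add: coeff_map_poly f0 coeff_mult fs fm)
  then show "poly (map_poly f (p * q)) x = poly (map_poly f p) x * poly (map_poly f q) x"
    by simp
qed

lemma poly_map_poly_altdef:
  fixes f :: "'a::comm_ring_1 \<Rightarrow> 'b::comm_ring_1"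
  assumes "f 0 = 0" "degree p \<le> N"
  shows "poly (map_poly f p) x = (\<Sum>i\<le>N. f (coeff p i) * x ^ i)"
proof -
  have d: "degree (map_poly f p) \<le> N"
    using assms by (intro degree_le) (auto simp: coeff_map_poly coeff_eq_0)
  have "poly (map_poly f p) x = (\<Sum>i\<le>degree (map_poly f p). coeff (map_poly f p) i * x ^ i)"
    by (simp add: poly_altdef)
  also have "\<dots> = (\<Sum>i\<le>N. coeff (map_poly f p) i * x ^ i)"
    using d by (intro sum.mono_neutral_left) (auto simp: coeff_eq_0)
  finally show ?thesis by (simp add: coeff_map_poly assms(1))
qed

lemma const_K_to_fract: "const_K r = to_fract [:[:r:]:]"
  by (simp add: const_K_def to_fract_def)

lemma q_K_to_fract: "q_K = to_fract [:[:0, 1:]:]"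
  by (simp add: q_K_def to_fract_def)

lemma thalf_K_to_fract: "thalf_K = to_fract [:0, 1:]"
  by (simp add: thalf_K_def to_fract_def)

lemma to_fract_power: "to_fract (x ^ n) = to_fract x ^ n"
  by (induction n) (auto simp: to_fract_mult)

lemma to_fract_sum: "to_fract (sum f A) = (\<Sum>a\<in>A. to_fract (f a))"
  by (induction A rule: infinite_finite_induct) (auto simp: to_fract_add)

lemma const_K_hom:
  "const_K 0 = 0" "const_K 1 = 1"
  "const_K (a + b) = const_K a + const_K b" "const_K (a * b) = const_K a * const_K b"
  by (simp_all add: const_K_to_fract flip: to_fract_add to_fract_mult one_pCons)

lemma q_K_nonzero [simp]: "q_K \<noteq> 0"
  by (simp add: q_K_to_fract)

lemma thalf_K_nonzero [simp]: "thalf_K \<noteq> 0"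
  by (simp add: thalf_K_to_fract)

lemma t_K_nonzero [simp]: "t_K \<noteq> 0"
  by (simp add: t_K_def)

text \<open>Keeps the denominators of the weights away from 0. Setting t^(1/2) = 1 and q = 0 sends
  the product to 0.\<close>

lemma q_t_powers_ne_1:
  assumes "a \<noteq> 0"
  shows "q_K ^ a * t_K ^ b \<noteq> 1"
proof
  assume "q_K ^ a * t_K ^ b = 1"
  then have "to_fract ([:[:0, 1:]:] ^ a * [:0, 1:] ^ (2 * b)) = (to_fract 1 :: coef)"
    by (simp add: q_K_to_fract t_K_def thalf_K_to_fract to_fract_mult to_fract_power power_mult)
  then have "[:[:0, 1::rat:]:] ^ a * [:0, 1:] ^ (2 * b) = 1"
    by (simp only: to_fract_eq_iff)
  then have "poly (poly ([:[:0, 1::rat:]:] ^ a * [:0, 1:] ^ (2 * b)) 1) 0 = 1"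
    by simp
  then show False using assms by (simp add: power_0_left split: if_splits)
qed

abbreviation bar_coeff :: "rat poly \<Rightarrow> coef" where
  "bar_coeff c \<equiv> poly (map_poly const_K c) (inverse q_K)"

lemma bar_coeff_hom:
  "bar_coeff 0 = 0" "bar_coeff 1 = 1"
  "bar_coeff (a + b) = bar_coeff a + bar_coeff b" "bar_coeff (a * b) = bar_coeff a * bar_coeff b"
  using poly_map_poly_ring_hom[of const_K] const_K_hom by auto

lemma bar_num_hom:
  "bar_num 0 = 0" "bar_num 1 = 1"
  "bar_num (a + b) = bar_num a + bar_num b" "bar_num (a * b) = bar_num a * bar_num b"
  unfolding bar_num_def
  using poly_map_poly_ring_hom[of bar_coeff] bar_coeff_hom by auto

lemma bar_num_eq_sum:
  assumes "degree p \<le> M" "\<And>j. degree (coeff p j) \<le> N"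
  shows "bar_num p = (\<Sum>j\<le>M. (\<Sum>i\<le>N. const_K (coeff (coeff p j) i) * inverse q_K ^ i) *
    inverse thalf_K ^ j)"
  unfolding bar_num_def
  by (subst poly_map_poly_altdef[OF _ assms(1)])
    (simp_all add: const_K_hom poly_map_poly_altdef[OF _ assms(2)])

text \<open>Multiplying \<open>bar_num p\<close> by a high power of \<open>q\<close> and of \<open>t\<^sup>1\<^sup>/\<^sup>2\<close> gives the polynomial with
  the coefficients of \<open>p\<close> in reverse order.\<close>

lemma bar_num_nonzero:
  assumes "p \<noteq> 0"
  shows "bar_num p \<noteq> 0"
proof
  assume z: "bar_num p = 0"
  define M where "M = degree p"
  have dM: "degree p \<le> M" by (simp add: M_def)
  define N where "N = Max ((\<lambda>j. degree (coeff p j)) ` {..M})"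
  have N: "degree (coeff p j) \<le> N" for j
  proof (cases "j \<le> M")
    case True then show ?thesis unfolding N_def by (intro Max_ge) auto
  next
    case False then show ?thesis by (simp add: M_def coeff_eq_0)
  qed
  define R where "R = (\<Sum>j\<le>M. \<Sum>i\<le>N. monom (monom (coeff (coeff p j) i) (N - i)) (M - j))"
  have c: "const_K a * q_K ^ i * thalf_K ^ j = to_fract (monom (monom a i) j)" for a i j
  proof -
    have "monom (monom a i) j = [:[:a:]:] * [:[:0, 1:]:] ^ i * [:0, 1:] ^ j"
      by (simp add: monom_altdef poly_const_pow)
    then show ?thesis
      by (simp only: const_K_to_fract q_K_to_fract thalf_K_to_fract to_fract_mult to_fract_power)
  qed
  have "q_K ^ N * thalf_K ^ M * bar_num p = to_fract R"
  proof -
    have s: "x ^ n * inverse x ^ i = x ^ (n - i)" if "i \<le> n" "x \<noteq> 0" for x :: coef and n i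
      using that by (simp add: power_diff field_simps)
    have "q_K ^ N * thalf_K ^ M * bar_num p = (\<Sum>j\<le>M. \<Sum>i\<le>N.
        const_K (coeff (coeff p j) i) * (q_K ^ N * inverse q_K ^ i) *
        (thalf_K ^ M * inverse thalf_K ^ j))"
      by (simp only: bar_num_eq_sum[OF dM N]
          sum_distrib_left sum_distrib_right mult_ac)
    also have "\<dots> = (\<Sum>j\<le>M. \<Sum>i\<le>N. to_fract (monom (monom (coeff (coeff p j) i) (N - i)) (M - j)))"
      by (intro sum.cong refl) (simp only: s q_K_nonzero thalf_K_nonzero atMost_iff not_False_eq_True c)
    finally show ?thesis by (simp add: R_def to_fract_sum)
  qed
  with z have "R = 0" by simp
  \<comment> \<open>Each coefficient of \<open>R\<close> is a single coefficient of
    \<open>p\<close>, since subtraction from \<open>M\<close> and from \<open>N\<close> is injective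
    on the ranges of summation.\<close>
  have "coeff (coeff p j) i = 0" if "j \<le> M" "i \<le> N" for i j
  proof -
    have t: "coeff (coeff (monom (monom (coeff (coeff p j') i') (N - i')) (M - j')) (M - j)) (N - i) =
        (if j' = j then if i' = i then coeff (coeff p j) i else 0 else 0)"
      if "j' \<le> M" "i' \<le> N" for i' j'
    proof -
      have "M - j' = M - j \<longleftrightarrow> j' = j" "N - i' = N - i \<longleftrightarrow> i' = i"
        using that \<open>j \<le> M\<close> \<open>i \<le> N\<close> by auto
      then show ?thesis by simp
    qed
    have "0 = coeff (coeff R (M - j)) (N - i)" by (simp add: \<open>R = 0\<close>)
    also have "\<dots> = (\<Sum>j'\<le>M. \<Sum>i'\<le>N. if j' = j then if i' = i then coeff (coeff p j) i else 0 else 0)"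
      unfolding R_def coeff_sum by (intro sum.cong refl) (simp only: t atMost_iff)
    also have "\<dots> = (\<Sum>j'\<le>M. if j' = j then \<Sum>i'\<le>N. if i' = i then coeff (coeff p j) i else 0 else 0)"
      by (intro sum.cong) auto
    also have "\<dots> = coeff (coeff p j) i"
      using that by simp
    finally show ?thesis by simp
  qed
  then have "coeff (coeff p j) i = 0" for i j
    using N[of j] by (metis M_def coeff_0 coeff_eq_0 le_trans not_le)
  then have "p = 0" by (simp add: poly_eq_iff)
  with assms show False by simp
qed

text \<open>\<open>bar_K\<close> is defined through the normalized fraction; by cross multiplication
  any representation gives the same value, because \<open>bar_num\<close> is multiplicative and
  vanishes only at 0. Additivity and multiplicativity of \<open>bar_K\<close> follow from
  this.\<close>

lemma bar_K_Fract:
  assumes "b \<noteq> 0"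
  shows "bar_K (Fract a b) = bar_num a / bar_num b"
proof -
  obtain c d where cd: "quot_of_fract (Fract a b) = (c, d)" by fastforce
  have d: "d \<noteq> 0" using snd_quot_of_fract_nonzero[of "Fract a b"] cd by simp
  have "Fract c d = Fract a b"
    using Fract_quot_of_fract[of "Fract a b"] cd by simp
  with d assms have "c * b = a * d" by (simp add: eq_fract)
  then have "bar_num c * bar_num b = bar_num a * bar_num d" by (metis bar_num_hom(4))
  then show ?thesis
    using assms d bar_num_nonzero by (simp add: bar_K_def cd field_simps)
qed

lemma bar_K_to_fract: "bar_K (to_fract p) = bar_num p"
  by (simp add: to_fract_def bar_K_Fract bar_num_hom)

lemma bar_K_0 [simp]: "bar_K 0 = 0" and bar_K_1 [simp]: "bar_K 1 = 1"
  using bar_K_to_fract[of 0] bar_K_to_fract[of 1] by (simp_all add: bar_num_hom)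

lemma bar_K_add: "bar_K (x + y) = bar_K x + bar_K y"
proof -
  obtain a b c d where "x = Fract a b" "b \<noteq> 0" "y = Fract c d" "d \<noteq> 0"
    by (meson Fract_cases)
  then show ?thesis
    using bar_num_nonzero[of b] bar_num_nonzero[of d]
    by (simp add: bar_K_Fract bar_num_hom field_simps)
qed

lemma bar_K_mult: "bar_K (x * y) = bar_K x * bar_K y"
proof -
  obtain a b c d where "x = Fract a b" "b \<noteq> 0" "y = Fract c d" "d \<noteq> 0"
    by (meson Fract_cases)
  then show ?thesis
    by (simp add: bar_K_Fract bar_num_hom)
qed

lemma bar_K_minus: "bar_K (- x) = - bar_K x"
  using bar_K_add[of x "- x"] by (simp add: eq_neg_iff_add_eq_0 add.commute)

lemma bar_K_diff: "bar_K (x - y) = bar_K x - bar_K y"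
  using bar_K_add[of x "- y"] by (simp add: bar_K_minus)

lemma bar_K_inverse: "bar_K (inverse x) = inverse (bar_K x)"
proof (cases "x = 0")
  case False
  then have "bar_K x * bar_K (inverse x) = 1" by (simp flip: bar_K_mult)
  then show ?thesis by (metis inverse_unique)
qed simp

lemma bar_K_divide: "bar_K (x / y) = bar_K x / bar_K y"
  by (simp add: divide_inverse bar_K_mult bar_K_inverse)

lemma bar_K_power: "bar_K (x ^ n) = bar_K x ^ n"
  by (induction n) (auto simp: bar_K_mult)

lemma bar_K_power_int: "bar_K (x powi k) = bar_K x powi k"
  by (cases k rule: int_cases2)
    (auto simp: bar_K_power bar_K_inverse power_int_minus)

lemma bar_K_q_K [simp]: "bar_K q_K = inverse q_K"
  by (simp add: q_K_to_fract[THEN arg_cong[of _ _ bar_K]] bar_K_to_fract bar_num_def map_poly_pCons const_K_hom)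

lemma bar_K_thalf_K: "bar_K thalf_K = inverse thalf_K"
  by (simp add: thalf_K_to_fract[THEN arg_cong[of _ _ bar_K]] bar_K_to_fract bar_num_def map_poly_pCons const_K_hom)

lemma bar_K_t_K [simp]: "bar_K t_K = inverse t_K"
  by (simp add: t_K_def bar_K_power bar_K_thalf_K power_inverse)

section \<open>Polynomials and Demazure--Lusztig operators\<close>

definition mon_eval :: "(nat \<Rightarrow> mpol) \<Rightarrow> (nat \<Rightarrow>\<^sub>0 nat) \<Rightarrow> mpol" where
  "mon_eval g e = (\<Prod>i \<in> Poly_Mapping.keys e. g i ^ Poly_Mapping.lookup e i)"

lemma Cst_hom:
  "Cst 0 = 0" "Cst 1 = 1" "Cst (a + b) = Cst a + Cst b" "Cst (a * b) = Cst a * Cst b"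
  "Cst (a - b) = Cst a - Cst b" "Cst (a ^ n) = Cst a ^ n"
proof -
  show m: "Cst (a * b) = Cst a * Cst b" for a b by (simp add: Cst_def mult_single)
  show o: "Cst 1 = 1" by (simp add: Cst_def)
  show "Cst (a ^ n) = Cst a ^ n" by (induction n) (simp_all add: m o)
qed (simp_all add: Cst_def single_add single_diff)

lemma Cst_eq_0_iff [simp]: "Cst c = 0 \<longleftrightarrow> c = 0"
  by (metis Cst_def lookup_single_eq lookup_zero single_zero)

lemma mon_eval_superset:
  assumes "finite A" "Poly_Mapping.keys e \<subseteq> A"
  shows "mon_eval g e = (\<Prod>i\<in>A. g i ^ Poly_Mapping.lookup e i)"
  unfolding mon_eval_def using assms
  by (intro prod.mono_neutral_left) (auto simp: in_keys_iff)

lemma mon_eval_add: "mon_eval g (e + e') = mon_eval g e * mon_eval g e'"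
proof -
  define A where "A = Poly_Mapping.keys e \<union> Poly_Mapping.keys e'"
  have "Poly_Mapping.keys (e + e') \<subseteq> A" by (simp add: A_def keys_add)
  then show ?thesis
    by (subst (1 2 3) mon_eval_superset[of A])
      (auto simp: A_def lookup_add power_add prod.distrib)
qed

lemma mon_eval_0 [simp]: "mon_eval g 0 = 1"
  by (simp add: mon_eval_def)

lemma mon_eval_single [simp]: "mon_eval g (Poly_Mapping.single i k) = g i ^ k"
  by (simp add: mon_eval_def)

lemma subst_superset:
  assumes "finite A" "Poly_Mapping.keys f \<subseteq> A"
  shows "subst g f = (\<Sum>e\<in>A. Cst (Poly_Mapping.lookup f e) * mon_eval g e)"
  unfolding subst_def mon_eval_def using assms
  by (intro sum.mono_neutral_left) (auto simp: in_keys_iff Cst_hom)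

lemma subst_add: "subst g (f + h) = subst g f + subst g h"
proof -
  define A where "A = Poly_Mapping.keys f \<union> Poly_Mapping.keys h"
  have "Poly_Mapping.keys (f + h) \<subseteq> A" by (simp add: A_def keys_add)
  then show ?thesis
    by (subst (1 2 3) subst_superset[of A])
      (auto simp: A_def lookup_add Cst_hom ring_distribs sum.distrib)
qed

lemma subst_single: "subst g (Poly_Mapping.single e c) = Cst c * mon_eval g e"
  by (subst subst_superset[of "{e}"]) auto

lemma subst_0 [simp]: "subst g 0 = 0"
  by (simp add: subst_def)

lemma poly_mapping_eq_sum_single:
  "f = (\<Sum>e\<in>Poly_Mapping.keys f. Poly_Mapping.single e (Poly_Mapping.lookup f e))"
proof (rule poly_mapping_eqI)
  fix k
  have "(\<Sum>e\<in>Poly_Mapping.keys f. Poly_Mapping.lookup (Poly_Mapping.single e (Poly_Mapping.lookup f e)) k)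
      = (\<Sum>e\<in>Poly_Mapping.keys f. if e = k then Poly_Mapping.lookup f k else 0)"
    by (intro sum.cong) (auto simp: lookup_single when_def)
  then show "Poly_Mapping.lookup f k = Poly_Mapping.lookup
      (\<Sum>e\<in>Poly_Mapping.keys f. Poly_Mapping.single e (Poly_Mapping.lookup f e)) k"
    by (simp add: lookup_sum in_keys_iff)
qed

lemma poly_mapping_single_induct:
  fixes f :: "'a \<Rightarrow>\<^sub>0 'b::comm_monoid_add"
  assumes z: "P 0" and s: "\<And>e c. P (Poly_Mapping.single e c)"
    and a: "\<And>f h. P f \<Longrightarrow> P h \<Longrightarrow> P (f + h)"
  shows "P f"
proof -
  have "P (\<Sum>e\<in>A. Poly_Mapping.single e (Poly_Mapping.lookup f e))" for A
    by (induction A rule: infinite_finite_induct) (auto simp: assms)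
  then show ?thesis using poly_mapping_eq_sum_single[of f] by metis
qed

lemma subst_mult: "subst g (f * h) = subst g f * subst g h"
proof (induction f rule: poly_mapping_single_induct)
  case (2 e c)
  show ?case
    by (induction h rule: poly_mapping_single_induct)
      (simp_all add: mult_single subst_single subst_add mon_eval_add Cst_hom ring_distribs)
qed (simp_all add: subst_add ring_distribs)

lemma subst_Cst [simp]: "subst g (Cst c) = Cst c"
  by (simp add: Cst_def subst_single mon_eval_def)

lemma subst_X [simp]: "subst g (X i) = g i"
  by (simp add: X_def subst_single Cst_hom)

lemma subst_1 [simp]: "subst g 1 = 1"
  using subst_Cst[of g 1] by (simp add: Cst_hom)

lemma subst_uminus: "subst g (- f) = - subst g f"
  using subst_add[of g f "- f"] by (simp add: eq_neg_iff_add_eq_0 add.commute)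

lemma subst_diff: "subst g (f - h) = subst g f - subst g h"
  using subst_add[of g f "- h"] by (simp add: subst_uminus)

lemma subst_sum: "subst g (sum F A) = (\<Sum>a\<in>A. subst g (F a))"
  by (induction A rule: infinite_finite_induct) (auto simp: subst_add)

lemma mon_eval_X: "mon_eval X e = Poly_Mapping.single e 1"
proof (induction e rule: poly_mapping_single_induct)
  case (2 i k)
  show ?case by (induction k) (simp_all add: X_def mult_single flip: single_add)
qed (simp_all add: mon_eval_add mult_single)

text \<open>Constants and variables generate the algebra, so identities between ring homomorphisms
  are checked on these generators.\<close>

lemma mpol_induct [case_names Cst X add mult]:
  assumes c: "\<And>c. P (Cst c)" and x: "\<And>i. P (X i)"
    and a: "\<And>f h. P f \<Longrightarrow> P h \<Longrightarrow> P (f + h)" and m: "\<And>f h. P f \<Longrightarrow> P h \<Longrightarrow> P (f * h)"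
  shows "P f"
proof (induction f rule: poly_mapping_single_induct)
  case 1 then show ?case using c[of 0] by (simp add: Cst_hom)
next
  case (2 e c)
  have p: "P (f ^ k)" if "P f" for f k
    using c[of 1] that by (induction k) (auto simp: m Cst_hom)
  have "P (\<Prod>i\<in>A. X i ^ Poly_Mapping.lookup e i)" for A
    using c[of 1] by (induction A rule: infinite_finite_induct) (auto simp: m p x Cst_hom)
  then have "P (Cst c * mon_eval X e)" by (simp add: mon_eval_def m assms(1))
  moreover have "Cst c * mon_eval X e = Poly_Mapping.single e c"
    by (simp add: mon_eval_X Cst_def mult_single)
  ultimately show ?case by simp
next
  case (3 f h) then show ?case by (rule a)
qed

lemma subst_subst: "subst g (subst h f) = subst (\<lambda>i. subst g (h i)) f"
  by (induction f rule: mpol_induct) (auto simp: subst_add subst_mult)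

lemma subst_ident [simp]: "subst X f = f"
  by (induction f rule: mpol_induct) (auto simp: subst_add subst_mult)

section \<open>The bar involution and permutations acting on polynomials\<close>

lemma lookup_bar [simp]: "Poly_Mapping.lookup (bar f) e = bar_K (Poly_Mapping.lookup f e)"
  by (simp add: bar_def Poly_Mapping.map.rep_eq when_def)

lemma bar_add: "bar (f + h) = bar f + bar h"
  by (rule poly_mapping_eqI) (simp add: lookup_add bar_K_add)

lemma bar_single: "bar (Poly_Mapping.single e c) = Poly_Mapping.single e (bar_K c)"
  by (rule poly_mapping_eqI) (simp add: lookup_single when_def)

lemma bar_0 [simp]: "bar 0 = 0"
  by (rule poly_mapping_eqI) simp

lemma bar_mult: "bar (f * h) = bar f * bar h"
proof (induction f rule: poly_mapping_single_induct)
  case (2 e c)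
  show ?case
    by (induction h rule: poly_mapping_single_induct)
      (simp_all add: mult_single bar_single bar_add bar_K_mult ring_distribs)
qed (simp_all add: bar_add ring_distribs)

lemma bar_Cst [simp]: "bar (Cst c) = Cst (bar_K c)"
  by (simp add: Cst_def bar_single)

lemma bar_X [simp]: "bar (X i) = X i"
  by (simp add: X_def bar_single)

lemma bar_sum: "bar (sum F A) = (\<Sum>a\<in>A. bar (F a))"
  by (induction A rule: infinite_finite_induct) (auto simp: bar_add)

lemma bar_subst: "bar (subst g f) = subst (\<lambda>i. bar (g i)) (bar f)"
  by (induction f rule: mpol_induct) (auto simp: subst_add subst_mult bar_add bar_mult)

lemma bar_act: "bar (act \<pi> f) = act \<pi> (bar f)"
  by (simp add: act_def bar_subst)

lemma act_act: "act \<pi> (act \<rho> f) = act (\<pi> \<circ> \<rho>) f"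
  by (simp add: act_def subst_subst)

lemma act_hom [simp]:
  "act \<pi> (f + h) = act \<pi> f + act \<pi> h" "act \<pi> (f - h) = act \<pi> f - act \<pi> h"
  "act \<pi> (f * h) = act \<pi> f * act \<pi> h" "act \<pi> (Cst c) = Cst c" "act \<pi> 1 = 1" "act \<pi> (X i) = X (\<pi> i)"
  by (simp_all add: act_def subst_add subst_diff subst_mult)

lemma act_id [simp]: "act id f = f"
  by (simp add: act_def)

text \<open>The substitution of the second identity is written by a formula that has the intended
  meaning only on the indices 1 to n; this lemma confines comparisons to them.\<close>

lemma subst_cong_poly_ring:
  assumes "f \<in> poly_ring n" "\<And>i. i \<in> {1..n} \<Longrightarrow> g i = h i"
  shows "subst g f = subst h f"
  using assms unfolding subst_def poly_ring_def
  by (intro sum.cong refl arg_cong2[of _ _ _ _ "(*)"] prod.cong) (fastforce dest: subsetD)+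

lemma poly_ring_Cst: "Cst c \<in> poly_ring n"
  by (auto simp: poly_ring_def Cst_def)

lemma poly_ring_X: "i \<in> {1..n} \<Longrightarrow> X i \<in> poly_ring n"
  by (auto simp: poly_ring_def X_def)

lemma poly_ring_add: "f \<in> poly_ring n \<Longrightarrow> h \<in> poly_ring n \<Longrightarrow> f + h \<in> poly_ring n"
  using keys_add[of f h] by (fastforce simp: poly_ring_def)

lemma poly_ring_mult:
  assumes "f \<in> poly_ring n" "h \<in> poly_ring n"
  shows "f * h \<in> poly_ring n"
  unfolding poly_ring_def
proof (intro CollectI ballI)
  fix e assume "e \<in> Poly_Mapping.keys (f * h)"
  then obtain a b where "e = a + b" "a \<in> Poly_Mapping.keys f" "b \<in> Poly_Mapping.keys h"
    using keys_mult[of f h] by auto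
  then show "Poly_Mapping.keys e \<subseteq> {1..n}"
    using assms keys_add[of a b] by (fastforce simp: poly_ring_def)
qed

lemma poly_ring_sum: "(\<And>a. a \<in> A \<Longrightarrow> F a \<in> poly_ring n) \<Longrightarrow> sum F A \<in> poly_ring n"
  using poly_ring_Cst[of 0 n]
  by (induction A rule: infinite_finite_induct) (auto simp: poly_ring_add Cst_hom)

section \<open>Relations between Demazure-Lusztig operators and variables\<close>

lemma simple_refl_apply:
  "simple_refl i j = (if j = i then i + 1 else if j = i + 1 then i else j)"
  by (simp add: simple_refl_def transpose_def)

lemma simple_refl_invol [simp]: "simple_refl i \<circ> simple_refl i = id"
  by (simp add: simple_refl_def)

lemma act_simple_refl_invol [simp]: "act (simple_refl i) (act (simple_refl i) f) = f"
  by (simp add: act_act)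

lemma X_diff_nonzero: "X i - X (i + 1) \<noteq> 0"
proof
  assume "X i - X (i + 1) = 0"
  then have "subst (\<lambda>j. if j = i then 1 else 0) (X i - X (i + 1)) = 0" by simp
  then show False by (simp add: subst_diff)
qed

lemma div_diff_exists: "\<exists>g. (X i - X (i + 1)) * g = act (simple_refl i) f - f"
proof (induction f rule: mpol_induct)
  case (Cst c) then show ?case by (intro exI[of _ 0]) simp
next
  case (X j)
  show ?case
    by (rule exI[of _ "if j = i then -1 else if j = i + 1 then 1 else 0"])
      (simp add: simple_refl_apply)
next
  case (add f h)
  then obtain a b where ab: "(X i - X (i + 1)) * a = act (simple_refl i) f - f"
    "(X i - X (i + 1)) * b = act (simple_refl i) h - h" by blast
  show ?case by (intro exI[of _ "a + b"]) (simp only: distrib_left ab, simp)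
next
  case (mult f h)
  then obtain a b where ab: "(X i - X (i + 1)) * a = act (simple_refl i) f - f"
    "(X i - X (i + 1)) * b = act (simple_refl i) h - h" by blast
  \<comment> \<open>Twisted Leibniz rule: s(f h) - f h = (s f - f) s h + f (s h - h).\<close>
  have "(X i - X (i + 1)) * (a * act (simple_refl i) h + f * b) =
      ((X i - X (i + 1)) * a) * act (simple_refl i) h + f * ((X i - X (i + 1)) * b)"
    by (simp only: ring_distribs mult_ac)
  then show ?case unfolding ab
    by (intro exI[of _ "a * act (simple_refl i) h + f * b"]) (simp add: algebra_simps)
qed

lemma div_diff_eq: "(X i - X (i + 1)) * div_diff i f = act (simple_refl i) f - f"
  unfolding div_diff_def
proof (rule theI')
  show "\<exists>!g. (X i - X (i + 1)) * g = act (simple_refl i) f - f"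
    using div_diff_exists[of i f] X_diff_nonzero[of i] by (metis mult_left_cancel)
qed

text \<open>With the denominator cleared, T_i is characterized by an equation between polynomials:
  x_i - x_(i+1) can be cancelled. Later relations are verified in this form.\<close>

lemma T_simple_eq:
  "(X i - X (i + 1)) * T_simple i f =
    (Cst t_K * (X i - X (i + 1)) + (Cst t_K - 1) * X (i + 1)) * act (simple_refl i) f -
    (Cst t_K - 1) * X (i + 1) * f"
proof -
  have "(X i - X (i + 1)) * T_simple i f = Cst t_K * (X i - X (i + 1)) * act (simple_refl i) f +
    (Cst t_K - 1) * X (i + 1) * ((X i - X (i + 1)) * div_diff i f)"
    by (simp add: T_simple_def Cst_hom algebra_simps)
  then show ?thesis unfolding div_diff_eq by (simp add: algebra_simps)
qed

lemma T_simple_eqI: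
  assumes "(X i - X (i + 1)) * g =
    (Cst t_K * (X i - X (i + 1)) + (Cst t_K - 1) * X (i + 1)) * act (simple_refl i) f -
    (Cst t_K - 1) * X (i + 1) * f"
  shows "T_simple i f = g"
  using assms X_diff_nonzero[of i] unfolding T_simple_eq[symmetric] by (metis mult_left_cancel)

lemma T_simple_add: "T_simple i (f + h) = T_simple i f + T_simple i h"
  by (rule T_simple_eqI) (simp only: distrib_left T_simple_eq act_hom, simp add: algebra_simps)

lemma T_simple_mult_invariant:
  assumes "act (simple_refl i) f = f"
  shows "T_simple i (f * h) = f * T_simple i h"
proof (rule T_simple_eqI)
  have "(X i - X (i + 1)) * (f * T_simple i h) = f * ((X i - X (i + 1)) * T_simple i h)"
    by (simp only: mult_ac)
  then show "(X i - X (i + 1)) * (f * T_simple i h) =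
    (Cst t_K * (X i - X (i + 1)) + (Cst t_K - 1) * X (i + 1)) * act (simple_refl i) (f * h) -
    (Cst t_K - 1) * X (i + 1) * (f * h)"
    unfolding T_simple_eq by (simp add: assms algebra_simps)
qed

lemma T_simple_Cst_mult: "T_simple i (Cst c * h) = Cst c * T_simple i h"
  by (simp add: T_simple_mult_invariant)

lemma T_simple_0 [simp]: "T_simple i 0 = 0"
  using T_simple_Cst_mult[of i 0 0] by (simp add: Cst_hom)

lemma T_simple_sum: "T_simple i (sum F A) = (\<Sum>a\<in>A. T_simple i (F a))"
  by (induction A rule: infinite_finite_induct) (auto simp: T_simple_add)

lemma T_simple_1: "T_simple i 1 = Cst t_K"
  by (rule T_simple_eqI) (simp add: algebra_simps)

text \<open>A Bernstein relation of the affine Hecke algebra. Peeling splits off a variable, which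
  must then be moved past T_i.\<close>

lemma T_simple_X_Suc:
  "T_simple i (X (i + 1) * f) = X i * T_simple i f + (Cst t_K - 1) * X (i + 1) * f"
proof (rule T_simple_eqI)
  have "(X i - X (i + 1)) * (X i * T_simple i f + (Cst t_K - 1) * X (i + 1) * f) =
     X i * ((X i - X (i + 1)) * T_simple i f) + (X i - X (i + 1)) * (Cst t_K - 1) * X (i + 1) * f"
    by (simp add: algebra_simps)
  then show "(X i - X (i + 1)) * (X i * T_simple i f + (Cst t_K - 1) * X (i + 1) * f) =
    (Cst t_K * (X i - X (i + 1)) + (Cst t_K - 1) * X (i + 1)) * act (simple_refl i) (X (i + 1) * f) -
    (Cst t_K - 1) * X (i + 1) * (X (i + 1) * f)"
    unfolding T_simple_eq by (simp add: simple_refl_apply algebra_simps)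
qed

lemma act_T_simple_eq:
  "(X (i + 1) - X i) * act (simple_refl i) (T_simple i f) =
    (Cst t_K * (X (i + 1) - X i) + (Cst t_K - 1) * X i) * f -
    (Cst t_K - 1) * X i * act (simple_refl i) f"
  using arg_cong[OF T_simple_eq[of i f], of "act (simple_refl i)"]
  by (simp add: simple_refl_apply)

text \<open>The Hecke relation (T_i - t)(T_i + 1) = 0. Applying sigma_i to the defining equation
  determines sigma_i(T_i f); what remains is a polynomial identity after multiplying twice by x_i -
  x_(i+1).\<close>

lemma T_simple_quadratic:
  "T_simple i (T_simple i f) = (Cst t_K - 1) * T_simple i f + Cst t_K * f"
proof -
  define d where "d = X i - X (i + 1)"
  define s where "s = Cst t_K"
  define y where "y = X (i + 1)"
  define F where "F = T_simple i f"
  define G where "G = act (simple_refl i) F"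
  define g where "g = act (simple_refl i) f"
  have x: "X i = d + y" by (simp add: d_def y_def)
  have 1: "d * F = (s * d + (s - 1) * y) * g - (s - 1) * y * f"
    using T_simple_eq[of i f] by (simp add: d_def s_def y_def F_def g_def)
  have 2: "- d * G = (- s * d + (s - 1) * (d + y)) * f - (s - 1) * (d + y) * g"
    using act_T_simple_eq[of i f]
    by (simp add: d_def s_def y_def F_def g_def G_def algebra_simps)
  have 3: "d * T_simple i F = (s * d + (s - 1) * y) * G - (s - 1) * y * F"
    using T_simple_eq[of i F] by (simp add: d_def s_def y_def G_def)
  have "d * (d * T_simple i F) = d * (d * ((s - 1) * F + s * f))"
    unfolding 3 using 1 2 by algebra
  moreover have "d \<noteq> 0" using X_diff_nonzero[of i] by (simp add: d_def)
  ultimately show ?thesis by (simp add: F_def s_def)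
qed

text \<open>The relation T_i x_i T_i = t x_(i+1): apply T_i to the Bernstein relation and simplify
  by the quadratic one.\<close>

lemma T_simple_X_T_simple:
  "T_simple i (X i * T_simple i f) = Cst t_K * X (i + 1) * f"
proof -
  have c: "T_simple i ((Cst t_K - 1) * h) = (Cst t_K - 1) * T_simple i h" for h
    using T_simple_Cst_mult[of i "t_K - 1" h] by (simp add: Cst_hom)
  have "T_simple i (T_simple i (X (i + 1) * f)) =
      T_simple i (X i * T_simple i f) + (Cst t_K - 1) * T_simple i (X (i + 1) * f)"
    using arg_cong[OF T_simple_X_Suc[of i f], of "T_simple i"]
    by (simp only: T_simple_add mult.assoc c)
  then show ?thesis unfolding T_simple_quadratic by (simp add: algebra_simps)
qed

text \<open>By the quadratic relation, T_i f and T_i (T_i f) together determine t f.\<close>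

lemma T_simple_inj: "inj (T_simple i)"
proof (rule injI)
  fix f h assume e: "T_simple i f = T_simple i h"
  then have "T_simple i (T_simple i f) = T_simple i (T_simple i h)" by simp
  then have "Cst t_K * f = Cst t_K * h"
    using e unfolding T_simple_quadratic by (metis add_left_cancel)
  then show "f = h" by simp
qed

text \<open>The eigenvector equation simplifies to (t x_i - x_(i+1)) (sigma_i f - f) = 0. This is
  how the symmetry of \<open>P\<close> in the first m variables is obtained.\<close>

lemma T_simple_eigen_imp_invariant:
  assumes "T_simple i f = Cst t_K * f"
  shows "act (simple_refl i) f = f"
proof -
  have "(Cst t_K * X i - X (i + 1)) * (act (simple_refl i) f - f) = 0"
    using T_simple_eq[of i f] by (simp add: assms algebra_simps)
  moreover have "Cst t_K * X i - X (i + 1) \<noteq> 0"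
  proof
    assume "Cst t_K * X i - X (i + 1) = 0"
    then have "subst (\<lambda>j. if j = i then 1 else 0) (Cst t_K * X i - X (i + 1)) = 0" by simp
    then show False by (simp add: subst_diff subst_mult)
  qed
  ultimately show ?thesis by simp
qed

section \<open>Inversions and reduced words\<close>

text \<open>Inversions are recorded by positions, not values: composing with a simple reflection on
  the left then adds or removes one pair and leaves all others in place, so inversions with a
  condition on their columns can be counted along a word.\<close>

definition invs :: "nat \<Rightarrow> (nat \<Rightarrow> nat) \<Rightarrow> (nat \<times> nat) set" where
  "invs n \<pi> = {(p, p'). p \<in> {1..n} \<and> p' \<in> {1..n} \<and> p < p' \<and> \<pi> p > \<pi> p'}"

lemma finite_invs [simp]: "finite (invs n \<pi>)"
  by (rule finite_subset[of _ "{1..n} \<times> {1..n}"]) (auto simp: invs_def)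

lemma invs_id [simp]: "invs n id = {}" "invs n (\<lambda>p. p) = {}"
  by (auto simp: invs_def)

lemma simple_refl_permutes: "i \<in> {1..<n} \<Longrightarrow> simple_refl i permutes {1..n}"
  unfolding simple_refl_def by (rule permutes_swap_id) auto

lemma word_perm_simps:
  "word_perm [] = id" "word_perm (i # w) = simple_refl i \<circ> word_perm w"
  by (simp_all add: word_perm_def)

lemma word_perm_permutes: "set w \<subseteq> {1..<n} \<Longrightarrow> word_perm w permutes {1..n}"
proof (induction w)
  case (Cons i w)
  then show ?case
    unfolding word_perm_simps by (intro permutes_compose simple_refl_permutes) auto
qed (unfold word_perm_simps, rule permutes_id)

lemma invs_empty_imp_id:
  assumes p: "\<pi> permutes {1..n}" and e: "invs n \<pi> = {}"
  shows "\<pi> = id"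
proof -
  have inj: "inj \<pi>" using p by (rule permutes_inj)
  have less: "\<pi> i < \<pi> j" if "i \<in> {1..n}" "j \<in> {1..n}" "i < j" for i j
  proof -
    have "\<not> \<pi> i > \<pi> j" using e that by (auto simp: invs_def)
    moreover have "\<pi> i \<noteq> \<pi> j" using inj that by (auto dest: injD)
    ultimately show ?thesis by simp
  qed
  have ge: "i \<le> \<pi> i" if "i \<in> {1..n}" for i
    using that
  proof (induction i)
    case (Suc i)
    then show ?case
      using less[of i "Suc i"] permutes_in_image[OF p, of 1] by (cases "i = 0") auto
  qed simp
  \<comment> \<open>The values \<pi> i \<ge> i have the same sum as the i themselves, so no
    inequality is strict.\<close>
  have "sum \<pi> {1..n} = sum id {1..n}"
    using sum.permute[OF p, of id] by simp
  then have "\<pi> i = i" if "i \<in> {1..n}" for i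
    using sum_mono_inv[of id "{1..n}" \<pi> i] ge that by simp
  then show ?thesis
    using p by (auto simp: fun_eq_iff permutes_def)
qed

text \<open>Exchanging the values i and i + 1 affects no comparison except the one between them, so
  the only new pair consists of their two positions.\<close>

lemma invs_simple_refl:
  assumes p: "\<pi> permutes {1..n}" and i: "i \<in> {1..<n}" and l: "inv \<pi> i < inv \<pi> (i + 1)"
  shows "invs n (simple_refl i \<circ> \<pi>) = insert (inv \<pi> i, inv \<pi> (i + 1)) (invs n \<pi>)"
    and "(inv \<pi> i, inv \<pi> (i + 1)) \<notin> invs n \<pi>"
proof -
  have pi: "\<pi> (inv \<pi> j) = j" for j using p by (simp add: permutes_inverses)
  have eq: "\<pi> x = j \<longleftrightarrow> x = inv \<pi> j" for x j using p by (metis permutes_inverses(2) pi)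
  have in1: "inv \<pi> i \<in> {1..n}" "inv \<pi> (i + 1) \<in> {1..n}"
    using i permutes_in_image[OF permutes_inv[OF p]] by auto
  show "(inv \<pi> i, inv \<pi> (i + 1)) \<notin> invs n \<pi>" by (simp add: invs_def pi)
  have s: "simple_refl i (\<pi> x) = (if x = inv \<pi> i then i + 1 else if x = inv \<pi> (i + 1) then i else \<pi> x)" for x
    by (simp only: simple_refl_apply eq)
  have ne: "\<pi> x \<noteq> i" "\<pi> x \<noteq> i + 1" if "x \<noteq> inv \<pi> i" "x \<noteq> inv \<pi> (i + 1)" for x
    using that by (simp_all only: eq not_False_eq_True)
  have cmp: "x < y \<and> simple_refl i (\<pi> x) > simple_refl i (\<pi> y) \<longleftrightarrow>
      (x, y) = (inv \<pi> i, inv \<pi> (i + 1)) \<or> x < y \<and> \<pi> x > \<pi> y" for x y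
    unfolding s using l ne[of x] ne[of y] pi[of i] pi[of "i + 1"]
    by (cases "x = inv \<pi> i"; cases "x = inv \<pi> (i + 1)"; cases "y = inv \<pi> i";
        cases "y = inv \<pi> (i + 1)") (simp_all, linarith+)
  have "(x, y) \<in> invs n (simple_refl i \<circ> \<pi>) \<longleftrightarrow>
      (x, y) \<in> insert (inv \<pi> i, inv \<pi> (i + 1)) (invs n \<pi>)" for x y
    using cmp[of x y] in1 unfolding invs_def by auto
  then show "invs n (simple_refl i \<circ> \<pi>) = insert (inv \<pi> i, inv \<pi> (i + 1)) (invs n \<pi>)"
    by auto
qed

lemma inv_simple_refl:
  assumes p: "\<pi> permutes {1..n}"
  shows "inv (simple_refl i \<circ> \<pi>) j = inv \<pi> (simple_refl i j)"
proof -
  have "(simple_refl i \<circ> \<pi>) (inv \<pi> (simple_refl i j)) = j"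
    using p by (simp add: permutes_inverses simple_refl_def)
  moreover have "inj (simple_refl i \<circ> \<pi>)"
    using permutes_inj[OF p] by (intro inj_compose) (simp_all add: simple_refl_def)
  ultimately show ?thesis by (metis inv_f_f)
qed

lemma card_invs_simple_refl:
  assumes p: "\<pi> permutes {1..n}" and i: "i \<in> {1..<n}"
  shows "card (invs n (simple_refl i \<circ> \<pi>)) =
    (if inv \<pi> i < inv \<pi> (i + 1) then card (invs n \<pi>) + 1 else card (invs n \<pi>) - 1)"
    and "\<not> inv \<pi> i < inv \<pi> (i + 1) \<Longrightarrow> card (invs n \<pi>) \<noteq> 0"
proof -
  let ?\<rho> = "simple_refl i \<circ> \<pi>"
  have r: "?\<rho> permutes {1..n}" using p i by (intro permutes_compose simple_refl_permutes)
  have b: "simple_refl i \<circ> ?\<rho> = \<pi>" by (simp flip: comp_assoc)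
  have c: "card (invs n \<pi>) = card (invs n ?\<rho>) + 1" if "\<not> inv \<pi> i < inv \<pi> (i + 1)"
  proof -
    have "inv \<pi> i \<noteq> inv \<pi> (i + 1)" using p by (metis permutes_inverses(1) n_not_Suc_n Suc_eq_plus1)
    then have "inv ?\<rho> i < inv ?\<rho> (i + 1)"
      using that by (simp add: inv_simple_refl[OF p] simple_refl_apply)
    from invs_simple_refl[OF r i this] show ?thesis unfolding b by simp
  qed
  then show "\<not> inv \<pi> i < inv \<pi> (i + 1) \<Longrightarrow> card (invs n \<pi>) \<noteq> 0" by simp
  show "card (invs n ?\<rho>) =
    (if inv \<pi> i < inv \<pi> (i + 1) then card (invs n \<pi>) + 1 else card (invs n \<pi>) - 1)"
    using invs_simple_refl[OF p i] c by auto
qed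

lemma card_invs_word_perm_le:
  assumes "set w \<subseteq> {1..<n}"
  shows "card (invs n (word_perm w)) \<le> length w"
  using assms
proof (induction w)
  case Nil then show ?case unfolding word_perm_simps by simp
next
  case (Cons i w)
  have "card (invs n (word_perm (i # w))) \<le> card (invs n (word_perm w)) + 1"
    unfolding word_perm_simps
    using card_invs_simple_refl(1)[OF word_perm_permutes[of w n], of i] Cons.prems
    by (auto split: if_splits)
  then show ?case using Cons by simp
qed

lemma ex_word_perm:
  assumes "\<pi> permutes {1..n}"
  shows "\<exists>w. set w \<subseteq> {1..<n} \<and> word_perm w = \<pi> \<and> length w = card (invs n \<pi>)"
  using assms
proof (induction "card (invs n \<pi>)" arbitrary: \<pi>)
  case 0
  then have "\<pi> = id" by (intro invs_empty_imp_id[of _ n]) auto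
  then show ?case using 0 by (intro exI[of _ "[]"]) (simp add: word_perm_simps(1))
next
  case (Suc k)
  \<comment> \<open>If the inverse increased at every step it would be the identity, and \<pi> would
    have no inversions.\<close>
  have "\<exists>i\<in>{1..<n}. \<not> inv \<pi> i < inv \<pi> (i + 1)"
  proof (rule ccontr)
    assume "\<not> ?thesis"
    then have h: "inv \<pi> i < inv \<pi> (i + 1)" if "i \<in> {1..<n}" for i using that by auto
    have m: "inv \<pi> i < inv \<pi> j" if "i < j" "1 \<le> i" "j \<le> n" for i j
      using that
    proof (induction j)
      case (Suc j)
      then show ?case using h[of j] by (cases "i = j") auto
    qed simp
    then have "invs n (inv \<pi>) = {}" by (force simp: invs_def)
    then have "inv \<pi> = id" using permutes_inv[OF Suc.prems] by (rule invs_empty_imp_id[rotated])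
    then have "\<pi> = id" using Suc.prems by (metis inv_id permutes_inv_inv)
    then show False using Suc.hyps(2) by simp
  qed
  then obtain i where i: "i \<in> {1..<n}" "\<not> inv \<pi> i < inv \<pi> (i + 1)" by blast
  let ?\<rho> = "simple_refl i \<circ> \<pi>"
  have r: "?\<rho> permutes {1..n}" using Suc.prems i by (intro permutes_compose simple_refl_permutes)
  have "card (invs n ?\<rho>) = k"
    using card_invs_simple_refl(1)[OF Suc.prems i(1)] i Suc.hyps(2) by simp
  then obtain w where w: "set w \<subseteq> {1..<n}" "word_perm w = ?\<rho>" "length w = k"
    using Suc.hyps(1)[of ?\<rho>] r by auto
  then show ?case using i Suc.hyps(2) by (intro exI[of _ "i # w"]) (simp add: word_perm_simps(2) flip: comp_assoc)
qed

lemma cox_length_eq_card_invs: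
  assumes "\<pi> permutes {1..n}"
  shows "cox_length n \<pi> = card (invs n \<pi>)"
  unfolding cox_length_def
proof (rule Least_equality)
  show "\<exists>w. set w \<subseteq> {1..<n} \<and> word_perm w = \<pi> \<and> length w = card (invs n \<pi>)"
    using assms by (rule ex_word_perm)
  show "card (invs n \<pi>) \<le> k"
    if "\<exists>w. set w \<subseteq> {1..<n} \<and> word_perm w = \<pi> \<and> length w = k" for k
    using that card_invs_word_perm_le by blast
qed

lemma reduced_word_exists:
  assumes "\<pi> permutes {1..n}"
  shows "reduced_word n \<pi> (SOME w. reduced_word n \<pi> w)"
proof -
  obtain w where "set w \<subseteq> {1..<n}" "word_perm w = \<pi>" "length w = card (invs n \<pi>)"
    using ex_word_perm[OF assms] by blast
  then have "reduced_word n \<pi> w"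
    unfolding reduced_word_def cox_length_eq_card_invs[OF assms] by (intro conjI)
  then show ?thesis by (rule someI)
qed

text \<open>A letter adds at most one inversion. A word with as many letters as inversions must gain
  one at each letter, which is the ascent condition of the induction step.\<close>

lemma reduced_word_induct [consumes 1, case_names Nil Cons]:
  assumes "reduced_word n \<pi> w"
    and "P id []"
    and "\<And>i \<pi> w. i \<in> {1..<n} \<Longrightarrow> \<pi> permutes {1..n} \<Longrightarrow> inv \<pi> i < inv \<pi> (i + 1) \<Longrightarrow>
      P \<pi> w \<Longrightarrow> P (simple_refl i \<circ> \<pi>) (i # w)"
  shows "P \<pi> w"
proof -
  have "set w \<subseteq> {1..<n} \<Longrightarrow> length w = card (invs n (word_perm w)) \<Longrightarrow> P (word_perm w) w"
  proof (induction w)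
    case Nil show ?case unfolding word_perm_simps by (rule assms(2))
  next
    case (Cons i w)
    then have i: "i \<in> {1..<n}" and w: "set w \<subseteq> {1..<n}" by auto
    have p: "word_perm w permutes {1..n}" using w by (rule word_perm_permutes)
    have "card (invs n (word_perm w)) \<le> length w" using w by (rule card_invs_word_perm_le)
    then have l: "inv (word_perm w) i < inv (word_perm w) (i + 1)"
      and "length w = card (invs n (word_perm w))"
      using Cons.prems(2)[unfolded word_perm_simps card_invs_simple_refl(1)[OF p i]]
      by (auto split: if_splits)
    then show ?case unfolding word_perm_simps by (intro assms(3)[OF i p l] Cons.IH w)
  qed
  moreover have "\<pi> permutes {1..n}" "word_perm w = \<pi>"
    using assms(1) word_perm_permutes by (auto simp: reduced_word_def)
  ultimately show ?thesis
    using assms(1) cox_length_eq_card_invs[of \<pi> n] by (auto simp: reduced_word_def)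
qed

definition reversal :: "nat \<Rightarrow> nat \<Rightarrow> nat \<Rightarrow> nat" where
  "reversal a b p = (if p \<in> {a..b} then a + b - p else p)"

lemma reversal_invol [simp]: "reversal a b (reversal a b p) = p"
  by (auto simp: reversal_def)

lemma reversal_comp_invol [simp]: "reversal a b \<circ> reversal a b = id"
  by (auto simp: fun_eq_iff)

lemma reversal_permutes: "reversal a b permutes {a..b}"
  unfolding permutes_def
  by (metis reversal_def reversal_invol)

lemma invs_permutes_subset:
  assumes "\<pi> permutes {a..b}"
  shows "invs n \<pi> \<subseteq> {(p, p'). a \<le> p \<and> p < p' \<and> p' \<le> b}"
proof (clarify)
  fix p p' assume "(p, p') \<in> invs n \<pi>"
  then have h: "p < p'" "\<pi> p' < \<pi> p" by (auto simp: invs_def)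
  have f: "\<pi> x = x" if "x \<notin> {a..b}" for x using assms that by (simp add: permutes_def)
  have i: "\<pi> x \<in> {a..b}" if "x \<in> {a..b}" for x using permutes_in_image[OF assms] that by blast
  show "a \<le> p \<and> p < p' \<and> p' \<le> b"
    using h f[of p] f[of p'] i[of p] i[of p'] by (cases "p \<in> {a..b}"; cases "p' \<in> {a..b}") auto
qed

lemma invs_reversal:
  assumes "1 \<le> a" "b \<le> n"
  shows "invs n (reversal a b) = {(p, p'). a \<le> p \<and> p < p' \<and> p' \<le> b}"
  using assms by (auto simp: invs_def reversal_def split: if_splits)

text \<open>\<open>longest_elt\<close> is some maximizer of the length, so uniqueness has to be
  shown: a maximizer inverts every pair in the interval, hence its composition with the reversal
  inverts none and is the identity.\<close>

lemma longest_elt_eq_reversal: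
  assumes a: "1 \<le> a" and b: "b \<le> n"
  shows "longest_elt n a b = reversal a b"
proof -
  have sub: "{a..b} \<subseteq> {1..n}" using a b by auto
  have len: "cox_length n \<pi> = card (invs n \<pi>)" if "\<pi> permutes {a..b}" for \<pi>
    using permutes_subset[OF that sub] by (rule cox_length_eq_card_invs)
  have le: "invs n \<pi> \<subseteq> invs n (reversal a b)" if "\<pi> permutes {a..b}" for \<pi>
    using invs_permutes_subset[OF that, of n] by (simp only: invs_reversal[OF a b])
  have max: "is_arg_max (cox_length n) (\<lambda>\<pi>. \<pi> permutes {a..b}) (reversal a b)"
    using card_mono[OF finite_invs le] reversal_permutes len
    by (auto simp: is_arg_max_def not_less)
  have "\<pi> = reversal a b" if "is_arg_max (cox_length n) (\<lambda>\<pi>. \<pi> permutes {a..b}) \<pi>" for \<pi>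
  proof -
    have p: "\<pi> permutes {a..b}" using that by (simp add: is_arg_max_def)
    have "card (invs n (reversal a b)) \<le> card (invs n \<pi>)"
      using that reversal_permutes[of a b] len by (auto simp: is_arg_max_def not_less)
    then have e: "invs n \<pi> = invs n (reversal a b)"
      using le[OF p] by (intro card_seteq) auto
    have "invs n (\<pi> \<circ> reversal a b) = {}"
    proof (rule equals0I, clarify)
      fix x y assume xy: "(x, y) \<in> invs n (\<pi> \<circ> reversal a b)"
      have "\<pi> \<circ> reversal a b permutes {a..b}"
        by (intro permutes_compose p reversal_permutes)
      then have "a \<le> x" "x < y" "y \<le> b" using invs_permutes_subset[of _ a b n] xy by blast+
      then have "(reversal a b y, reversal a b x) \<in> invs n (reversal a b)"
        using a b by (auto simp: invs_reversal reversal_def)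
      then show False using xy unfolding e[symmetric] by (simp add: invs_def)
    qed
    moreover have "\<pi> \<circ> reversal a b permutes {1..n}"
      using permutes_subset[OF _ sub] p reversal_permutes by (auto intro: permutes_compose)
    ultimately have "\<pi> \<circ> reversal a b = id" by (intro invs_empty_imp_id)
    then have "(\<pi> \<circ> reversal a b) \<circ> reversal a b = reversal a b" by simp
    then show ?thesis unfolding comp_assoc by simp
  qed
  with max show ?thesis unfolding longest_elt_def arg_max_def by (metis someI)
qed

section \<open>Peeling a box off a filling\<close>

definition naf_weight :: "(nat \<Rightarrow> nat) \<Rightarrow> nat list \<Rightarrow> (nat \<times> nat \<Rightarrow> nat) \<Rightarrow> coef" where
  "naf_weight b \<mu> \<sigma> = q_K ^ maj \<mu> \<sigma> * t_K powi fill_coinv b \<mu> \<sigma> *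
     (\<Prod>u \<in> {u \<in> dg \<mu>. \<sigma> u \<noteq> \<sigma> (below u)}.
        (1 - t_K) / (1 - q_K ^ (leg \<mu> u + 1) * t_K ^ (arm \<mu> u + 1)))"

definition E_gen :: "(nat \<Rightarrow> nat) \<Rightarrow> nat list \<Rightarrow> mpol" where
  "E_gen b \<mu> = (\<Sum>\<sigma> \<in> NAF b \<mu>. Cst (naf_weight b \<mu> \<sigma>) * (\<Prod>u \<in> dg \<mu>. X (\<sigma> u)))"

lemma E_mac_eq_E_gen: "E_mac \<mu> = E_gen id \<mu>"
  by (simp add: E_mac_def E_gen_def naf_weight_def)

lemma mem_dg: "(i, r) \<in> dg \<mu> \<longleftrightarrow> 1 \<le> i \<and> i \<le> length \<mu> \<and> 1 \<le> r \<and> r \<le> part \<mu> i"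
  by (simp add: dg_def)

lemma mem_aug_dg: "(i, r) \<in> aug_dg \<mu> \<longleftrightarrow> 1 \<le> i \<and> i \<le> length \<mu> \<and> r \<le> part \<mu> i"
  by (auto simp: aug_dg_def dg_def)

lemma finite_dg [simp]: "finite (dg \<mu>)"
proof (rule finite_subset)
  show "dg \<mu> \<subseteq> Sigma {1..length \<mu>} (\<lambda>i. {1..part \<mu> i})" by (auto simp: dg_def)
qed simp

lemma finite_aug_dg [simp]: "finite (aug_dg \<mu>)"
proof (rule finite_subset)
  show "aug_dg \<mu> \<subseteq> Sigma {1..length \<mu>} (\<lambda>i. {0..part \<mu> i})" by (auto simp: mem_aug_dg)
qed simp

lemma finite_NAF [simp]: "finite (NAF b \<mu>)"
  unfolding NAF_def
  by (rule finite_subset[OF _ finite_PiE[of "aug_dg \<mu>" "\<lambda>_. {1..length \<mu>}"]]) auto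

text \<open>The two sets counted by \<open>arm\<close> lie on different sides of the column of the
  box, so their union keeps the count. A single permutation of the columns then compares arms in two
  diagrams.\<close>

definition arm_set :: "nat list \<Rightarrow> nat \<times> nat \<Rightarrow> nat set" where
  "arm_set \<mu> u = (case u of (i, r) \<Rightarrow>
     {i'. ((i', r) \<in> dg \<mu> \<and> i' < i \<and> part \<mu> i' \<le> part \<mu> i) \<or>
          ((i', r - 1) \<in> aug_dg \<mu> \<and> i' > i \<and> part \<mu> i' < part \<mu> i)})"

lemma arm_eq_card: "arm \<mu> u = card (arm_set \<mu> u)"
proof -
  obtain i r where u: "u = (i, r)" by fastforce
  have "card ({i'. (i', r) \<in> dg \<mu> \<and> i' < i \<and> part \<mu> i' \<le> part \<mu> i} \<union>
      {i'. (i', r - 1) \<in> aug_dg \<mu> \<and> i' > i \<and> part \<mu> i' < part \<mu> i}) = arm \<mu> u"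
    unfolding arm_def u prod.case
    by (rule card_Un_disjoint) (auto simp: mem_dg mem_aug_dg intro: finite_subset[of _ "{1..length \<mu>}"])
  then show ?thesis by (simp add: arm_set_def u Collect_disj_eq)
qed

text \<open>Sends a column of the peeled shape to the column it came from: the columns after column
  k + 1 have moved one place to the left, and column k + 1 has become the last.\<close>

definition rot :: "nat \<Rightarrow> nat \<Rightarrow> nat \<Rightarrow> nat" where
  "rot k n i = (if k < i \<and> i < n then i + 1 else if i = n then k + 1 else i)"

lemma rot_permutes:
  assumes "k < n"
  shows "rot k n permutes {1..n}"
proof (rule bij_imp_permutes)
  have "inj_on (rot k n) {1..n}" using assms by (auto simp: inj_on_def rot_def)
  moreover have "rot k n ` {1..n} \<subseteq> {1..n}" using assms by (auto simp: rot_def)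
  ultimately show "bij_betw (rot k n) {1..n} {1..n}"
    by (simp add: bij_betw_def endo_inj_surj)
qed (use assms in \<open>auto simp: rot_def\<close>)

text \<open>\<open>b \<circ> peel_perm k n j\<close> is the new basement. The removed box, with
  entry \<open>b j\<close>, becomes the basement of the last column; if j \<le> k, the old value
  \<open>b (k + 1)\<close> fills the place j that this leaves vacant among the empty
  columns.\<close>

definition peel_perm :: "nat \<Rightarrow> nat \<Rightarrow> nat \<Rightarrow> nat \<Rightarrow> nat" where
  "peel_perm k n j = transpose j (k + 1) \<circ> rot k n"

lemma peel_perm_permutes:
  assumes "k < n" "j \<in> {1..k + 1}"
  shows "peel_perm k n j permutes {1..n}"
  unfolding peel_perm_def using assms
  by (intro permutes_compose rot_permutes permutes_swap_id) auto

definition peel_shape :: "nat \<Rightarrow> nat list \<Rightarrow> nat list" where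
  "peel_shape k \<mu> = replicate k 0 @ drop (k + 1) \<mu> @ [part \<mu> (k + 1) - 1]"

lemma length_peel_shape: "k < length \<mu> \<Longrightarrow> length (peel_shape k \<mu>) = length \<mu>"
  by (simp add: peel_shape_def)

lemma part_peel_shape:
  assumes "k < length \<mu>" "i \<in> {1..length \<mu>}"
  shows "part (peel_shape k \<mu>) i =
    (if i \<le> k then 0 else if i < length \<mu> then part \<mu> (i + 1) else part \<mu> (k + 1) - 1)"
  using assms
  by (auto simp: peel_shape_def part_def nth_append nth_Cons' less_Suc_eq)

text \<open>The columns counted by the arm of the removed box (k + 1, 1); the columns to its left
  are empty and contribute nothing.\<close>

definition short_cols :: "nat \<Rightarrow> nat list \<Rightarrow> nat set" where
  "short_cols k \<mu> = {p. k + 1 < p \<and> p \<le> length \<mu> \<and> part \<mu> p < part \<mu> (k + 1)}"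

text \<open>The summand is \<open>1\<close> if \<open>b p\<close> comes strictly between \<open>b j\<close> and \<open>b (k + 1)\<close> in the cyclic order
  of \<open>1, \<dots>, n\<close>, and \<open>0\<close> otherwise.\<close>

definition peel_exp :: "nat \<Rightarrow> nat list \<Rightarrow> (nat \<Rightarrow> nat) \<Rightarrow> nat \<Rightarrow> int" where
  "peel_exp k \<mu> b j = (\<Sum>p \<in> short_cols k \<mu>.
     1 + of_bool (b j > b (k + 1)) - of_bool (b p > b (k + 1)) - of_bool (b j > b p))"

definition peel_factor :: "nat \<Rightarrow> nat list \<Rightarrow> coef" where
  "peel_factor k \<mu> =
    (1 - t_K) / (1 - q_K ^ part \<mu> (k + 1) * t_K ^ (card (short_cols k \<mu>) + 1))"

text \<open>The contribution of the removed box. Its leg plus one is the height of its column; it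
  differs from the box below exactly if j \<noteq> k + 1, and is a descent exactly if
  \<open>b j > b (k + 1)\<close>.\<close>

definition peel_wt :: "nat \<Rightarrow> nat list \<Rightarrow> (nat \<Rightarrow> nat) \<Rightarrow> nat \<Rightarrow> coef" where
  "peel_wt k \<mu> b j = (if j = k + 1 then 1 else peel_factor k \<mu>) *
     q_K ^ (if b j > b (k + 1) then part \<mu> (k + 1) else 0) * t_K powi peel_exp k \<mu> b j"

lemma finite_short_cols [simp]: "finite (short_cols k \<mu>)"
  by (rule finite_subset[of _ "{..length \<mu>}"]) (auto simp: short_cols_def)

section \<open>The diagrams before and after peeling\<close>

locale peel =
  fixes k n :: nat and \<mu> :: "nat list" and b :: "nat \<Rightarrow> nat" and j :: nat
  assumes n: "length \<mu> = n" and k: "k < n"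
    and zero: "\<And>i. 1 \<le> i \<Longrightarrow> i \<le> k \<Longrightarrow> part \<mu> i = 0"
    and pos: "part \<mu> (k + 1) \<ge> 1"
    and b: "b permutes {1..n}" and j: "1 \<le> j" "j \<le> k + 1"
begin

abbreviation "\<mu>' \<equiv> peel_shape k \<mu>"
abbreviation "a \<equiv> part \<mu> (k + 1)"
definition "b' = b \<circ> peel_perm k n j"

lemma n': "length \<mu>' = n"
  using n k by (simp add: length_peel_shape)

lemma part':
  "1 \<le> i \<Longrightarrow> i \<le> k \<Longrightarrow> part \<mu>' i = 0"
  "k < i \<Longrightarrow> i < n \<Longrightarrow> part \<mu>' i = part \<mu> (i + 1)"
  "part \<mu>' n = a - 1"
  using part_peel_shape[of k \<mu> i] part_peel_shape[of k \<mu> n] n k by auto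

lemma b'_vals:
  "k < i \<Longrightarrow> i < n \<Longrightarrow> b' i = b (i + 1)"
  "b' n = b j"
  using k j by (auto simp: b'_def peel_perm_def rot_def transpose_def)

lemma b'_permutes: "b' permutes {1..n}"
  unfolding b'_def using b k j by (intro permutes_compose peel_perm_permutes) auto

lemma b_inj: "b x = b y \<longleftrightarrow> x = y"
  using permutes_inj[OF b] by (auto dest: injD)

lemma b'_inj: "b' x = b' y \<longleftrightarrow> x = y"
  using permutes_inj[OF b'_permutes] by (auto dest: injD)

text \<open>\<open>up\<close> embeds the boxes of the peeled diagram outside the zero columns into the diagram of
  \<open>\<mu>\<close>; it misses the basement box \<open>(k + 1, 0)\<close> of the peeled column, whose first box becomes
  the basement of the last column.\<close>

definition up :: "nat \<times> nat \<Rightarrow> nat \<times> nat" where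
  "up u = (if fst u < n then (fst u + 1, snd u) else (k + 1, snd u + 1))"

definition down :: "nat \<times> nat \<Rightarrow> nat \<times> nat" where
  "down u = (if fst u = k + 1 then (n, snd u - 1) else (fst u - 1, snd u))"

text \<open>The part common to both augmented diagrams, basement included. The remaining boxes,
  \<open>low\<close> and \<open>low'\<close>, lie in the basement and are in conflict only with
  other basement boxes.\<close>

definition core :: "(nat \<times> nat) set" where
  "core = {(i, r). k < i \<and> i \<le> n \<and> r \<le> part \<mu>' i}"

definition low :: "(nat \<times> nat) set" where
  "low = {(i, r). 1 \<le> i \<and> i \<le> k + 1 \<and> r = 0}"

definition low' :: "(nat \<times> nat) set" where
  "low' = {(i, r). 1 \<le> i \<and> i \<le> k \<and> r = 0}"

lemma down_up: "u \<in> core \<Longrightarrow> down (up u) = u"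
  by (auto simp: core_def up_def down_def)

lemma inj_on_up: "inj_on up core"
  by (metis down_up inj_onI)

lemma aug_dg': "aug_dg \<mu>' = core \<union> low'"
  using k n' part'(1) by (auto simp: mem_aug_dg core_def low'_def)

lemma aug_dg: "aug_dg \<mu> = up ` core \<union> low"
proof (rule set_eqI, clarify)
  fix i r
  have "(i, r) \<in> up ` core \<longleftrightarrow> (k + 1 < i \<and> i \<le> n \<and> r \<le> part \<mu> i) \<or> (i = k + 1 \<and> 1 \<le> r \<and> r \<le> a)"
  proof
    assume "(i, r) \<in> up ` core"
    then show "(k + 1 < i \<and> i \<le> n \<and> r \<le> part \<mu> i) \<or> (i = k + 1 \<and> 1 \<le> r \<and> r \<le> a)"
      using pos part'(2,3) by (auto simp: core_def up_def split: if_splits)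
  next
    assume h: "(k + 1 < i \<and> i \<le> n \<and> r \<le> part \<mu> i) \<or> (i = k + 1 \<and> 1 \<le> r \<and> r \<le> a)"
    then have "down (i, r) \<in> core" "up (down (i, r)) = (i, r)"
      using k part'(2)[of "i - 1"] part'(3) by (auto simp: core_def up_def down_def)
    then show "(i, r) \<in> up ` core" by (metis imageI)
  qed
  then show "(i, r) \<in> aug_dg \<mu> \<longleftrightarrow> (i, r) \<in> up ` core \<union> low"
    using n k zero[of i]
    by (cases "i \<le> k"; cases "i = k + 1") (auto simp: mem_aug_dg low_def not_less_eq_eq)
qed

lemma finite_core [simp]: "finite core"
  using aug_dg' finite_aug_dg[of \<mu>'] by simp

lemma dg'_core: "dg \<mu>' \<subseteq> core"
proof
  fix u assume "u \<in> dg \<mu>'"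
  then have "u \<in> aug_dg \<mu>'" "snd u \<ge> 1" by (auto simp: aug_dg_def dg_def)
  then show "u \<in> core" unfolding aug_dg' by (auto simp: low'_def)
qed

lemma dg: "dg \<mu> = insert (k + 1, 1) (up ` dg \<mu>')"
proof -
  have "dg \<mu> = {u \<in> aug_dg \<mu>. snd u \<ge> 1}" by (auto simp: aug_dg_def dg_def)
  also have "\<dots> = up ` {u \<in> core. snd (up u) \<ge> 1}" by (auto simp: aug_dg low_def)
  \<comment> \<open>The basement box of the last column is the only one that \<open>up\<close>
    raises out of row 0.\<close>
  also have "{u \<in> core. snd (up u) \<ge> 1} = insert (n, 0) (dg \<mu>')"
  proof (intro equalityI subsetI)
    fix u assume "u \<in> {u \<in> core. snd (up u) \<ge> 1}"
    then show "u \<in> insert (n, 0) (dg \<mu>')"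
      using n' by (cases u) (auto simp: core_def up_def mem_dg split: if_splits)
  next
    fix u assume "u \<in> insert (n, 0) (dg \<mu>')"
    moreover have "(n, 0) \<in> core" using k by (simp add: core_def)
    moreover have "snd u \<ge> 1" if "u \<in> dg \<mu>'" using that by (auto simp: dg_def)
    ultimately show "u \<in> {u \<in> core. snd (up u) \<ge> 1}" using dg'_core by (auto simp: up_def)
  qed
  finally show ?thesis by (simp add: up_def)
qed

lemma up_not_first: "(k + 1, 1) \<notin> up ` dg \<mu>'"
  using part'(1)[of k] by (auto simp: up_def dg_def)

lemma up_below: "u \<in> dg \<mu>' \<Longrightarrow> below (up u) = up (below u)"
  by (auto simp: below_def up_def dg_def)

lemma below_core: "u \<in> dg \<mu>' \<Longrightarrow> below u \<in> core"
  using dg'_core by (auto simp: below_def core_def dg_def)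

lemma leg_up: "u \<in> dg \<mu>' \<Longrightarrow> leg \<mu> (up u) = leg \<mu>' u"
  using dg'_core part' by (auto simp: leg_def up_def core_def)

text \<open>A box in the last column and row r is in conflict with the boxes of the other core
  columns in rows r and r + 1. At its new place in column k + 1, row r + 1, these are the boxes to
  its right in the same row and in the row below, which are again the ones in conflict with
  it.\<close>

lemma attack_up:
  assumes "u \<in> core" "v \<in> core"
  shows "attack (up u) (up v) \<longleftrightarrow> attack u v"
  using assms by (cases u; cases v) (auto simp: attack_def up_def core_def)

lemma reads_before_up:
  assumes "u \<in> core" "v \<in> core" "attack u v"
  shows "reads_before (up u) (up v) \<longleftrightarrow> reads_before u v"
  using assms by (cases u; cases v) (auto simp: attack_def reads_before_def up_def core_def)

text \<open>Relative to the moved column, the conditions "left, same row, at most as high" and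
  "right, one row below, strictly lower" turn into each other, because its height and the rows of
  its boxes differ by one in the two shapes. All other columns keep their order.\<close>

lemma arm_up:
  assumes "u \<in> dg \<mu>'"
  shows "arm \<mu> (up u) = arm \<mu>' u"
proof -
  obtain i r where u: "u = (i, r)" by fastforce
  have i: "k < i" "i \<le> n" "1 \<le> r" "r \<le> part \<mu>' i"
    using assms dg'_core by (auto simp: u core_def dg_def)
  have P: "rot k n permutes {1..n}" using k by (rule rot_permutes)
  have eq: "rot k n x \<in> arm_set \<mu> (up u) \<longleftrightarrow> x \<in> arm_set \<mu>' u" if x: "x \<in> {1..n}" for x
  proof -
    consider "x \<le> k" | "k < x" "x < n" | "x = n" using x by force
    then show ?thesis
    proof cases
      case 1
      then show ?thesis using i k x zero[of x] part'(1)[of x] n n'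
        by (auto simp: arm_set_def u up_def rot_def mem_dg mem_aug_dg)
    next
      case 2
      then show ?thesis using i k pos part'(2)[of x] part'(2)[of i] part'(3) n n'
        by (auto simp: arm_set_def u up_def rot_def mem_dg mem_aug_dg)
    next
      case 3
      then show ?thesis using i k pos part'(2)[of i] part'(3) n n'
        by (auto simp: arm_set_def u up_def rot_def mem_dg mem_aug_dg)
    qed
  qed
  have sub: "arm_set \<mu> (up u) \<subseteq> {1..n}" "arm_set \<mu>' u \<subseteq> {1..n}"
    using n n' by (auto simp: arm_set_def mem_dg mem_aug_dg split: prod.splits)
  have "arm_set \<mu> (up u) = rot k n ` arm_set \<mu>' u"
  proof (intro set_eqI iffI)
    fix y assume y: "y \<in> arm_set \<mu> (up u)"
    then obtain x where "x \<in> {1..n}" "y = rot k n x"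
      using sub permutes_image[OF P] by blast
    then show "y \<in> rot k n ` arm_set \<mu>' u" using y eq by blast
  next
    fix y assume "y \<in> rot k n ` arm_set \<mu>' u"
    then show "y \<in> arm_set \<mu> (up u)" using sub eq by blast
  qed
  then show ?thesis
    using permutes_inj_on[OF P] by (simp add: arm_eq_card card_image)
qed

lemma arm_first: "arm \<mu> (k + 1, 1) = card (short_cols k \<mu>)"
proof -
  have "arm_set \<mu> (k + 1, 1) = short_cols k \<mu>"
    using zero n by (auto simp: arm_set_def short_cols_def mem_dg mem_aug_dg)
  then show ?thesis by (simp add: arm_eq_card)
qed

lemma leg_first: "leg \<mu> (k + 1, 1) + 1 = a"
  using pos by (simp add: leg_def)

text \<open>The value \<open>undefined\<close> off the diagram makes the result extensional, as
  membership in \<open>NAF\<close> demands.\<close>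

definition lift :: "(nat \<times> nat \<Rightarrow> nat) \<Rightarrow> nat \<times> nat \<Rightarrow> nat" where
  "lift \<sigma> u = (if u \<in> up ` core then \<sigma> (down u) else if u \<in> low then b (fst u) else undefined)"

definition drop_box :: "(nat \<times> nat \<Rightarrow> nat) \<Rightarrow> nat \<times> nat \<Rightarrow> nat" where
  "drop_box \<sigma> u = (if u \<in> core then \<sigma> (up u) else if u \<in> low' then b' (fst u) else undefined)"

lemma low_disjoint: "u \<in> core \<Longrightarrow> up u \<notin> low" "u \<in> core \<Longrightarrow> u \<notin> low'"
  by (auto simp: core_def low_def low'_def up_def)

text \<open>A box in row 1 attacks (i, 0) only from a column to the left of i, and for i \<le> k + 1
  these columns are empty.\<close>

lemma attack_low_up:
  assumes "u \<in> low" "v \<in> aug_dg \<mu>" "attack u v \<or> attack v u"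
  shows "snd v = 0"
proof -
  obtain i where u: "u = (i, 0)" "1 \<le> i" "i \<le> k + 1" using assms(1) by (auto simp: low_def)
  obtain c r where v: "v = (c, r)" by fastforce
  have c: "1 \<le> c" "r \<le> part \<mu> c" using assms(2) by (auto simp: v mem_aug_dg)
  show ?thesis using assms(3) c zero[of c] u by (auto simp: attack_def v)
qed

lemma attack_low'_core:
  assumes "u \<in> low'" "v \<in> aug_dg \<mu>'" "attack u v \<or> attack v u"
  shows "snd v = 0"
proof -
  obtain i where u: "u = (i, 0)" "1 \<le> i" "i \<le> k" using assms(1) by (auto simp: low'_def)
  obtain c r where v: "v = (c, r)" by fastforce
  have c: "1 \<le> c" "r \<le> part \<mu>' c" using assms(2) by (auto simp: v mem_aug_dg)
  show ?thesis using assms(3) c part'(1)[of c] u by (auto simp: attack_def v)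
qed


text \<open>Correspondence of fillings under peeling. Comparing the statistics for a relation, and
  not for one of the two maps, serves both directions of the bijection.\<close>

definition compat :: "(nat \<times> nat \<Rightarrow> nat) \<Rightarrow> (nat \<times> nat \<Rightarrow> nat) \<Rightarrow> bool" where
  "compat \<sigma> \<sigma>' \<longleftrightarrow> (\<forall>u\<in>core. \<sigma> (up u) = \<sigma>' u) \<and>
     (\<forall>i. 1 \<le> i \<longrightarrow> i \<le> n \<longrightarrow> \<sigma> (i, 0) = b i \<and> \<sigma>' (i, 0) = b' i)"

section \<open>Change of the statistics under peeling\<close>

lemma dg_Collect:
  "{u \<in> dg \<mu>. Q u} = (if Q (k + 1, 1) then {(k + 1, 1)} else {}) \<union> up ` {u \<in> dg \<mu>'. Q (up u)}"
  unfolding dg by auto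

lemma sum_dg_Collect:
  "(\<Sum>u\<in>{u \<in> dg \<mu>. Q u}. f u) =
    (if Q (k + 1, 1) then f (k + 1, 1) else 0) + (\<Sum>u\<in>{u \<in> dg \<mu>'. Q (up u)}. f (up u))"
proof -
  have "inj_on up {u \<in> dg \<mu>'. Q (up u)}"
    using inj_on_up dg'_core by (rule inj_on_subset[OF _ subset_trans[rotated]]) auto
  moreover have "(\<Sum>u\<in>{u \<in> dg \<mu>. Q u}. f u) =
    (if Q (k + 1, 1) then f (k + 1, 1) else 0) + (\<Sum>u\<in>up ` {u \<in> dg \<mu>'. Q (up u)}. f u)"
    unfolding dg_Collect using up_not_first by (subst sum.union_disjoint) auto
  ultimately show ?thesis by (simp add: sum.reindex)
qed

lemma prod_dg_Collect:
  "(\<Prod>u\<in>{u \<in> dg \<mu>. Q u}. f u) =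
    (if Q (k + 1, 1) then f (k + 1, 1) else 1) * (\<Prod>u\<in>{u \<in> dg \<mu>'. Q (up u)}. f (up u))"
proof -
  have "inj_on up {u \<in> dg \<mu>'. Q (up u)}"
    using inj_on_up dg'_core by (rule inj_on_subset[OF _ subset_trans[rotated]]) auto
  moreover have "(\<Prod>u\<in>{u \<in> dg \<mu>. Q u}. f u) =
    (if Q (k + 1, 1) then f (k + 1, 1) else 1) * (\<Prod>u\<in>up ` {u \<in> dg \<mu>'. Q (up u)}. f u)"
    unfolding dg_Collect using up_not_first by (subst prod.union_disjoint) auto
  ultimately show ?thesis by (simp add: prod.reindex)
qed

lemma compat_first:
  assumes "compat \<sigma> \<sigma>'"
  shows "\<sigma> (k + 1, 1) = b j" "\<sigma> (below (k + 1, 1)) = b (k + 1)"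
proof -
  have "(n, 0) \<in> core" "up (n, 0) = (k + 1, 1)" using k by (auto simp: core_def up_def)
  then show "\<sigma> (k + 1, 1) = b j" using assms k b'_vals(2) by (auto simp: compat_def)
  show "\<sigma> (below (k + 1, 1)) = b (k + 1)" using assms k by (auto simp: compat_def below_def)
qed

lemma compat_up:
  assumes "compat \<sigma> \<sigma>'" "u \<in> dg \<mu>'"
  shows "\<sigma> (up u) = \<sigma>' u" "\<sigma> (below (up u)) = \<sigma>' (below u)"
  using assms dg'_core below_core[of u] by (auto simp: compat_def up_below)

lemma sum_descents:
  assumes c: "compat \<sigma> \<sigma>'"
  shows "(\<Sum>u\<in>descents \<mu> \<sigma>. f u) =
    (if b j > b (k + 1) then f (k + 1, 1) else 0) + (\<Sum>u\<in>descents \<mu>' \<sigma>'. f (up u))"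
proof -
  have "{u \<in> dg \<mu>'. \<sigma> (below (up u)) < \<sigma> (up u)} = descents \<mu>' \<sigma>'"
    using compat_up[OF c] by (auto simp: descents_def)
  then show ?thesis
    unfolding descents_def[of \<mu>] sum_dg_Collect compat_first[OF c] by simp
qed

lemma maj_compat:
  assumes "compat \<sigma> \<sigma>'"
  shows "maj \<mu> \<sigma> = (if b j > b (k + 1) then a else 0) + maj \<mu>' \<sigma>'"
proof -
  have "(\<Sum>u\<in>descents \<mu>' \<sigma>'. leg \<mu> (up u) + 1) = maj \<mu>' \<sigma>'"
    unfolding maj_def by (rule sum.cong) (auto simp: leg_up descents_def)
  then show ?thesis unfolding maj_def[of \<mu>] sum_descents[OF assms] leg_first by simp
qed

lemma prod_compat:
  assumes "compat \<sigma> \<sigma>'"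
  shows "(\<Prod>u \<in> {u \<in> dg \<mu>. \<sigma> u \<noteq> \<sigma> (below u)}.
      (1 - t_K) / (1 - q_K ^ (leg \<mu> u + 1) * t_K ^ (arm \<mu> u + 1))) =
    (if j = k + 1 then 1 else peel_factor k \<mu>) *
    (\<Prod>u \<in> {u \<in> dg \<mu>'. \<sigma>' u \<noteq> \<sigma>' (below u)}.
      (1 - t_K) / (1 - q_K ^ (leg \<mu>' u + 1) * t_K ^ (arm \<mu>' u + 1)))"
proof -
  have *: "{u \<in> dg \<mu>'. \<sigma> (up u) \<noteq> \<sigma> (below (up u))} = {u \<in> dg \<mu>'. \<sigma>' u \<noteq> \<sigma>' (below u)}"
    using compat_up[OF assms] by auto
  show ?thesis
    unfolding prod_dg_Collect compat_first[OF assms] * leg_first arm_first b_inj peel_factor_def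
    by (auto simp: leg_up arm_up intro!: prod.cong)
qed

lemma prod_X_compat:
  assumes "compat \<sigma> \<sigma>'"
  shows "(\<Prod>u \<in> dg \<mu>. X (\<sigma> u)) = X (b j) * (\<Prod>u \<in> dg \<mu>'. X (\<sigma>' u))"
  using prod_dg_Collect[of "\<lambda>u. X (\<sigma> u)" "\<lambda>_. True"] compat_first[OF assms] compat_up[OF assms]
  by (simp cong: prod.cong)

text \<open>The pairs subtracted in \<open>fill_inv\<close>.\<close>

definition pos_pairs :: "nat list \<Rightarrow> (nat \<Rightarrow> nat) \<Rightarrow> (nat \<times> nat) set" where
  "pos_pairs \<nu> c = {(i, i'). 1 \<le> i \<and> i < i' \<and> i' \<le> length \<nu> \<and> part \<nu> i \<le> part \<nu> i' \<and> c i < c i'}"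

text \<open>Basement inversions whose left box is in one of the first l columns. Row 0 is read from
  right to left, hence the condition \<open>c i < c i'\<close>.\<close>

definition head_pairs :: "nat \<Rightarrow> (nat \<Rightarrow> nat) \<Rightarrow> (nat \<times> nat) set" where
  "head_pairs l c = {(i, i'). 1 \<le> i \<and> i \<le> l \<and> i < i' \<and> i' \<le> n \<and> c i < c i'}"

lemma finite_pairs [simp]: "finite (pos_pairs \<nu> c)" "finite (head_pairs l c)"
  by (rule finite_subset[of _ "{..length \<nu>} \<times> {..length \<nu>}"]; auto simp: pos_pairs_def)
    (rule finite_subset[of _ "{..l} \<times> {..n}"]; auto simp: head_pairs_def)

lemma finite_Inv_set [simp]: "finite (Inv_set \<nu> \<sigma>)"
  by (rule finite_subset[of _ "aug_dg \<nu> \<times> aug_dg \<nu>"]) (auto simp: Inv_set_def)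

definition core_invs :: "(nat \<times> nat \<Rightarrow> nat) \<Rightarrow> ((nat \<times> nat) \<times> nat \<times> nat) set" where
  "core_invs \<sigma> = {(u, v). u \<in> core \<and> v \<in> core \<and> attack u v \<and> reads_before u v \<and> \<sigma> u > \<sigma> v}"

text \<open>An inversion with a box in \<open>low\<close> lies entirely in the basement; all others
  come from pairs in \<open>core\<close>. The latter are the same for both fillings and cancel in
  the comparison.\<close>

lemma card_Inv_set:
  assumes c: "compat \<sigma> \<sigma>'"
  shows "card (Inv_set \<mu> \<sigma>) = card (core_invs \<sigma>') + card (head_pairs (k + 1) b)"
proof -
  let ?h = "\<lambda>(i, i'). ((i', 0::nat), (i, 0::nat))"
  have "Inv_set \<mu> \<sigma> = map_prod up up ` core_invs \<sigma>' \<union> ?h ` head_pairs (k + 1) b"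
    (is "_ = ?A \<union> ?B")
  proof (intro set_eqI iffI)
    fix x assume x: "x \<in> Inv_set \<mu> \<sigma>"
    obtain u v where uv: "x = (u, v)" by (rule prod.exhaust)
    have h: "u \<in> aug_dg \<mu>" "v \<in> aug_dg \<mu>" "attack u v" "reads_before u v" "\<sigma> u > \<sigma> v"
      using x by (auto simp: uv Inv_set_def)
    show "x \<in> ?A \<union> ?B"
    proof (cases "u \<in> low \<or> v \<in> low")
      case True
      then have "snd u = 0" "snd v = 0"
        using attack_low_up[of u v] attack_low_up[of v u] h by (auto simp: low_def)
      then obtain i i' where i: "u = (i', 0)" "v = (i, 0)" by (metis prod.collapse)
      have "1 \<le> i" "i \<le> n" "1 \<le> i'" "i' \<le> n" using h(1,2) n by (auto simp: i mem_aug_dg)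
      moreover have "i < i'" using h(4) by (simp add: i reads_before_def)
      moreover have "i \<le> k + 1" using True \<open>i < i'\<close> by (auto simp: i low_def)
      ultimately have "(i, i') \<in> head_pairs (k + 1) b"
        using h(5) c by (auto simp: i head_pairs_def compat_def)
      then show ?thesis by (force simp: uv i)
    next
      case False
      then obtain u' v' where u': "u = up u'" "v = up v'" "u' \<in> core" "v' \<in> core"
        using h(1,2) unfolding aug_dg by auto
      then have "(u', v') \<in> core_invs \<sigma>'"
        using h c attack_up[of u' v'] reads_before_up[of u' v']
        by (auto simp: core_invs_def compat_def)
      then show ?thesis by (force simp: uv u')
    qed
  next
    fix x assume "x \<in> ?A \<union> ?B"
    then show "x \<in> Inv_set \<mu> \<sigma>"
    proof
      assume "x \<in> ?A"
      then show ?thesis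
        using c attack_up reads_before_up
        by (auto simp: core_invs_def Inv_set_def aug_dg compat_def)
    next
      assume "x \<in> ?B"
      then show ?thesis
        using c n k by (auto simp: head_pairs_def Inv_set_def mem_aug_dg compat_def attack_def
            reads_before_def)
    qed
  qed
  moreover have "inj_on (map_prod up up) (core_invs \<sigma>')"
    using map_prod_inj_on[OF inj_on_up inj_on_up]
    by (rule inj_on_subset) (auto simp: core_invs_def)
  moreover have "inj_on ?h (head_pairs (k + 1) b)" by (auto simp: inj_on_def)
  moreover have "?A \<inter> ?B = {}"
  proof (rule equals0I)
    fix x assume x: "x \<in> ?A \<inter> ?B"
    then obtain v where "v \<in> core" "snd x = up v" by (auto simp: core_invs_def)
    moreover have "snd x \<in> low" using x by (auto simp: head_pairs_def low_def)
    ultimately show False using low_disjoint(1) by metis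
  qed
  moreover have "finite (core_invs \<sigma>')"
    by (rule finite_subset[of _ "core \<times> core"]) (auto simp: core_invs_def)
  ultimately show ?thesis by (simp add: card_Un_disjoint card_image)
qed

lemma card_Inv_set':
  assumes c: "compat \<sigma> \<sigma>'"
  shows "card (Inv_set \<mu>' \<sigma>') = card (core_invs \<sigma>') + card (head_pairs k b')"
proof -
  let ?h = "\<lambda>(i, i'). ((i', 0::nat), (i, 0::nat))"
  have "Inv_set \<mu>' \<sigma>' = core_invs \<sigma>' \<union> ?h ` head_pairs k b'" (is "_ = ?A \<union> ?B")
  proof (intro set_eqI iffI)
    fix x assume x: "x \<in> Inv_set \<mu>' \<sigma>'"
    obtain u v where uv: "x = (u, v)" by (rule prod.exhaust)
    have h: "u \<in> aug_dg \<mu>'" "v \<in> aug_dg \<mu>'" "attack u v" "reads_before u v" "\<sigma>' u > \<sigma>' v"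
      using x by (auto simp: uv Inv_set_def)
    show "x \<in> ?A \<union> ?B"
    proof (cases "u \<in> low' \<or> v \<in> low'")
      case True
      then have "snd u = 0" "snd v = 0"
        using attack_low'_core[of u v] attack_low'_core[of v u] h by (auto simp: low'_def)
      then obtain i i' where i: "u = (i', 0)" "v = (i, 0)" by (metis prod.collapse)
      have "1 \<le> i" "i \<le> n" "1 \<le> i'" "i' \<le> n" using h(1,2) n' by (auto simp: i mem_aug_dg)
      moreover have "i < i'" using h(4) by (simp add: i reads_before_def)
      moreover have "i \<le> k" using True \<open>i < i'\<close> by (auto simp: i low'_def)
      ultimately have "(i, i') \<in> head_pairs k b'"
        using h(5) c by (auto simp: i head_pairs_def compat_def)
      then show ?thesis by (force simp: uv i)
    next
      case False
      then show ?thesis using h unfolding aug_dg' by (auto simp: uv core_invs_def)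
    qed
  next
    fix x assume "x \<in> ?A \<union> ?B"
    then show "x \<in> Inv_set \<mu>' \<sigma>'"
    proof
      assume "x \<in> ?A"
      then show ?thesis by (auto simp: core_invs_def Inv_set_def aug_dg')
    next
      assume "x \<in> ?B"
      then show ?thesis
        using c n' k by (auto simp: head_pairs_def Inv_set_def mem_aug_dg compat_def attack_def
            reads_before_def)
    qed
  qed
  moreover have "inj_on ?h (head_pairs k b')" by (auto simp: inj_on_def)
  moreover have "?A \<inter> ?B = {}"
    by (auto simp: core_invs_def head_pairs_def core_def)
  moreover have "finite (core_invs \<sigma>')"
    by (rule finite_subset[of _ "core \<times> core"]) (auto simp: core_invs_def)
  ultimately show ?thesis by (simp add: card_Un_disjoint card_image)
qed


definition tail_pairs :: "(nat \<times> nat) set" where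
  "tail_pairs = {(i, i'). k + 1 < i \<and> i < i' \<and> i' \<le> n \<and> part \<mu> i \<le> part \<mu> i' \<and> b i < b i'}"

lemma finite_tail_pairs [simp]: "finite tail_pairs"
  by (rule finite_subset[of _ "{..n} \<times> {..n}"]) (auto simp: tail_pairs_def)

text \<open>Pairs whose left column is empty occur in both sets, since an empty column is at most as
  high as any other. For left column k + 1 the two sets differ by the short columns, which are
  lower.\<close>

lemma card_head_pairs:
  "int (card (head_pairs (k + 1) b)) - int (card (pos_pairs \<mu> b)) =
    int (card {p \<in> short_cols k \<mu>. b p > b (k + 1)}) - int (card tail_pairs)"
proof -
  let ?G = "{p. k + 1 < p \<and> p \<le> n \<and> b p > b (k + 1)}"
  let ?S = "{p \<in> short_cols k \<mu>. b p > b (k + 1)}"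
  have fG: "finite ?G" by (rule finite_subset[of _ "{..n}"]) auto
  have fh: "finite ({k + 1} \<times> ?G)" "finite ({k + 1} \<times> (?G - ?S))" using fG by auto
  have "head_pairs (k + 1) b = head_pairs k b \<union> {k + 1} \<times> ?G"
    by (auto simp: head_pairs_def le_Suc_eq)
  moreover have "head_pairs k b \<inter> {k + 1} \<times> ?G = {}" by (auto simp: head_pairs_def)
  ultimately have 1: "card (head_pairs (k + 1) b) = card (head_pairs k b) + card ?G"
    using fh by (simp add: card_Un_disjoint card_cartesian_product)
  have "pos_pairs \<mu> b = head_pairs k b \<union> ({k + 1} \<times> (?G - ?S) \<union> tail_pairs)"
  proof (intro set_eqI, clarify)
    fix i i' show "(i, i') \<in> pos_pairs \<mu> b \<longleftrightarrow>
        (i, i') \<in> head_pairs k b \<union> ({k + 1} \<times> (?G - ?S) \<union> tail_pairs)"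
      using zero[of i] n
      by (cases "i \<le> k"; cases "i = k + 1")
        (auto simp: pos_pairs_def head_pairs_def tail_pairs_def short_cols_def)
  qed
  moreover have "head_pairs k b \<inter> ({k + 1} \<times> (?G - ?S) \<union> tail_pairs) = {}"
    by (auto simp: head_pairs_def tail_pairs_def)
  moreover have "({k + 1} \<times> (?G - ?S)) \<inter> tail_pairs = {}" by (auto simp: tail_pairs_def)
  ultimately have 2: "card (pos_pairs \<mu> b) =
      card (head_pairs k b) + (card (?G - ?S) + card tail_pairs)"
    using fh by (simp add: card_Un_disjoint card_cartesian_product)
  have S: "?S \<subseteq> ?G" using n by (auto simp: short_cols_def)
  then have "card (?G - ?S) + card ?S = card ?G"
    using card_Diff_subset[OF finite_subset[OF S fG] S] card_mono[OF fG S] by simp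
  then show ?thesis using 1 2 by simp
qed

text \<open>Here the moved column is the right end of a pair, and
  \<open>part \<mu> p \<le> a - 1\<close> says that column p is short. The pairs between the
  remaining columns are again \<open>tail_pairs\<close>, shifted by one.\<close>

lemma card_head_pairs':
  "int (card (head_pairs k b')) - int (card (pos_pairs \<mu>' b')) =
    - int (card tail_pairs) - int (card {p \<in> short_cols k \<mu>. b j > b p})"
proof -
  let ?S = "{p \<in> short_cols k \<mu>. b j > b p}"
  let ?f = "map_prod (\<lambda>i. i - 1) (\<lambda>i. i - 1) :: nat \<times> nat \<Rightarrow> nat \<times> nat"
  let ?g = "\<lambda>p. (p - 1, n)"
  have "pos_pairs \<mu>' b' = head_pairs k b' \<union> (?f ` tail_pairs \<union> ?g ` ?S)"
  proof (intro set_eqI, clarify)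
    fix i i'
    have f: "(i, i') \<in> ?f ` tail_pairs \<longleftrightarrow> (i + 1, i' + 1) \<in> tail_pairs"
    proof
      assume "(i, i') \<in> ?f ` tail_pairs"
      then obtain c c' where "(c, c') \<in> tail_pairs" "i = c - 1" "i' = c' - 1" by auto
      then show "(i + 1, i' + 1) \<in> tail_pairs" by (auto simp: tail_pairs_def)
    next
      assume "(i + 1, i' + 1) \<in> tail_pairs"
      then show "(i, i') \<in> ?f ` tail_pairs" by (force simp: image_iff)
    qed
    have g: "(i, i') \<in> ?g ` ?S \<longleftrightarrow> i' = n \<and> i + 1 \<in> ?S"
    proof
      assume "(i, i') \<in> ?g ` ?S"
      then show "i' = n \<and> i + 1 \<in> ?S" by (auto simp: short_cols_def)
    next
      assume "i' = n \<and> i + 1 \<in> ?S"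
      then show "(i, i') \<in> ?g ` ?S" by (force simp: image_iff)
    qed
    show "(i, i') \<in> pos_pairs \<mu>' b' \<longleftrightarrow>
        (i, i') \<in> head_pairs k b' \<union> (?f ` tail_pairs \<union> ?g ` ?S)"
    proof (cases "i \<le> k")
      case True
      then show ?thesis unfolding Un_iff f g using part'(1)[of i] n'
        by (auto simp: pos_pairs_def head_pairs_def tail_pairs_def short_cols_def)
    next
      case False
      then show ?thesis unfolding Un_iff f g
        using part'(2)[of i] part'(2)[of i'] part'(3) b'_vals(1)[of i] b'_vals(1)[of i'] b'_vals(2) n n' k pos
        by (cases "i' < n"; cases "i' = n"; cases "i < n")
          (auto simp: pos_pairs_def head_pairs_def tail_pairs_def short_cols_def)
    qed
  qed
  moreover have "head_pairs k b' \<inter> (?f ` tail_pairs \<union> ?g ` ?S) = {}"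
    by (auto simp: head_pairs_def tail_pairs_def short_cols_def)
  moreover have "?f ` tail_pairs \<inter> ?g ` ?S = {}"
    using k by (auto simp: tail_pairs_def)
  moreover have "card (?f ` tail_pairs) = card tail_pairs"
    by (rule card_image) (auto simp: inj_on_def tail_pairs_def)
  moreover have "card (?g ` ?S) = card ?S"
    by (rule card_image) (auto simp: inj_on_def short_cols_def)
  ultimately have "card (pos_pairs \<mu>' b') = card (head_pairs k b') + (card tail_pairs + card ?S)"
    by (simp add: card_Un_disjoint)
  then show ?thesis by simp
qed

lemma sum_arm: "(\<Sum>u\<in>dg \<mu>. arm \<mu> u) = card (short_cols k \<mu>) + (\<Sum>u\<in>dg \<mu>'. arm \<mu>' u)"
  using sum_dg_Collect[of "arm \<mu>" "\<lambda>_. True"] arm_first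
  by (simp add: arm_up cong: sum.cong)

text \<open>The four summands of \<open>peel_exp\<close> come, in order, from the arm of the removed
  box, from its arm once more if it is a descent, and from the short columns left over in the
  basement pairs before and after peeling.\<close>

lemma fill_coinv_compat:
  assumes c: "compat \<sigma> \<sigma>'"
  shows "fill_coinv b \<mu> \<sigma> = peel_exp k \<mu> b j + fill_coinv b' \<mu>' \<sigma>'"
proof -
  have d: "(\<Sum>u\<in>descents \<mu> \<sigma>. arm \<mu> u) =
      (if b j > b (k + 1) then card (short_cols k \<mu>) else 0) + (\<Sum>u\<in>descents \<mu>' \<sigma>'. arm \<mu>' u)"
    unfolding sum_descents[OF c] arm_first
    by (intro arg_cong2[of _ _ _ _ "(+)"] sum.cong refl) (simp_all add: arm_up descents_def)
  have card_sum: "(\<Sum>p\<in>short_cols k \<mu>. of_bool (Q p)) = int (card {p \<in> short_cols k \<mu>. Q p})" for Q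
    by (simp add: of_bool_def sum.If_cases Int_def)
  have e: "peel_exp k \<mu> b j = int (card (short_cols k \<mu>)) +
      (if b j > b (k + 1) then int (card (short_cols k \<mu>)) else 0) -
      int (card {p \<in> short_cols k \<mu>. b p > b (k + 1)}) - int (card {p \<in> short_cols k \<mu>. b j > b p})"
    by (simp add: peel_exp_def sum.distrib sum_subtractf card_sum del: sum_of_bool_eq)
  have p: "{(i, j). 1 \<le> i \<and> i < j \<and> j \<le> length \<nu> \<and> part \<nu> i \<le> part \<nu> j \<and> c i < c j} = pos_pairs \<nu> c"
    for \<nu> c by (simp add: pos_pairs_def)
  show ?thesis
    unfolding fill_coinv_def fill_inv_def p e d sum_arm card_Inv_set[OF c] card_Inv_set'[OF c]
    using card_head_pairs card_head_pairs' by simp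
qed

lemma naf_weight_compat:
  assumes c: "compat \<sigma> \<sigma>'"
  shows "naf_weight b \<mu> \<sigma> = peel_wt k \<mu> b j * naf_weight b' \<mu>' \<sigma>'"
  unfolding naf_weight_def maj_compat[OF c] prod_compat[OF c] fill_coinv_compat[OF c] peel_wt_def
  by (simp add: power_add power_int_add)

section \<open>The bijection between fillings\<close>

lemma NAF_iff:
  "\<sigma> \<in> NAF c \<nu> \<longleftrightarrow> \<sigma> \<in> aug_dg \<nu> \<rightarrow>\<^sub>E {1..length \<nu>} \<and>
    (\<forall>i. 1 \<le> i \<longrightarrow> i \<le> length \<nu> \<longrightarrow> \<sigma> (i, 0) = c i) \<and>
    (\<forall>u \<in> aug_dg \<nu>. \<forall>v \<in> aug_dg \<nu>. attack u v \<longrightarrow> \<sigma> u \<noteq> \<sigma> v)"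
  by (auto simp: NAF_def)

lemma b_range: "1 \<le> i \<Longrightarrow> i \<le> n \<Longrightarrow> 1 \<le> b i \<and> b i \<le> n"
  using permutes_in_image[OF b, of i] by simp

lemma b'_range: "1 \<le> i \<Longrightarrow> i \<le> n \<Longrightarrow> 1 \<le> b' i \<and> b' i \<le> n"
  using permutes_in_image[OF b'_permutes, of i] by simp

lemma lift_up: "u \<in> core \<Longrightarrow> lift \<sigma> (up u) = \<sigma> u"
  by (simp add: lift_def down_up)

lemma lift_low: "u \<in> low \<Longrightarrow> lift \<sigma> u = b (fst u)"
  using low_disjoint(1) by (auto simp: lift_def)

lemma compat_lift:
  assumes "\<sigma>' \<in> NAF b' \<mu>'"
  shows "compat (lift \<sigma>') \<sigma>'"
proof -
  have s: "\<sigma>' (i, 0) = b' i" if "1 \<le> i" "i \<le> n" for i using assms that n' by (simp add: NAF_iff)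
  have "lift \<sigma>' (i, 0) = b i" if i: "1 \<le> i" "i \<le> n" for i
  proof (cases "i \<le> k + 1")
    case True
    then show ?thesis using i lift_low[of "(i, 0)" \<sigma>'] by (simp add: low_def)
  next
    case False
    then have "(i - 1, 0) \<in> core" "up (i - 1, 0) = (i, 0)" using i by (auto simp: core_def up_def)
    then show ?thesis using lift_up[of "(i - 1, 0)" \<sigma>'] s[of "i - 1"] b'_vals(1)[of "i - 1"] False i
      by simp
  qed
  then show ?thesis using s lift_up by (simp add: compat_def)
qed

lemma lift_NAF:
  assumes "\<sigma>' \<in> NAF b' \<mu>'"
  shows "lift \<sigma>' \<in> NAF b \<mu>"
proof -
  have c: "compat (lift \<sigma>') \<sigma>'" using assms by (rule compat_lift)
  have base: "lift \<sigma>' (i, 0) = b i" if "1 \<le> i" "i \<le> n" for i using c that by (simp add: compat_def)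
  have r: "\<sigma>' u \<in> {1..n}" if "u \<in> core" for u
    using assms that n' by (auto simp: NAF_iff aug_dg')
  have "lift \<sigma>' \<in> aug_dg \<mu> \<rightarrow>\<^sub>E {1..n}"
  proof (rule PiE_I)
    fix u assume "u \<in> aug_dg \<mu>"
    then show "lift \<sigma>' u \<in> {1..n}"
      unfolding aug_dg using r lift_up lift_low b_range k by (auto simp: low_def)
  next
    fix u assume "u \<notin> aug_dg \<mu>"
    then show "lift \<sigma>' u = undefined" by (auto simp: aug_dg lift_def)
  qed
  moreover have "lift \<sigma>' u \<noteq> lift \<sigma>' v"
    if u: "u \<in> aug_dg \<mu>" and v: "v \<in> aug_dg \<mu>" and a: "attack u v" for u v
  proof (cases "u \<in> low \<or> v \<in> low")
    case True
    then have "snd u = 0" "snd v = 0"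
      using attack_low_up[of u v] attack_low_up[of v u] u v a by (auto simp: low_def)
    moreover have "u \<noteq> v" using a by (simp add: attack_def)
    ultimately show ?thesis
      using u v n base[of "fst u"] base[of "fst v"] b_inj by (cases u; cases v) (auto simp: mem_aug_dg)
  next
    case False
    then obtain u' v' where "u = up u'" "v = up v'" "u' \<in> core" "v' \<in> core"
      using u v unfolding aug_dg by auto
    then show ?thesis using a attack_up[of u' v'] assms lift_up aug_dg' by (auto simp: NAF_iff)
  qed
  ultimately show ?thesis using base n by (auto simp: NAF_iff)
qed

lemma drop_box_core: "u \<in> core \<Longrightarrow> drop_box \<sigma> u = \<sigma> (up u)"
  by (simp add: drop_box_def)

lemma drop_box_NAF:
  assumes "\<sigma> \<in> NAF b \<mu>" "\<sigma> (k + 1, 1) = b j"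
  shows "drop_box \<sigma> \<in> NAF b' \<mu>'"
proof -
  have low: "drop_box \<sigma> u = b' (fst u)" if "u \<in> low'" for u
    using low_disjoint(2)[of u] that by (auto simp: drop_box_def)
  have base: "drop_box \<sigma> (i, 0) = b' i" if i: "1 \<le> i" "i \<le> n" for i
  proof (cases "i \<le> k")
    case True
    then show ?thesis using i low[of "(i, 0)"] by (simp add: low'_def)
  next
    case False
    then have "(i, 0) \<in> core" using i by (auto simp: core_def)
    moreover have "\<sigma> (i + 1, 0) = b (i + 1)" if "i < n" using assms(1) n that by (simp add: NAF_iff)
    ultimately show ?thesis
      using drop_box_core[of "(i, 0)" \<sigma>] i False b'_vals assms(2) by (cases "i < n") (auto simp: up_def)
  qed
  have "drop_box \<sigma> \<in> aug_dg \<mu>' \<rightarrow>\<^sub>E {1..n}"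
  proof (rule PiE_I)
    fix u assume u: "u \<in> aug_dg \<mu>'"
    have r: "\<sigma> v \<in> {1..n}" if "v \<in> aug_dg \<mu>" for v
      using assms(1) n that by (auto simp: NAF_iff)
    show "drop_box \<sigma> u \<in> {1..n}"
    proof (cases "u \<in> core")
      case True
      then show ?thesis using r[of "up u"] by (simp add: drop_box_core aug_dg)
    next
      case False
      then have "u \<in> low'" using u by (simp add: aug_dg')
      then show ?thesis using low[of u] b'_range k by (auto simp: low'_def)
    qed
  next
    fix u assume "u \<notin> aug_dg \<mu>'"
    then show "drop_box \<sigma> u = undefined" by (auto simp: aug_dg' drop_box_def)
  qed
  moreover have "drop_box \<sigma> u \<noteq> drop_box \<sigma> v"
    if u: "u \<in> aug_dg \<mu>'" and v: "v \<in> aug_dg \<mu>'" and a: "attack u v" for u v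
  proof (cases "u \<in> low' \<or> v \<in> low'")
    case True
    then have "snd u = 0" "snd v = 0"
      using attack_low'_core[of u v] attack_low'_core[of v u] u v a by (auto simp: low'_def)
    moreover have "u \<noteq> v" using a by (simp add: attack_def)
    ultimately show ?thesis
      using u v n' base[of "fst u"] base[of "fst v"] b'_inj by (cases u; cases v) (auto simp: mem_aug_dg)
  next
    case False
    then have "u \<in> core" "v \<in> core" using u v unfolding aug_dg' by auto
    then show ?thesis using a attack_up[of u v] assms(1) drop_box_core aug_dg by (auto simp: NAF_iff)
  qed
  ultimately show ?thesis using base n' by (auto simp: NAF_iff)
qed

lemma lift_drop_box:
  assumes "\<sigma> \<in> NAF b \<mu>"
  shows "lift (drop_box \<sigma>) = \<sigma>"
proof
  fix u
  consider "u \<in> up ` core" | "u \<in> low" "u \<notin> up ` core" | "u \<notin> aug_dg \<mu>" by (auto simp: aug_dg)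
  then show "lift (drop_box \<sigma>) u = \<sigma> u"
  proof cases
    case 1 then show ?thesis by (auto simp: lift_up drop_box_core)
  next
    case 2
    then show ?thesis using assms n k by (auto simp: lift_low low_def NAF_iff)
  next
    case 3
    then have "lift (drop_box \<sigma>) u = undefined" by (auto simp: aug_dg lift_def)
    moreover have "\<sigma> u = undefined" using assms 3 unfolding NAF_iff by (metis PiE_arb)
    ultimately show ?thesis by simp
  qed
qed

lemma drop_box_lift:
  assumes "\<sigma>' \<in> NAF b' \<mu>'"
  shows "drop_box (lift \<sigma>') = \<sigma>'"
proof
  fix u
  consider "u \<in> core" | "u \<in> low'" "u \<notin> core" | "u \<notin> aug_dg \<mu>'" by (auto simp: aug_dg')
  then show "drop_box (lift \<sigma>') u = \<sigma>' u"
  proof cases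
    case 1 then show ?thesis by (simp add: lift_up drop_box_core)
  next
    case 2
    then show ?thesis using assms n' k by (auto simp: drop_box_def low'_def NAF_iff)
  next
    case 3
    then have "drop_box (lift \<sigma>') u = undefined" by (auto simp: aug_dg' drop_box_def)
    moreover have "\<sigma>' u = undefined" using assms 3 unfolding NAF_iff by (metis PiE_arb)
    ultimately show ?thesis by simp
  qed
qed

lemma sum_NAF_first:
  "(\<Sum>\<sigma> | \<sigma> \<in> NAF b \<mu> \<and> \<sigma> (k + 1, 1) = b j. Cst (naf_weight b \<mu> \<sigma>) * (\<Prod>u \<in> dg \<mu>. X (\<sigma> u))) =
    Cst (peel_wt k \<mu> b j) * X (b j) * E_gen b' \<mu>'"
proof -
  have "(\<Sum>\<sigma> | \<sigma> \<in> NAF b \<mu> \<and> \<sigma> (k + 1, 1) = b j. Cst (naf_weight b \<mu> \<sigma>) * (\<Prod>u \<in> dg \<mu>. X (\<sigma> u))) =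
      (\<Sum>\<sigma>' \<in> NAF b' \<mu>'. Cst (peel_wt k \<mu> b j) * X (b j) *
        (Cst (naf_weight b' \<mu>' \<sigma>') * (\<Prod>u \<in> dg \<mu>'. X (\<sigma>' u))))"
  proof (rule sum.reindex_bij_witness[of _ lift drop_box])
    fix \<sigma> assume h: "\<sigma> \<in> {\<sigma>. \<sigma> \<in> NAF b \<mu> \<and> \<sigma> (k + 1, 1) = b j}"
    then show "lift (drop_box \<sigma>) = \<sigma>" "drop_box \<sigma> \<in> NAF b' \<mu>'"
      using lift_drop_box drop_box_NAF by auto
    then have c: "compat \<sigma> (drop_box \<sigma>)" using compat_lift[of "drop_box \<sigma>"] by simp
    show "Cst (peel_wt k \<mu> b j) * X (b j) * (Cst (naf_weight b' \<mu>' (drop_box \<sigma>)) *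
        (\<Prod>u \<in> dg \<mu>'. X (drop_box \<sigma> u))) = Cst (naf_weight b \<mu> \<sigma>) * (\<Prod>u \<in> dg \<mu>. X (\<sigma> u))"
      unfolding naf_weight_compat[OF c] prod_X_compat[OF c] by (simp add: Cst_hom mult_ac)
  next
    fix \<sigma>' assume h: "\<sigma>' \<in> NAF b' \<mu>'"
    then show "drop_box (lift \<sigma>') = \<sigma>'" "lift \<sigma>' \<in> {\<sigma>. \<sigma> \<in> NAF b \<mu> \<and> \<sigma> (k + 1, 1) = b j}"
      using drop_box_lift lift_NAF compat_first(1)[OF compat_lift] by auto
  qed
  then show ?thesis by (simp add: E_gen_def sum_distrib_left)
qed

end

text \<open>The box (k + 1, 1) attacks all basement boxes to the right of column k + 1, which leaves
  only the first k + 1 basement values.\<close>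

lemma NAF_first_box:
  assumes k: "k < length \<mu>" and pos: "part \<mu> (k + 1) \<ge> 1"
    and b: "b permutes {1..length \<mu>}" and s: "\<sigma> \<in> NAF b \<mu>"
  shows "\<exists>j\<in>{1..k + 1}. \<sigma> (k + 1, 1) = b j"
proof -
  have m: "(k + 1, 1) \<in> aug_dg \<mu>" using k pos by (simp add: mem_aug_dg)
  then have "\<sigma> (k + 1, 1) \<in> {1..length \<mu>}" using s by (auto simp: NAF_def)
  then obtain j where j: "j \<in> {1..length \<mu>}" "\<sigma> (k + 1, 1) = b j"
    using permutes_image[OF b] by blast
  have "\<not> j > k + 1"
  proof
    assume l: "j > k + 1"
    then have "(j, 0) \<in> aug_dg \<mu>" "attack (k + 1, 1) (j, 0)" "\<sigma> (j, 0) = b j"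
      using j s by (auto simp: mem_aug_dg attack_def NAF_def)
    moreover have "\<sigma> (k + 1, 1) \<noteq> \<sigma> (j, 0)" using s m calculation unfolding NAF_def by blast
    ultimately show False using j by simp
  qed
  then show ?thesis using j by auto
qed

theorem E_gen_peel:
  assumes k: "k < length \<mu>" and z: "\<And>i. 1 \<le> i \<Longrightarrow> i \<le> k \<Longrightarrow> part \<mu> i = 0"
    and pos: "part \<mu> (k + 1) \<ge> 1" and b: "b permutes {1..length \<mu>}"
  shows "E_gen b \<mu> = (\<Sum>j\<in>{1..k + 1}. Cst (peel_wt k \<mu> b j) * X (b j) *
    E_gen (b \<circ> peel_perm k (length \<mu>) j) (peel_shape k \<mu>))"
proof -
  let ?F = "\<lambda>\<sigma>. Cst (naf_weight b \<mu> \<sigma>) * (\<Prod>u \<in> dg \<mu>. X (\<sigma> u))"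
  have inj: "b x = b y \<longleftrightarrow> x = y" for x y using permutes_inj[OF b] by (auto dest: injD)
  have "E_gen b \<mu> = sum ?F (\<Union>j\<in>{1..k + 1}. {\<sigma> \<in> NAF b \<mu>. \<sigma> (k + 1, 1) = b j})"
    unfolding E_gen_def using NAF_first_box[OF k pos b] by (intro sum.cong) auto
  also have "\<dots> = (\<Sum>j\<in>{1..k + 1}. sum ?F {\<sigma> \<in> NAF b \<mu>. \<sigma> (k + 1, 1) = b j})"
    using inj by (intro sum.UNION_disjoint) auto
  also have "\<dots> = (\<Sum>j\<in>{1..k + 1}. Cst (peel_wt k \<mu> b j) * X (b j) *
    E_gen (b \<circ> peel_perm k (length \<mu>) j) (peel_shape k \<mu>))"
  proof (rule sum.cong[OF refl])
    fix j assume "j \<in> {1..k + 1}"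
    then interpret peel k "length \<mu>" \<mu> b j
      using assms by unfold_locales auto
    show "sum ?F {\<sigma> \<in> NAF b \<mu>. \<sigma> (k + 1, 1) = b j} = Cst (peel_wt k \<mu> b j) * X (b j) *
        E_gen (b \<circ> peel_perm k (length \<mu>) j) (peel_shape k \<mu>)"
      using sum_NAF_first by (simp add: b'_def)
  qed
  finally show ?thesis .
qed

text \<open>The basement is the only filling, and the correction term in \<open>fill_inv\<close>
  cancels its inversions.\<close>

lemma E_gen_zero_shape:
  assumes z: "\<And>i. 1 \<le> i \<Longrightarrow> i \<le> length \<mu> \<Longrightarrow> part \<mu> i = 0" and b: "b permutes {1..length \<mu>}"
  shows "E_gen b \<mu> = 1"
proof -
  have a: "aug_dg \<mu> = {1..length \<mu>} \<times> {0}" using z by (auto simp: mem_aug_dg)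
  have d: "dg \<mu> = {}" using z by (auto simp: dg_def)
  let ?s = "\<lambda>u. if u \<in> aug_dg \<mu> then b (fst u) else undefined"
  have "NAF b \<mu> = {?s}"
  proof (intro equalityI subsetI)
    fix \<sigma> assume s: "\<sigma> \<in> NAF b \<mu>"
    have "\<sigma> u = ?s u" for u
      using s by (cases u) (auto simp: NAF_def a PiE_def extensional_def)
    then show "\<sigma> \<in> {?s}" by auto
  next
    fix \<sigma> assume "\<sigma> \<in> {?s}"
    moreover have "?s \<in> aug_dg \<mu> \<rightarrow>\<^sub>E {1..length \<mu>}"
    proof (rule PiE_I)
      fix u assume "u \<in> aug_dg \<mu>"
      then show "?s u \<in> {1..length \<mu>}" using permutes_in_image[OF b, of "fst u"] by (auto simp: a)
    qed simp
    moreover have "?s u \<noteq> ?s v" if "u \<in> aug_dg \<mu>" "v \<in> aug_dg \<mu>" "attack u v" for u v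
    proof -
      have "snd u = 0" "snd v = 0" using that by (auto simp: a)
      then have "fst u \<noteq> fst v" using that(3) by (auto simp: attack_def prod_eq_iff)
      then show ?thesis using that permutes_inj[OF b] by (auto dest: injD)
    qed
    ultimately show "\<sigma> \<in> NAF b \<mu>"
      by (simp add: NAF_def) (simp add: a)
  qed
  moreover have "naf_weight b \<mu> ?s = 1"
  proof -
    have "Inv_set \<mu> ?s = (\<lambda>(i, i'). ((i', 0), (i, 0))) `
        {(i, j). 1 \<le> i \<and> i < j \<and> j \<le> length \<mu> \<and> part \<mu> i \<le> part \<mu> j \<and> b i < b j}"
      using z by (auto simp: Inv_set_def a attack_def reads_before_def image_iff)
    moreover have "inj_on (\<lambda>(i, i'). ((i', 0::nat), (i, 0::nat))) A" for A :: "(nat \<times> nat) set"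
      by (auto simp: inj_on_def)
    ultimately have "card (Inv_set \<mu> ?s) =
        card {(i, j). 1 \<le> i \<and> i < j \<and> j \<le> length \<mu> \<and> part \<mu> i \<le> part \<mu> j \<and> b i < b j}"
      by (simp add: card_image)
    then show ?thesis
      by (simp add: naf_weight_def d descents_def maj_def fill_coinv_def fill_inv_def)
  qed
  ultimately show ?thesis by (simp add: E_gen_def d Cst_hom)
qed

lemma shape_cases:
  obtains "\<And>i. 1 \<le> i \<Longrightarrow> i \<le> length \<mu> \<Longrightarrow> part \<mu> i = 0"
  | k where "k < length \<mu>" "\<And>i. 1 \<le> i \<Longrightarrow> i \<le> k \<Longrightarrow> part \<mu> i = 0" "part \<mu> (k + 1) \<ge> 1"
proof (cases "\<exists>i. 1 \<le> i \<and> i \<le> length \<mu> \<and> part \<mu> i \<noteq> 0")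
  case False
  then show thesis by (intro that(1)) auto
next
  case True
  define i where "i = (LEAST i. 1 \<le> i \<and> i \<le> length \<mu> \<and> part \<mu> i \<noteq> 0)"
  have i: "1 \<le> i" "i \<le> length \<mu>" "part \<mu> i \<noteq> 0"
    using LeastI_ex[OF True] by (simp_all add: i_def)
  have min: "part \<mu> c = 0" if "1 \<le> c" "c < i" for c
    using not_less_Least[of c "\<lambda>i. 1 \<le> i \<and> i \<le> length \<mu> \<and> part \<mu> i \<noteq> 0"] that i
    by (auto simp: i_def)
  show thesis using i min by (intro that(2)[of "i - 1"]) auto
qed

lemma sum_list_peel_shape:
  assumes "k < length \<mu>" "part \<mu> (k + 1) \<ge> 1"
  shows "sum_list (peel_shape k \<mu>) < sum_list \<mu>"
proof -
  have "\<mu> = take k \<mu> @ part \<mu> (k + 1) # drop (k + 1) \<mu>"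
    using id_take_nth_drop[OF assms(1)] by (simp add: part_def)
  then have "sum_list \<mu> = sum_list (take k \<mu>) + part \<mu> (k + 1) + sum_list (drop (k + 1) \<mu>)"
    by (metis add.assoc sum_list.Cons sum_list_append)
  then show ?thesis using assms by (simp add: peel_shape_def sum_list_replicate)
qed

text \<open>The hypothesis covers all smaller shapes and not only the peeled one, because the
  exchange of equal columns peels off two boxes at once.\<close>

lemma shape_induct [case_names zero peel]:
  assumes "\<And>\<mu>. (\<And>i. 1 \<le> i \<Longrightarrow> i \<le> length \<mu> \<Longrightarrow> part \<mu> i = 0) \<Longrightarrow> P \<mu>"
    and "\<And>k \<mu>. k < length \<mu> \<Longrightarrow> (\<And>i. 1 \<le> i \<Longrightarrow> i \<le> k \<Longrightarrow> part \<mu> i = 0) \<Longrightarrow>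
      part \<mu> (k + 1) \<ge> 1 \<Longrightarrow> (\<And>\<nu>. sum_list \<nu> < sum_list \<mu> \<Longrightarrow> P \<nu>) \<Longrightarrow> P \<mu>"
  shows "P \<mu>"
proof (induction "sum_list \<mu>" arbitrary: \<mu> rule: less_induct)
  case less
  show ?case
  proof (cases \<mu> rule: shape_cases)
    case 1 then show ?thesis by (rule assms(1))
  next
    case (2 k) then show ?thesis using less by (intro assms(2)[of k \<mu>])
  qed
qed

section \<open>The action of the Demazure--Lusztig operators\<close>

definition peel_term :: "nat \<Rightarrow> nat list \<Rightarrow> (nat \<Rightarrow> nat) \<Rightarrow> nat \<Rightarrow> mpol" where
  "peel_term k \<mu> b j = Cst (peel_wt k \<mu> b j) * X (b j) *
    E_gen (b \<circ> peel_perm k (length \<mu>) j) (peel_shape k \<mu>)"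

lemma E_gen_eq_sum_peel_term:
  assumes "k < length \<mu>" "\<And>i. 1 \<le> i \<Longrightarrow> i \<le> k \<Longrightarrow> part \<mu> i = 0"
    "part \<mu> (k + 1) \<ge> 1" "b permutes {1..length \<mu>}"
  shows "E_gen b \<mu> = (\<Sum>j\<in>{1..k + 1}. peel_term k \<mu> b j)"
  using E_gen_peel[OF assms] by (simp add: peel_term_def)

text \<open>The position in the peeled shape of the basement value that was in position \<open>y\<close>.\<close>

definition peel_pos :: "nat \<Rightarrow> nat \<Rightarrow> nat \<Rightarrow> nat \<Rightarrow> nat" where
  "peel_pos k n j y = (if y = j then n else if y = k + 1 then j else if y \<le> k then y else y - 1)"

lemma peel_perm_peel_pos:
  assumes "k < n" "j \<in> {1..k + 1}" "y \<in> {1..n}"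
  shows "peel_perm k n j (peel_pos k n j y) = y" "peel_pos k n j y \<in> {1..n}"
  using assms by (auto simp: peel_perm_def peel_pos_def rot_def transpose_def)

lemma part_peel_pos:
  assumes "k < length \<mu>" "j \<in> {1..k + 1}" "y \<in> {1..length \<mu>}"
  shows "part (peel_shape k \<mu>) (peel_pos k (length \<mu>) j y) =
    (if y = j then part \<mu> (k + 1) - 1 else if y \<le> k + 1 then 0 else part \<mu> y)"
proof -
  have "peel_pos k (length \<mu>) j y \<in> {1..length \<mu>}"
    using assms by (rule peel_perm_peel_pos)
  from part_peel_shape[OF assms(1) this] show ?thesis
    using assms by (auto simp: peel_pos_def split: if_splits)
qed

lemma transpose_apply_comp:
  assumes "inj f"
  shows "f (transpose x y p) = transpose (f x) (f y) (f p)"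
  using assms by (auto simp: transpose_def dest: injD)

lemma transpose_comp_peel_perm:
  assumes "k < n" "x \<le> k" "y \<le> k"
  shows "transpose x y \<circ> peel_perm k n j = peel_perm k n (transpose x y j) \<circ> transpose x y"
proof
  fix p
  have fix_big: "transpose x y p = p" if "p > k" for p using assms that by (simp add: transpose_def)
  have "transpose x y (rot k n p) = rot k n (transpose x y p)"
  proof (cases "p \<le> k")
    case True
    then have "transpose x y p \<le> k" using assms by (auto simp: transpose_def)
    then show ?thesis using True assms by (simp add: rot_def)
  next
    case False
    then have "rot k n p > k" by (auto simp: rot_def)
    then show ?thesis using False fix_big by simp
  qed
  moreover have "transpose x y (transpose j (k + 1) p') =
      transpose (transpose x y j) (k + 1) (transpose x y p')" for p'
    using transpose_apply_comp[OF inj_transpose, of x y j "k + 1" p'] fix_big[of "k + 1"] by simp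
  ultimately show "(transpose x y \<circ> peel_perm k n j) p =
      (peel_perm k n (transpose x y j) \<circ> transpose x y) p"
    by (simp add: peel_perm_def)
qed

text \<open>Exchanging the basement values of two empty columns permutes the terms of the recursion:
  the weight depends on these columns only through \<open>b j\<close>, and the peeled basements
  differ by the same exchange.\<close>

lemma E_gen_swap_zero_prefix:
  assumes "b permutes {1..length \<mu>}" "\<And>i. 1 \<le> i \<Longrightarrow> i \<le> l \<Longrightarrow> part \<mu> i = 0"
    "x \<in> {1..l}" "y \<in> {1..l}" "l \<le> length \<mu>"
  shows "E_gen (b \<circ> transpose x y) \<mu> = E_gen b \<mu>"
  using assms
proof (induction \<mu> arbitrary: b l rule: shape_induct)
  case (zero \<mu>)
  have bt: "b \<circ> transpose x y permutes {1..length \<mu>}"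
    using zero by (intro permutes_compose permutes_swap_id) auto
  show ?case
    by (simp only: E_gen_zero_shape[OF zero(1) zero(2)] E_gen_zero_shape[OF zero(1) bt])
next
  case (peel k \<mu>)
  let ?n = "length \<mu>" and ?\<mu>' = "peel_shape k \<mu>" and ?\<tau> = "transpose x y"
  have l: "l \<le> k" using peel.hyps(3) peel.prems(2)[of "k + 1"] by (cases "l \<le> k") auto
  have xy: "x \<in> {1..k}" "y \<in> {1..k}" using peel.prems l by auto
  have fix_big: "?\<tau> p = p" if "p > k" for p using xy that by (simp add: transpose_def)
  have bt: "b \<circ> ?\<tau> permutes {1..?n}"
    using peel.prems by (intro permutes_compose permutes_swap_id) auto
  have \<tau>: "?\<tau> permutes {1..k + 1}" using xy by (intro permutes_swap_id) auto
  have "peel_term k \<mu> (b \<circ> ?\<tau>) j = peel_term k \<mu> b (?\<tau> j)" if j: "j \<in> {1..k + 1}" for j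
  proof -
    have tj: "?\<tau> j \<in> {1..k + 1}" using permutes_in_image[OF \<tau>] j by blast
    have jk: "?\<tau> j = k + 1 \<longleftrightarrow> j = k + 1" using xy by (auto simp: transpose_def)
    have e: "peel_exp k \<mu> (b \<circ> ?\<tau>) j = peel_exp k \<mu> b (?\<tau> j)"
      unfolding peel_exp_def using fix_big
      by (intro sum.cong) (auto simp: short_cols_def)
    have "?\<tau> \<circ> peel_perm k ?n j = peel_perm k ?n (?\<tau> j) \<circ> ?\<tau>"
      using peel.hyps(1) xy by (intro transpose_comp_peel_perm) auto
    then have "b \<circ> ?\<tau> \<circ> peel_perm k ?n j = (b \<circ> peel_perm k ?n (?\<tau> j)) \<circ> ?\<tau>"
      by (simp add: comp_assoc)
    moreover have "E_gen ((b \<circ> peel_perm k ?n (?\<tau> j)) \<circ> ?\<tau>) ?\<mu>' =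
        E_gen (b \<circ> peel_perm k ?n (?\<tau> j)) ?\<mu>'"
    proof (rule peel.IH[of _ _ k])
      show "b \<circ> peel_perm k ?n (?\<tau> j) permutes {1..length ?\<mu>'}"
        unfolding length_peel_shape[OF peel.hyps(1)]
        by (rule permutes_compose[OF peel_perm_permutes[OF peel.hyps(1) tj] peel.prems(1)])
    qed (use peel.hyps xy in \<open>auto simp: length_peel_shape part_peel_shape sum_list_peel_shape\<close>)
    ultimately show ?thesis
      using jk fix_big by (simp add: peel_term_def peel_wt_def e)
  qed
  then have "E_gen (b \<circ> ?\<tau>) \<mu> = (\<Sum>j\<in>{1..k + 1}. peel_term k \<mu> b (?\<tau> j))"
    using E_gen_eq_sum_peel_term[OF peel.hyps(1-3) bt] by simp
  also have "\<dots> = (\<Sum>j\<in>{1..k + 1}. peel_term k \<mu> b j)"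
    using sum.permute[OF \<tau>, of "peel_term k \<mu> b"] by (simp add: comp_def)
  also have "\<dots> = E_gen b \<mu>"
    by (rule E_gen_eq_sum_peel_term[OF peel.hyps(1-3) peel.prems(1), symmetric])
  finally show ?case .
qed

lemma simple_refl_comp_eq:
  assumes "inj b" "b x = i" "b y = i + 1"
  shows "simple_refl i \<circ> b = b \<circ> transpose x y"
proof
  fix p
  have "b p = i \<longleftrightarrow> p = x" "b p = i + 1 \<longleftrightarrow> p = y"
    using assms by (metis injD)+
  then show "(simple_refl i \<circ> b) p = (b \<circ> transpose x y) p"
    using assms by (auto simp: simple_refl_apply transpose_def)
qed

lemma simple_refl_less_iff:
  assumes "{x, y} \<noteq> {i, i + 1}"
  shows "simple_refl i x < simple_refl i y \<longleftrightarrow> x < y"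
  using assms by (auto simp: simple_refl_apply)

lemma simple_refl_comp_permutes:
  "b permutes {1..n} \<Longrightarrow> i \<in> {1..<n} \<Longrightarrow> simple_refl i \<circ> b permutes {1..n}"
  by (intro permutes_compose simple_refl_permutes)

text \<open>For exchanging i and i + 1 in the basement when at most one short column r has its
  summand changed.\<close>

lemma peel_exp_shift:
  assumes "\<And>p. p \<in> short_cols k \<mu> \<Longrightarrow>
    of_bool (c j > c (k + 1)) - of_bool (c p > c (k + 1)) - of_bool (c j > c p) =
    of_bool (b j > b (k + 1)) - of_bool (b p > b (k + 1)) - of_bool (b j > b p) +
    (if p = r then d else (0::int))"
  shows "peel_exp k \<mu> c j = peel_exp k \<mu> b j + (if r \<in> short_cols k \<mu> then d else 0)"
proof -
  have "peel_exp k \<mu> c j = (\<Sum>p\<in>short_cols k \<mu>.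
      (1 + of_bool (b j > b (k + 1)) - of_bool (b p > b (k + 1)) - of_bool (b j > b p)) +
      (if p = r then d else 0))"
    unfolding peel_exp_def using assms by (intro sum.cong refl) (smt (verit))
  then show ?thesis by (simp add: sum.distrib peel_exp_def)
qed

text \<open>For a term with split-off variable x_i where induction only yields T_i on the basement
  with i and i + 1 exchanged: T_i x_i T_i = t x_(i+1) converts one into the other.\<close>

lemma T_simple_X_of_T_simple_eq:
  assumes "T_simple i g = Cst (t_K ^ d) * f"
  shows "Cst (t_K ^ d) * T_simple i (X i * f) = Cst t_K * X (i + 1) * g"
proof -
  have "Cst (t_K ^ d) * T_simple i (X i * f) = T_simple i (X i * T_simple i g)"
    unfolding assms by (simp add: mult_ac flip: T_simple_Cst_mult)
  then show ?thesis by (simp only: T_simple_X_T_simple)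
qed

lemma T_simple_mult_X:
  assumes "l \<noteq> i" "l \<noteq> i + 1"
  shows "T_simple i (Cst c * X l * f) = Cst c * X l * T_simple i f"
  using assms by (intro T_simple_mult_invariant) (simp add: simple_refl_apply)

lemma peel_factor_denom_nonzero:
  assumes "part \<mu> (k + 1) \<ge> 1"
  shows "1 - q_K ^ part \<mu> (k + 1) * t_K ^ l \<noteq> 0"
  using q_t_powers_ne_1[of "part \<mu> (k + 1)" l] assms by auto

text \<open>Among empty columns the order of i and i + 1 is immaterial: the exchange leaves the
  polynomial unchanged, so the rule \<open>S\<close> may be applied to whichever basement has i on
  the left.\<close>

lemma T_simple_E_gen_zero_prefix:
  assumes S: "\<And>c x y. c permutes {1..length \<nu>} \<Longrightarrow> 1 \<le> x \<Longrightarrow> x < y \<Longrightarrow> y \<le> length \<nu> \<Longrightarrow>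
      c x = i \<Longrightarrow> c y = i + 1 \<Longrightarrow>
      T_simple i (E_gen c \<nu>) = Cst (t_K ^ of_bool (part \<nu> x \<le> part \<nu> y)) * E_gen (simple_refl i \<circ> c) \<nu>"
    and c: "c permutes {1..length \<nu>}" and z: "\<And>i. 1 \<le> i \<Longrightarrow> i \<le> l \<Longrightarrow> part \<nu> i = 0"
    and xy: "x \<in> {1..l}" "y \<in> {1..l}" "l \<le> length \<nu>" "c x = i" "c y = i + 1"
  shows "T_simple i (E_gen c \<nu>) = Cst t_K * E_gen (simple_refl i \<circ> c) \<nu>"
proof -
  have sc: "simple_refl i \<circ> c = c \<circ> transpose x y"
    using permutes_inj[OF c] xy by (intro simple_refl_comp_eq)
  then have eq: "E_gen (simple_refl i \<circ> c) \<nu> = E_gen c \<nu>"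
    using E_gen_swap_zero_prefix[OF c z] xy by simp
  have scp: "simple_refl i \<circ> c permutes {1..length \<nu>}"
    unfolding sc using c xy by (intro permutes_compose permutes_swap_id) auto
  have ne: "x \<noteq> y" using xy by auto
  show ?thesis
  proof (cases "x < y")
    case True
    then show ?thesis using S[OF c _ True] xy z by simp
  next
    case False
    then have "T_simple i (E_gen (simple_refl i \<circ> c) \<nu>) =
        Cst (t_K ^ of_bool (part \<nu> y \<le> part \<nu> x)) * E_gen (simple_refl i \<circ> (simple_refl i \<circ> c)) \<nu>"
      using ne xy by (intro S[OF scp]) (auto simp: simple_refl_apply)
    then show ?thesis using xy z eq by (simp flip: comp_assoc)
  qed
qed


lemma Cst_t_K_cancel: "Cst (t_K ^ d) * f = Cst (t_K ^ d) * h \<Longrightarrow> f = h"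
  by (simp add: Cst_hom)

lemma peel_wt_self:
  assumes "inj b"
  shows "peel_wt k \<mu> b (k + 1) = 1"
proof -
  have "peel_exp k \<mu> b (k + 1) = 0"
    unfolding peel_exp_def
  proof (intro sum.neutral ballI)
    fix p assume "p \<in> short_cols k \<mu>"
    then have "b p \<noteq> b (k + 1)" using assms by (auto simp: short_cols_def dest: injD)
    then show "1 + of_bool (b (k + 1) < b (k + 1)) - of_bool (b (k + 1) < b p) -
        of_bool (b p < b (k + 1)) = (0::int)" by simp
  qed
  then show ?thesis by (simp add: peel_wt_def)
qed

text \<open>In the recursion, T_i commutes with the split-off variable unless j is p or p'. If only
  p is among the first k + 1 columns, the term of p is handled by T_i x_i T_i = t x_(i+1). If both
  are, their two terms are treated together, since T_i mixes x_i and x_(i+1).\<close>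

theorem T_simple_E_gen:
  assumes "b permutes {1..length \<mu>}" "1 \<le> p" "p < p'" "p' \<le> length \<mu>" "b p = i" "b p' = i + 1"
  shows "T_simple i (E_gen b \<mu>) =
    Cst (t_K ^ of_bool (part \<mu> p \<le> part \<mu> p')) * E_gen (simple_refl i \<circ> b) \<mu>"
  using assms
proof (induction \<mu> arbitrary: b p p' rule: shape_induct)
  case (zero \<mu>)
  have "i \<in> {1..<length \<mu>}"
    using zero.prems permutes_in_image[OF zero.prems(1), of p] permutes_in_image[OF zero.prems(1), of p'] by auto
  then have sb: "simple_refl i \<circ> b permutes {1..length \<mu>}"
    using zero.prems(1) by (intro simple_refl_comp_permutes)
  have "of_bool (part \<mu> p \<le> part \<mu> p') = (1::nat)" using zero by simp
  then show ?case
    by (simp only: E_gen_zero_shape[OF zero.hyps zero.prems(1)] E_gen_zero_shape[OF zero.hyps sb]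
        T_simple_1 power_one_right mult_1_right)
next
  case (peel k \<mu>)
  let ?n = "length \<mu>" and ?\<mu>' = "peel_shape k \<mu>" and ?s = "simple_refl i"
  define a where "a = part \<mu> (k + 1)"
  define e :: nat where "e = of_bool (part \<mu> p \<le> part \<mu> p')"
  note k = peel.hyps(1) and zero = peel.hyps(2)
  note b = peel.prems(1) and p = peel.prems(2-4) and bp = peel.prems(5) and bp' = peel.prems(6)
  have a: "a \<ge> 1" using peel.hyps(3) by (simp add: a_def)
  have i: "i \<in> {1..<?n}"
    using p bp bp' permutes_in_image[OF b, of p] permutes_in_image[OF b, of p'] by auto
  have binj: "b x = b y \<longleftrightarrow> x = y" for x y using permutes_inj[OF b] by (auto dest: injD)
  have bi: "b x = i \<longleftrightarrow> x = p" "b x = i + 1 \<longleftrightarrow> x = p'" for x using binj bp bp' by metis+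
  have sb: "?s \<circ> b permutes {1..?n}" using b i by (rule simple_refl_comp_permutes)
  have set_eq: "{b x, b y} = {i, i + 1} \<longleftrightarrow> {x, y} = {p, p'}" for x y
    by (simp only: doubleton_eq_iff bi)
  have cmp: "(?s \<circ> b) x < (?s \<circ> b) y \<longleftrightarrow> b x < b y" if "{x, y} \<noteq> {p, p'}" for x y
    using simple_refl_less_iff[of "b x" "b y" i, unfolded set_eq, OF that] by simp
  define c where "c j = b \<circ> peel_perm k ?n j" for j
  have c: "c j permutes {1..length ?\<mu>'}" if "j \<in> {1..k + 1}" for j
    unfolding c_def length_peel_shape[OF k]
    by (rule permutes_compose[OF peel_perm_permutes[OF k that] b])
  have sc: "?s \<circ> c j permutes {1..length ?\<mu>'}" if "j \<in> {1..k + 1}" for j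
    using c[OF that] i by (intro simple_refl_comp_permutes) (simp_all add: length_peel_shape[OF k])
  let ?pos = "peel_pos k ?n"
  have cpos: "c j (?pos j x) = b x" "?pos j x \<in> {1..?n}" if "j \<in> {1..k + 1}" "x \<in> {1..?n}" for j x
    using peel_perm_peel_pos[OF k that] by (simp_all add: c_def)
  have IH: "T_simple i (E_gen c' ?\<mu>') =
      Cst (t_K ^ of_bool (part ?\<mu>' x \<le> part ?\<mu>' y)) * E_gen (?s \<circ> c') ?\<mu>'"
    if "c' permutes {1..length ?\<mu>'}" "1 \<le> x" "x < y" "y \<le> length ?\<mu>'" "c' x = i" "c' y = i + 1"
    for c' x y
    using that by (rule peel.IH[OF sum_list_peel_shape[OF k peel.hyps(3)]])
  have zero': "part ?\<mu>' x = 0" if "1 \<le> x" "x \<le> k" for x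
    using that k by (simp add: part_peel_shape)
  have Z: "T_simple i (E_gen (c j) ?\<mu>') = Cst t_K * E_gen (?s \<circ> c j) ?\<mu>'"
    if j: "j \<in> {1..k + 1}" and xy: "x \<in> {1..k}" "y \<in> {1..k}" "c j x = i" "c j y = i + 1" for j x y
  proof (rule T_simple_E_gen_zero_prefix[of ?\<mu>' i "c j" k x y])
    show "k \<le> length ?\<mu>'" using k by (simp add: length_peel_shape)
  qed (fact IH c[OF j] zero' xy)+
  have pos_part: "part ?\<mu>' (?pos j x) = (if x = j then a - 1 else if x \<le> k + 1 then 0 else part \<mu> x)"
    if "j \<in> {1..k + 1}" "x \<in> {1..?n}" for j x
    using part_peel_pos[OF k that] by (simp add: a_def)
  have pterm: "peel_term k \<mu> b j = Cst (peel_wt k \<mu> b j) * X (b j) * E_gen (c j) ?\<mu>'" for j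
    by (simp add: peel_term_def c_def)
  have sterm: "peel_term k \<mu> (?s \<circ> b) j =
      Cst (peel_wt k \<mu> (?s \<circ> b) j) * X (?s (b j)) * E_gen (?s \<circ> c j) ?\<mu>'" for j
    by (simp add: peel_term_def c_def comp_assoc)
  have pn: "p \<in> {1..?n}" "p' \<in> {1..?n}" using p by auto
  have pass: "T_simple i (peel_term k \<mu> b j) = Cst (t_K ^ e) * peel_term k \<mu> (?s \<circ> b) j"
    if j: "j \<in> {1..k + 1}" "j \<noteq> p" "j \<noteq> p'" for j
  proof -
    have bj: "b j \<noteq> i" "b j \<noteq> i + 1" using j bi[of j] by simp_all
    then have sbj: "?s (b j) = b j" by (simp add: simple_refl_apply)
    define d :: nat where "d = of_bool (part ?\<mu>' (?pos j p) \<le> part ?\<mu>' (?pos j p'))"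
    have T: "T_simple i (E_gen (c j) ?\<mu>') = Cst (t_K ^ d) * E_gen (?s \<circ> c j) ?\<mu>'"
    \<comment> \<open>If p' = k + 1, its value moves to column j, possibly to the left of p; both
      columns are empty then, so \<open>Z\<close> applies in either order.\<close>
    proof (cases "p' \<le> k + 1")
      case True
      have "?pos j p \<in> {1..k}" "?pos j p' \<in> {1..k}"
        using True j p by (auto simp: peel_pos_def)
      moreover from this have "d = 1" using zero' by (simp add: d_def)
      ultimately show ?thesis
        using Z[OF j(1), of "?pos j p" "?pos j p'"] cpos[OF j(1)] pn bp bp' k
        by (simp add: length_peel_shape)
    next
      case False
      then have "?pos j p < ?pos j p'" using j p by (auto simp: peel_pos_def)
      then show ?thesis
        unfolding d_def using IH[OF c[OF j(1)], of "?pos j p" "?pos j p'"] cpos[OF j(1)] pn bp bp' k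
        by (simp add: length_peel_shape)
    qed
    \<comment> \<open>\<open>d\<close> and \<open>e\<close> differ only if p = k + 1 and column p'
      is short. In that case the exchange of i and i + 1 raises the summand of p' in
      \<open>peel_exp\<close> by one.\<close>
    have w: "peel_wt k \<mu> b j * t_K ^ d = t_K ^ e * peel_wt k \<mu> (?s \<circ> b) j"
    proof (cases "p = k + 1")
      case True
      then have p': "p' > k + 1" using p by simp
      have ed: "d = 1" "e = of_bool (a \<le> part \<mu> p')"
        using True p' j pos_part[OF j(1)] pn by (simp_all add: d_def e_def a_def)
      have "peel_exp k \<mu> (?s \<circ> b) j = peel_exp k \<mu> b j + (if p' \<in> short_cols k \<mu> then 1 else 0)"
      proof (rule peel_exp_shift)
        fix x assume x: "x \<in> short_cols k \<mu>"
        then have xk: "x > k + 1" by (simp add: short_cols_def)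
        have 1: "(?s \<circ> b) (k + 1) < (?s \<circ> b) j \<longleftrightarrow> b (k + 1) < b j"
          and 2: "(?s \<circ> b) x < (?s \<circ> b) j \<longleftrightarrow> b x < b j"
          using j True p' xk by (intro cmp; auto simp: doubleton_eq_iff)+
        have 3: "(?s \<circ> b) (k + 1) < (?s \<circ> b) x \<longleftrightarrow> b (k + 1) < b x" if "x \<noteq> p'"
          using that True p' xk by (intro cmp) (auto simp: doubleton_eq_iff)
        have 4: "\<not> (?s \<circ> b) (k + 1) < (?s \<circ> b) p'" "b (k + 1) < b p'"
          using bp bp' True by (simp_all add: simple_refl_apply)
        show "of_bool ((?s \<circ> b) j > (?s \<circ> b) (k + 1)) - of_bool ((?s \<circ> b) x > (?s \<circ> b) (k + 1)) -
            of_bool ((?s \<circ> b) j > (?s \<circ> b) x) =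
          of_bool (b j > b (k + 1)) - of_bool (b x > b (k + 1)) - of_bool (b j > b x) +
          (if x = p' then 1 else (0::int))"
          unfolding 1 2 using 3 4 by (cases "x = p'") simp_all
      qed
      moreover have "p' \<in> short_cols k \<mu> \<longleftrightarrow> part \<mu> p' < a"
        using p p' by (simp add: short_cols_def a_def)
      moreover have "(?s \<circ> b) (k + 1) < (?s \<circ> b) j \<longleftrightarrow> b (k + 1) < b j"
        using j True p' by (intro cmp) (auto simp: doubleton_eq_iff)
      ultimately show ?thesis
        unfolding peel_wt_def ed by (simp add: power_int_add del: comp_apply)
    next
      case False
      have ne: "{x, y} \<noteq> {p, p'}" if "x = k + 1 \<or> x = j" "y = k + 1 \<or> y = j \<or> k + 1 < y" for x y
        using that False p j by (auto simp: doubleton_eq_iff)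
      have "peel_exp k \<mu> (?s \<circ> b) j = peel_exp k \<mu> b j"
        unfolding peel_exp_def
      proof (intro sum.cong refl)
        fix x assume "x \<in> short_cols k \<mu>"
        then have xk: "k + 1 < x" by (simp add: short_cols_def)
        have 1: "(?s \<circ> b) (k + 1) < (?s \<circ> b) j \<longleftrightarrow> b (k + 1) < b j"
          and 2: "(?s \<circ> b) (k + 1) < (?s \<circ> b) x \<longleftrightarrow> b (k + 1) < b x"
          using xk by (intro cmp ne; simp)+
        have 3: "(?s \<circ> b) x < (?s \<circ> b) j \<longleftrightarrow> b x < b j"
          using ne[of j x] xk by (intro cmp) (simp add: insert_commute)
        show "1 + of_bool ((?s \<circ> b) (k + 1) < (?s \<circ> b) j) - of_bool ((?s \<circ> b) (k + 1) < (?s \<circ> b) x) -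
            of_bool ((?s \<circ> b) x < (?s \<circ> b) j) =
          1 + of_bool (b (k + 1) < b j) - of_bool (b (k + 1) < b x) - of_bool (b x < b j)"
          unfolding 1 2 3 ..
      qed
      moreover have "(?s \<circ> b) (k + 1) < (?s \<circ> b) j \<longleftrightarrow> b (k + 1) < b j"
        by (rule cmp[OF ne]) auto
      moreover have "d = e"
        using False p j pos_part[OF j(1) pn(1)] pos_part[OF j(1) pn(2)] zero[of p] zero[of p']
        by (auto simp: d_def e_def)
      ultimately show ?thesis
        unfolding peel_wt_def by (simp del: comp_apply)
    qed
    have "T_simple i (peel_term k \<mu> b j) = Cst (peel_wt k \<mu> b j * t_K ^ d) * X (b j) * E_gen (?s \<circ> c j) ?\<mu>'"
      unfolding pterm T_simple_mult_X[OF bj] T by (simp add: Cst_hom mult_ac)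
    also have "\<dots> = Cst (t_K ^ e) * peel_term k \<mu> (?s \<circ> b) j"
      unfolding w sterm sbj by (simp add: Cst_hom mult_ac)
    finally show ?thesis .
  qed
  have E: "E_gen b \<mu> = (\<Sum>j\<in>{1..k + 1}. peel_term k \<mu> b j)"
    and sE: "E_gen (?s \<circ> b) \<mu> = (\<Sum>j\<in>{1..k + 1}. peel_term k \<mu> (?s \<circ> b) j)"
    using E_gen_eq_sum_peel_term[OF peel.hyps(1-3)] b sb by blast+
  have split: "T_simple i (E_gen b \<mu>) = Cst (t_K ^ e) * E_gen (?s \<circ> b) \<mu>"
    if A: "A \<subseteq> {1..k + 1}" "\<And>j. j \<in> {1..k + 1} - A \<Longrightarrow> j \<noteq> p \<and> j \<noteq> p'"
      and TA: "T_simple i (\<Sum>j\<in>A. peel_term k \<mu> b j) =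
        Cst (t_K ^ e) * (\<Sum>j\<in>A. peel_term k \<mu> (?s \<circ> b) j)" for A
  proof -
    have *: "(\<Sum>j\<in>{1..k + 1}. f j) = (\<Sum>j\<in>{1..k + 1} - A. f j) + (\<Sum>j\<in>A. f j)" for f :: "nat \<Rightarrow> mpol"
      using A(1) by (intro sum.subset_diff) auto
    have "T_simple i (\<Sum>j\<in>{1..k + 1} - A. peel_term k \<mu> b j) =
        Cst (t_K ^ e) * (\<Sum>j\<in>{1..k + 1} - A. peel_term k \<mu> (?s \<circ> b) j)"
      unfolding T_simple_sum sum_distrib_left using A(2) pass by (intro sum.cong) auto
    then show ?thesis unfolding E sE *[of "peel_term k \<mu> b"] *[of "peel_term k \<mu> (?s \<circ> b)"]
      by (simp only: T_simple_add TA distrib_left)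
  qed
  have fixed: "(?s \<circ> b) x = b x" "b x \<noteq> i" "b x \<noteq> i + 1" if "x \<noteq> p" "x \<noteq> p'" for x
    using that bi[of x] by (simp_all add: simple_refl_apply)
  consider "p > k + 1" | "p \<le> k + 1" "p' > k + 1" | "p \<le> k" "p' \<le> k + 1" using p by linarith
  then have "T_simple i (E_gen b \<mu>) = Cst (t_K ^ e) * E_gen (?s \<circ> b) \<mu>"
  proof cases
    case 1
    then show ?thesis using p by (intro split[of "{}"]) auto
  next
    case 2
    have pj: "p \<in> {1..k + 1}" using 2 p by simp
    define d :: nat where "d = of_bool (part \<mu> p' < a)"
    \<comment> \<open>In \<open>c p\<close> the value i sits in the last column, to the right of i +
      1, so the induction hypothesis is applied to the exchanged basement.\<close>
    have "T_simple i (E_gen (?s \<circ> c p) ?\<mu>') =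
        Cst (t_K ^ of_bool (part ?\<mu>' (?pos p p') \<le> part ?\<mu>' (?pos p p))) * E_gen (?s \<circ> (?s \<circ> c p)) ?\<mu>'"
    proof (rule IH[OF sc[OF pj]])
      show "1 \<le> ?pos p p'" "?pos p p' < ?pos p p" "?pos p p \<le> length ?\<mu>'"
        using 2 p k by (auto simp: peel_pos_def length_peel_shape)
      show "(?s \<circ> c p) (?pos p p') = i" "(?s \<circ> c p) (?pos p p) = i + 1"
        using cpos(1)[OF pj pn(1)] cpos(1)[OF pj pn(2)] bp bp' by (simp_all add: simple_refl_apply)
    qed
    also have "of_bool (part ?\<mu>' (?pos p p') \<le> part ?\<mu>' (?pos p p)) = d"
      using pos_part[OF pj pn(1)] pos_part[OF pj pn(2)] 2 p a by (auto simp: d_def)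
    also have "?s \<circ> (?s \<circ> c p) = c p" by (simp flip: comp_assoc)
    finally have "T_simple i (E_gen (?s \<circ> c p) ?\<mu>') = Cst (t_K ^ d) * E_gen (c p) ?\<mu>'" .
    then have X: "Cst (t_K ^ d) * T_simple i (X i * E_gen (c p) ?\<mu>') =
        Cst t_K * X (i + 1) * E_gen (?s \<circ> c p) ?\<mu>'"
      by (rule T_simple_X_of_T_simple_eq)
    have w: "peel_wt k \<mu> b p * t_K = t_K ^ (d + e) * peel_wt k \<mu> (?s \<circ> b) p"
    proof (cases "p = k + 1")
      case True
      then have "d + e = 1" by (auto simp: d_def e_def a_def)
      then show ?thesis
        using peel_wt_self permutes_inj[OF b] permutes_inj[OF sb] by (simp only: True power_one_right mult_1_left mult_1_right)
    next
      case False
      have e1: "e = 1" using False pj zero[of p] p by (simp add: e_def)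
      have "peel_exp k \<mu> b p = peel_exp k \<mu> (?s \<circ> b) p + (if p' \<in> short_cols k \<mu> then 1 else 0)"
      proof (rule peel_exp_shift)
        fix x assume x: "x \<in> short_cols k \<mu>"
        then have xk: "x > k + 1" by (simp add: short_cols_def)
        have 1: "(?s \<circ> b) (k + 1) < (?s \<circ> b) p \<longleftrightarrow> b (k + 1) < b p"
          and 2: "(?s \<circ> b) (k + 1) < (?s \<circ> b) x \<longleftrightarrow> b (k + 1) < b x"
          using False 2 pj xk by (intro cmp; auto simp: doubleton_eq_iff)+
        have 3: "(?s \<circ> b) x < (?s \<circ> b) p \<longleftrightarrow> b x < b p" if "x \<noteq> p'"
          using that False pj xk by (intro cmp) (auto simp: doubleton_eq_iff)
        have 4: "(?s \<circ> b) p' < (?s \<circ> b) p" "\<not> b p' < b p"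
          using bp bp' by (simp_all add: simple_refl_apply)
        show "of_bool (b p > b (k + 1)) - of_bool (b x > b (k + 1)) - of_bool (b p > b x) =
          of_bool ((?s \<circ> b) p > (?s \<circ> b) (k + 1)) - of_bool ((?s \<circ> b) x > (?s \<circ> b) (k + 1)) -
            of_bool ((?s \<circ> b) p > (?s \<circ> b) x) + (if x = p' then 1 else (0::int))"
          unfolding 1 2 using 3 4 by (cases "x = p'") simp_all
      qed
      moreover have "p' \<in> short_cols k \<mu> \<longleftrightarrow> part \<mu> p' < a"
        using p 2 by (simp add: short_cols_def a_def)
      moreover have "(?s \<circ> b) (k + 1) < (?s \<circ> b) p \<longleftrightarrow> b (k + 1) < b p"
        using False 2 by (intro cmp) (auto simp: doubleton_eq_iff)
      ultimately show ?thesis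
        unfolding peel_wt_def e1 by (simp add: power_int_add d_def del: comp_apply)
    qed
    have "Cst (t_K ^ d) * T_simple i (peel_term k \<mu> b p) =
        Cst (peel_wt k \<mu> b p) * (Cst (t_K ^ d) * T_simple i (X i * E_gen (c p) ?\<mu>'))"
      unfolding pterm bp mult.assoc T_simple_Cst_mult by (simp only: mult_ac)
    also have "\<dots> = Cst (peel_wt k \<mu> b p * t_K) * (X (i + 1) * E_gen (?s \<circ> c p) ?\<mu>')"
      unfolding X by (simp only: Cst_hom mult_ac)
    also have "\<dots> = Cst (t_K ^ d) * (Cst (t_K ^ e) * peel_term k \<mu> (?s \<circ> b) p)"
    proof -
      have "?s (b p) = i + 1" by (simp add: bp simple_refl_apply)
      then show ?thesis unfolding w sterm by (simp only: Cst_hom power_add mult_ac)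
    qed
    finally have "T_simple i (peel_term k \<mu> b p) = Cst (t_K ^ e) * peel_term k \<mu> (?s \<circ> b) p"
      by (rule Cst_t_K_cancel)
    then show ?thesis using pj 2 by (intro split[of "{p}"]) auto
  next
    case 3
    have pj: "p \<in> {1..k + 1}" "p' \<in> {1..k + 1}" "p \<noteq> p'" using 3 p by auto
    have e1: "e = 1" using 3 p zero[of p] by (simp add: e_def)
    define y where "y = E_gen (c p') ?\<mu>'"
    define y' where "y' = E_gen (c p) ?\<mu>'"
    have st: "?s \<circ> b = b \<circ> transpose p p'"
      using permutes_inj[OF b] bp bp' by (rule simple_refl_comp_eq)
    \<comment> \<open>sigma_i exchanges the two peeled basements, exactly if p' = k + 1 and
      otherwise up to swapping two empty columns.\<close>
    have swap: "E_gen (?s \<circ> c p') ?\<mu>' = y' \<and> E_gen (?s \<circ> c p) ?\<mu>' = y"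
    proof (cases "p' = k + 1")
      case True
      have "?s \<circ> c p' = c p"
        unfolding c_def peel_perm_def True by (simp add: st True flip: comp_assoc)
      moreover from this have "?s \<circ> c p = c p'" by (metis comp_assoc simple_refl_invol id_comp)
      ultimately show ?thesis by (simp only: y_def y'_def)
    next
      case False
      then have pk: "p \<in> {1..k}" "p' \<in> {1..k}" using 3 p by auto
      have tp: "transpose p p' \<circ> peel_perm k ?n j = peel_perm k ?n (transpose p p' j) \<circ> transpose p p'" for j
        using pk k by (intro transpose_comp_peel_perm) auto
      have "?s \<circ> c p' = c p \<circ> transpose p p'" "?s \<circ> c p = c p' \<circ> transpose p p'"
        using tp[of p'] tp[of p] unfolding c_def comp_assoc[symmetric] st by (simp_all add: comp_assoc)
      then show ?thesis
        using E_gen_swap_zero_prefix[OF c zero', of _ k p p'] pj pk k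
        by (simp only: y_def y'_def) (simp add: length_peel_shape)
    qed
    have "T_simple i (E_gen (c p') ?\<mu>') =
        Cst (t_K ^ of_bool (part ?\<mu>' (?pos p' p) \<le> part ?\<mu>' (?pos p' p'))) * E_gen (?s \<circ> c p') ?\<mu>'"
    proof (rule IH[OF c[OF pj(2)]])
      show "1 \<le> ?pos p' p" "?pos p' p < ?pos p' p'" "?pos p' p' \<le> length ?\<mu>'"
        using 3 p k by (auto simp: peel_pos_def length_peel_shape)
      show "c p' (?pos p' p) = i" "c p' (?pos p' p') = i + 1"
        using cpos(1)[OF pj(2) pn(1)] cpos(1)[OF pj(2) pn(2)] bp bp' by simp_all
    qed
    also have "of_bool (part ?\<mu>' (?pos p' p) \<le> part ?\<mu>' (?pos p' p')) = (1::nat)"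
      using pos_part[OF pj(2) pn(1)] 3 pj by auto
    finally have Ty: "T_simple i y = Cst (t_K ^ 1) * y'" using swap by (simp only: y_def)
    then have T1: "T_simple i (X i * y') = X (i + 1) * y"
      using T_simple_X_of_T_simple_eq[OF Ty] by (simp add: mult.assoc)
    have T2: "T_simple i (X (i + 1) * y) = Cst t_K * (X i * y') + (Cst t_K - 1) * (X (i + 1) * y)"
      unfolding T_simple_X_Suc Ty by (simp add: mult_ac)
    \<comment> \<open>For p' = k + 1 the second equation is f + (t - 1) = f q^a t^(A+1) with f the
      peel factor and A the number of short columns. Otherwise all four weights agree, as no other
      basement value can separate i from i + 1.\<close>
    have w: "peel_wt k \<mu> b p' = peel_wt k \<mu> (?s \<circ> b) p' \<and>
      peel_wt k \<mu> b p + (t_K - 1) * peel_wt k \<mu> b p' = t_K * peel_wt k \<mu> (?s \<circ> b) p"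
    proof (cases "p' = k + 1")
      case True
      have 1: "peel_wt k \<mu> b p' = 1" "peel_wt k \<mu> (?s \<circ> b) p' = 1"
        unfolding True using peel_wt_self permutes_inj[OF b] permutes_inj[OF sb] by blast+
      have bk: "b (k + 1) = i + 1" "(?s \<circ> b) (k + 1) = i" "(?s \<circ> b) p = i + 1"
        using True bp bp' by (simp_all add: simple_refl_apply)
      have e0: "peel_exp k \<mu> b p = 0"
        unfolding peel_exp_def
      proof (intro sum.neutral ballI)
        fix x assume "x \<in> short_cols k \<mu>"
        then have "x \<noteq> p" "x \<noteq> p'" using 3 by (auto simp: short_cols_def)
        then show "1 + of_bool (b (k + 1) < b p) - of_bool (b (k + 1) < b x) - of_bool (b x < b p) = (0::int)"
          using fixed(2,3)[of x] bp bk by auto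
      qed
      have eA: "peel_exp k \<mu> (?s \<circ> b) p = int (card (short_cols k \<mu>))"
      proof -
        have "peel_exp k \<mu> (?s \<circ> b) p = (\<Sum>x\<in>short_cols k \<mu>. 1)"
          unfolding peel_exp_def
        proof (intro sum.cong refl)
          fix x assume "x \<in> short_cols k \<mu>"
          then have "x \<noteq> p" "x \<noteq> p'" using 3 by (auto simp: short_cols_def)
          then show "1 + of_bool ((?s \<circ> b) (k + 1) < (?s \<circ> b) p) - of_bool ((?s \<circ> b) (k + 1) < (?s \<circ> b) x) -
              of_bool ((?s \<circ> b) x < (?s \<circ> b) p) = (1::int)"
            unfolding bk using fixed[of x] by auto
        qed
        then show ?thesis by simp
      qed
      have "peel_wt k \<mu> b p = peel_factor k \<mu>"
        using 3 bp bk by (simp add: peel_wt_def e0)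
      moreover have "peel_wt k \<mu> (?s \<circ> b) p = peel_factor k \<mu> * (q_K ^ a * t_K ^ card (short_cols k \<mu>))"
        unfolding peel_wt_def eA bk using 3 by (simp add: a_def)
      moreover have "peel_factor k \<mu> + (t_K - 1) = t_K * (peel_factor k \<mu> * (q_K ^ a * t_K ^ card (short_cols k \<mu>)))"
        using peel_factor_denom_nonzero[OF peel.hyps(3), of "card (short_cols k \<mu>) + 1"]
        unfolding peel_factor_def a_def by (simp add: divide_simps) (simp add: algebra_simps)
      ultimately show ?thesis using 1 by simp
    next
      case False
      have all: "peel_wt k \<mu> c' j = peel_wt k \<mu> b p"
        if cj: "c' = b \<or> c' = ?s \<circ> b" "j = p \<or> j = p'" for c' j
      proof -
        have v: "c' j \<in> {i, i + 1}" using cj bp bp' by (auto simp: simple_refl_apply)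
        have cx: "c' x = b x" "b x < c' j \<longleftrightarrow> b x < i" "c' j < b x \<longleftrightarrow> i < b x" if "x \<noteq> p" "x \<noteq> p'" for x
          using fixed[OF that] cj(1) v by auto
        have kk: "k + 1 \<noteq> p" "k + 1 \<noteq> p'" using False 3 by auto
        have "peel_exp k \<mu> c' j = peel_exp k \<mu> b p"
          unfolding peel_exp_def
        proof (intro sum.cong refl)
          fix x assume "x \<in> short_cols k \<mu>"
          then have "x \<noteq> p" "x \<noteq> p'" using 3 by (auto simp: short_cols_def)
          then show "1 + of_bool (c' (k + 1) < c' j) - of_bool (c' (k + 1) < c' x) - of_bool (c' x < c' j) =
            1 + of_bool (b (k + 1) < b p) - of_bool (b (k + 1) < b x) - of_bool (b x < b p)"
            using cx kk bp by simp
        qed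
        then show ?thesis using cx[OF kk] kk cj bp by (auto simp: peel_wt_def)
      qed
      have "peel_wt k \<mu> b p' = peel_wt k \<mu> b p" "peel_wt k \<mu> (?s \<circ> b) p = peel_wt k \<mu> b p"
        "peel_wt k \<mu> (?s \<circ> b) p' = peel_wt k \<mu> b p"
        by (rule all; simp)+
      then show ?thesis by (simp only: left_diff_distrib mult_1_left) simp
    qed
    have sv: "?s (b p) = i + 1" "?s (b p') = i" using bp bp' by (simp_all add: simple_refl_apply)
    have c1: "Cst (peel_wt k \<mu> b p) + (Cst t_K - 1) * Cst (peel_wt k \<mu> (?s \<circ> b) p') =
        Cst t_K * Cst (peel_wt k \<mu> (?s \<circ> b) p)"
    proof -
      have "Cst (peel_wt k \<mu> b p + (t_K - 1) * peel_wt k \<mu> b p') = Cst (t_K * peel_wt k \<mu> (?s \<circ> b) p)"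
        by (rule arg_cong[of _ _ Cst, OF conjunct2[OF w]])
      then show ?thesis unfolding conjunct1[OF w] by (simp add: Cst_hom)
    qed
    have "T_simple i (peel_term k \<mu> b p + peel_term k \<mu> b p') =
        Cst (peel_wt k \<mu> b p) * T_simple i (X i * y') +
        Cst (peel_wt k \<mu> (?s \<circ> b) p') * T_simple i (X (i + 1) * y)"
      unfolding pterm bp bp' y_def[symmetric] y'_def[symmetric] T_simple_add mult.assoc
        T_simple_Cst_mult using w by simp
    also have "\<dots> = (Cst (peel_wt k \<mu> b p) + (Cst t_K - 1) * Cst (peel_wt k \<mu> (?s \<circ> b) p')) * (X (i + 1) * y) +
        Cst t_K * (Cst (peel_wt k \<mu> (?s \<circ> b) p') * (X i * y'))"
      unfolding T1 T2 by (simp only: ring_distribs mult_ac add_ac)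
    also have "\<dots> = Cst (t_K ^ e) * (peel_term k \<mu> (?s \<circ> b) p + peel_term k \<mu> (?s \<circ> b) p')"
      unfolding c1 sterm sv e1 using swap by (simp only: distrib_left mult_ac power_one_right)
    finally have "T_simple i (\<Sum>j\<in>{p, p'}. peel_term k \<mu> b j) =
        Cst (t_K ^ e) * (\<Sum>j\<in>{p, p'}. peel_term k \<mu> (?s \<circ> b) j)"
      using pj by simp
    then show ?thesis using pj by (intro split[of "{p, p'}"]) auto
  qed
  then show ?case unfolding e_def .
qed

section \<open>Columns of equal height\<close>

lemma peel_perm_apply:
  assumes "k < n" "j \<in> {1..k + 1}"
  shows "peel_perm k n j x =
    (if x = n then j else if n < x then x else if k < x then x + 1 else if x = j then k + 1 else x)"
  using assms by (auto simp: peel_perm_def rot_def transpose_def)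

text \<open>The grouping for peeling twice: the three terms that involve an index j \<le> k and
  otherwise only k + 1 do not match one by one when the columns are exchanged, but their sums
  do.\<close>

lemma sum_square_split:
  fixes g :: "nat \<Rightarrow> nat \<Rightarrow> 'a::comm_monoid_add"
  shows "(\<Sum>j\<in>{1..k + 1}. \<Sum>j'\<in>{1..k + 1}. g j j') =
    g (k + 1) (k + 1) + (\<Sum>j\<in>{1..k}. g j (k + 1) + g (k + 1) j + g j j) +
    (\<Sum>j\<in>{1..k}. \<Sum>j'\<in>{1..k} - {j}. g j j')"
proof -
  have "(\<Sum>j\<in>{1..k}. \<Sum>j'\<in>{1..k}. g j j') =
      (\<Sum>j\<in>{1..k}. g j j + (\<Sum>j'\<in>{1..k} - {j}. g j j'))"
    by (intro sum.cong refl sum.remove) auto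
  then show ?thesis by (simp add: sum.distrib add_ac)
qed

text \<open>The relations between the peel factors of the two steps, with Y = q^a t^(A+1) for A
  short columns; the second step has one short column more.\<close>

lemma peel_factor_identities:
  fixes Y t :: "'a::field"
  assumes "1 - Y \<noteq> 0" "1 - Y * t \<noteq> 0"
  shows "(1 - t) / (1 - Y * t) * t + (1 - t) / (1 - Y) * ((1 - t) / (1 - Y * t)) = (1 - t) / (1 - Y)"
    and "(1 - t) / (1 - Y * t) + (1 - t) / (1 - Y) * ((1 - t) / (1 - Y * t)) * Y = (1 - t) / (1 - Y)"
proof -
  define u v where "u = 1 - Y" and "v = 1 - Y * t"
  have uv: "u \<noteq> 0" "v \<noteq> 0" using assms by (simp_all add: u_def v_def)
  have "(1 - t) / v * t + (1 - t) / u * ((1 - t) / v) = (1 - t) * (t * u + (1 - t)) / (u * v)"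
    using uv by (simp add: field_simps)
  also have "t * u + (1 - t) = v" by (simp add: u_def v_def algebra_simps)
  finally have "(1 - t) / v * t + (1 - t) / u * ((1 - t) / v) = (1 - t) / u" using uv by simp
  then show "(1 - t) / (1 - Y * t) * t + (1 - t) / (1 - Y) * ((1 - t) / (1 - Y * t)) = (1 - t) / (1 - Y)"
    unfolding u_def v_def .
  have "(1 - t) / v + (1 - t) / u * ((1 - t) / v) * Y = (1 - t) * (u + (1 - t) * Y) / (u * v)"
    using uv by (simp add: field_simps)
  also have "u + (1 - t) * Y = v" by (simp add: u_def v_def algebra_simps)
  finally have "(1 - t) / v + (1 - t) / u * ((1 - t) / v) * Y = (1 - t) / u" using uv by simp
  then show "(1 - t) / (1 - Y * t) + (1 - t) / (1 - Y) * ((1 - t) / (1 - Y * t)) * Y = (1 - t) / (1 - Y)"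
    unfolding u_def v_def .
qed

text \<open>Both columns are peeled off; the two orders of the columns are compared term by term.\<close>

lemma E_gen_swap_first_columns:
  assumes k: "k + 1 < length \<mu>" and zero: "\<And>i. 1 \<le> i \<Longrightarrow> i \<le> k \<Longrightarrow> part \<mu> i = 0"
    and pos: "part \<mu> (k + 1) \<ge> 1" and eq: "part \<mu> (k + 2) = part \<mu> (k + 1)"
    and b: "b permutes {1..length \<mu>}" and bi: "b (k + 1) = i" "b (k + 2) = i + 1"
    and IH: "\<And>c. c permutes {1..length \<mu>} \<Longrightarrow>
      E_gen (c \<circ> transpose (length \<mu> - 1) (length \<mu>)) (peel_shape k (peel_shape k \<mu>)) =
      E_gen c (peel_shape k (peel_shape k \<mu>))"
  shows "E_gen (simple_refl i \<circ> b) \<mu> = E_gen b \<mu>"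
proof -
  define n where "n = length \<mu>"
  define K where "K = k + 1"
  define a where "a = part \<mu> K"
  define \<mu>' where "\<mu>' = peel_shape k \<mu>"
  define \<mu>'' where "\<mu>'' = peel_shape k \<mu>'"
  define \<tau> where "\<tau> = transpose K (K + 1)"
  define pp where "pp = peel_perm k n"
  have kn: "k < n" "K < n" using k by (auto simp: n_def K_def)
  have n': "length \<mu>' = n" "length \<mu>'' = n"
    using kn by (simp_all add: \<mu>'_def \<mu>''_def length_peel_shape n_def)
  have part': "part \<mu>' x = (if x \<le> k then 0 else if x < n then part \<mu> (x + 1) else a - 1)"
    if "x \<in> {1..n}" for x
    using part_peel_shape[of k \<mu> x] that kn by (simp add: \<mu>'_def n_def a_def K_def)
  have partK': "part \<mu>' (k + 1) = a" using part'[of K] kn eq by (simp add: K_def a_def)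
  have part'': "part \<mu>'' x = 0" if "1 \<le> x" "x \<le> k" for x
    using part_peel_shape[of k \<mu>' x] that kn n' by (simp add: \<mu>''_def)
  have binj: "b x = b y \<longleftrightarrow> x = y" for x y by (rule inj_eq[OF permutes_inj[OF b]])
  have bK: "b K = i" "b (K + 1) = i + 1" using bi by (simp_all add: K_def)
  have sb: "simple_refl i \<circ> b = b \<circ> \<tau>"
    unfolding \<tau>_def using permutes_inj[OF b] bK by (intro simple_refl_comp_eq)
  have \<tau>p: "\<tau> permutes {1..n}" unfolding \<tau>_def using kn by (intro permutes_swap_id) (auto simp: K_def)
  have bp: "b permutes {1..n}" and bt: "b \<circ> \<tau> permutes {1..n}"
    using b \<tau>p by (auto simp: n_def intro: permutes_compose)
  have pp: "pp j permutes {1..n}" if "j \<in> {1..K}" for j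
    unfolding pp_def using kn that by (intro peel_perm_permutes) (auto simp: K_def)
  have ppx: "pp j x = (if x = n then j else if n < x then x else if k < x then x + 1
      else if x = j then K else x)" if "j \<in> {1..K}" for j x
    using peel_perm_apply[of k n j x] kn that by (simp add: pp_def K_def)
  have small: "b j < i \<or> b j > i + 1" if "j \<in> {1..k}" for j
    using binj[of j K] binj[of j "K + 1"] that bK by (auto simp: K_def)
  have short: "b p < i \<or> b p > i + 1" "\<tau> p = p" "p > K + 1" "p \<le> n" if "p \<in> short_cols k \<mu>" for p
  proof -
    have "p > K" "p \<noteq> K + 1" "p \<le> n" using that eq by (auto simp: short_cols_def K_def n_def)
    then show "b p < i \<or> b p > i + 1" "\<tau> p = p" "p > K + 1" "p \<le> n"
      using binj[of p K] binj[of p "K + 1"] bK by (auto simp: \<tau>_def transpose_def)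
  qed
  have \<tau>small: "\<tau> j = j" if "j \<in> {1..k}" for j using that by (auto simp: \<tau>_def transpose_def K_def)
  have \<tau>K: "\<tau> K = K + 1" "\<tau> (K + 1) = K" by (simp_all add: \<tau>_def)

  define F where "F c j j' = E_gen (c \<circ> pp j \<circ> pp j') \<mu>''" for c j j'
  define W where "W c j j' = peel_wt k \<mu> c j * peel_wt k \<mu>' (c \<circ> pp j) j'" for c j j'
  define g where "g c j j' = Cst (W c j j') * (X (c j) * X ((c \<circ> pp j) j')) * F c j j'" for c j j'
  have expand: "E_gen c \<mu> = (\<Sum>j\<in>{1..k + 1}. \<Sum>j'\<in>{1..k + 1}. g c j j')" if c: "c permutes {1..n}" for c
  proof -
    have "E_gen (c \<circ> pp j) \<mu>' = (\<Sum>j'\<in>{1..k + 1}. Cst (peel_wt k \<mu>' (c \<circ> pp j) j') *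
        X ((c \<circ> pp j) j') * F c j j')" if j: "j \<in> {1..k + 1}" for j
    proof -
      have "c \<circ> pp j permutes {1..length \<mu>'}"
        using c pp[of j] j by (auto simp: K_def n' intro: permutes_compose)
      then show ?thesis
        using E_gen_peel[of k \<mu>' "c \<circ> pp j"] kn part' partK' pos
        by (simp add: n' F_def pp_def \<mu>''_def a_def K_def)
    qed
    then show ?thesis
      using E_gen_peel[of k \<mu> c] kn zero pos c
      by (simp only: n_def[symmetric] pp_def[symmetric] \<mu>'_def[symmetric] g_def W_def
          sum_distrib_left Cst_hom mult_ac cong: sum.cong)
  qed

  \<comment> \<open>The column peeled first, now last and of height a - 1, is short relative to the
    second one.\<close>
  have short': "short_cols k \<mu>' = insert n ((\<lambda>p. p - 1) ` short_cols k \<mu>)"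
  proof (intro set_eqI iffI)
    fix x assume x: "x \<in> short_cols k \<mu>'"
    then have x: "k + 1 < x" "x \<le> n" "part \<mu>' x < a" using partK' n' by (auto simp: short_cols_def)
    show "x \<in> insert n ((\<lambda>p. p - 1) ` short_cols k \<mu>)"
    proof (cases "x = n")
      case False
      then have "x + 1 \<in> short_cols k \<mu>"
        using x part'[of x] by (simp add: short_cols_def n_def a_def K_def)
      then show ?thesis by force
    qed simp
  next
    fix x assume "x \<in> insert n ((\<lambda>p. p - 1) ` short_cols k \<mu>)"
    then show "x \<in> short_cols k \<mu>'"
    proof
      assume "x = n"
      then show ?thesis
        using part'[of n] kn partK' n' pos by (simp add: short_cols_def K_def a_def)
    next
      assume "x \<in> (\<lambda>p. p - 1) ` short_cols k \<mu>"
      then obtain p where p: "p \<in> short_cols k \<mu>" "x = p - 1" by blast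
      have px: "k + 1 < x" "x < n" "x + 1 = p" using short(3,4)[OF p(1)] p(2) by (auto simp: K_def)
      then have "part \<mu>' x = part \<mu> p" using part'[of x] by simp
      then show ?thesis
        using px p(1) n' partK' by (simp add: short_cols_def a_def K_def)
    qed
  qed
  define xs :: "nat \<Rightarrow> nat \<Rightarrow> int" where
    "xs v u = (\<Sum>p\<in>short_cols k \<mu>. 1 + of_bool (v > u) - of_bool (b p > u) - of_bool (v > b p))" for v u
  have n_notin: "n \<notin> (\<lambda>p. p - 1) ` short_cols k \<mu>" using short(3,4) by force
  have inj_pred: "inj_on (\<lambda>p. p - 1) (short_cols k \<mu>)"
    using short(3) by (force simp: inj_on_def)
  have card': "card (short_cols k \<mu>') = card (short_cols k \<mu>) + 1"
    unfolding short' using n_notin inj_pred by (simp add: card_image)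
  have exp1: "peel_exp k \<mu> c j = xs (c j) (c K)" if "c = b \<or> c = b \<circ> \<tau>" for c j
    unfolding peel_exp_def xs_def K_def using that short(2) by (intro sum.cong refl) auto
  have exp2: "peel_exp k \<mu>' (c \<circ> pp j) j' = xs v' u +
      (1 + of_bool (v' > u) - of_bool (c j > u) - of_bool (v' > c j))"
    if c: "c = b \<or> c = b \<circ> \<tau>" and j: "j \<in> {1..K}" and v': "v' = (c \<circ> pp j) j'" and u: "u = c (K + 1)"
    for c j j' v' u
  proof -
    have cK: "(c \<circ> pp j) (k + 1) = u" using ppx[OF j, of K] kn u by (simp add: K_def)
    have cn: "(c \<circ> pp j) n = c j" using ppx[OF j, of n] by simp
    have cs: "(c \<circ> pp j) (p - 1) = b p" if "p \<in> short_cols k \<mu>" for p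
      using ppx[OF j, of "p - 1"] short[OF that] c by (auto simp: K_def)
    have "peel_exp k \<mu>' (c \<circ> pp j) j' =
        (1 + of_bool (v' > u) - of_bool (c j > u) - of_bool (v' > c j)) +
        (\<Sum>p\<in>short_cols k \<mu>. 1 + of_bool (v' > u) - of_bool ((c \<circ> pp j) (p - 1) > u) -
          of_bool (v' > (c \<circ> pp j) (p - 1)))"
      unfolding peel_exp_def short' cK v'[symmetric] using n_notin inj_pred
      by (simp only: sum.insert finite_imageI finite_short_cols cn sum.reindex not_False_eq_True)
        (simp only: o_def)
    also have "(\<Sum>p\<in>short_cols k \<mu>. 1 + of_bool (v' > u) - of_bool ((c \<circ> pp j) (p - 1) > u) -
          of_bool (v' > (c \<circ> pp j) (p - 1))) = xs v' u"
      unfolding xs_def by (intro sum.cong refl) (simp only: cs)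
    finally show ?thesis by (simp only: add.commute)
  qed
  define c0 where "c0 = peel_factor k \<mu>"
  define c1 where "c1 = peel_factor k \<mu>'"
  define Y where "Y = q_K ^ a * t_K ^ (card (short_cols k \<mu>) + 1)"
  have c01: "c1 * t_K + c0 * c1 = c0" "c1 + c0 * c1 * Y = c0"
  proof -
    have "c0 = (1 - t_K) / (1 - Y)" "c1 = (1 - t_K) / (1 - Y * t_K)"
      unfolding c0_def c1_def peel_factor_def card' partK' by (simp_all add: Y_def a_def K_def mult_ac)
    moreover have "1 - Y \<noteq> 0" "1 - Y * t_K \<noteq> 0"
      using peel_factor_denom_nonzero[OF pos, of "card (short_cols k \<mu>) + 1"]
        peel_factor_denom_nonzero[OF pos, of "card (short_cols k \<mu>) + 2"]
      by (simp_all add: Y_def a_def K_def mult_ac)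
    ultimately show "c1 * t_K + c0 * c1 = c0" "c1 + c0 * c1 * Y = c0"
      using peel_factor_identities[of Y t_K] by simp_all
  qed
  define P where "P j = q_K ^ (if b j > i then a else 0) * t_K powi xs (b j) i" for j
  have xs_i: "xs v (i + 1) = xs v i" if "v < i \<or> v > i + 1" for v
    unfolding xs_def using that short(1) by (intro sum.cong refl) force
  have xs_0: "xs i (i + 1) = 0"
    unfolding xs_def using short(1) by (intro sum.neutral ballI) force
  have xs_A: "xs (i + 1) i = int (card (short_cols k \<mu>))"
  proof -
    have "xs (i + 1) i = (\<Sum>p\<in>short_cols k \<mu>. 1)"
      unfolding xs_def using short(1) by (intro sum.cong refl) force
    then show ?thesis by simp
  qed
  have w_first: "peel_wt k \<mu> c K = 1" "peel_wt k \<mu>' (c \<circ> pp j) K = 1"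
    if "c = b \<or> c = b \<circ> \<tau>" "j \<in> {1..K}" for c j
  proof -
    have "inj c" "inj (c \<circ> pp j)"
      using that permutes_inj[OF bp] permutes_inj[OF bt] permutes_inj[OF pp] by (auto intro: inj_compose)
    then show "peel_wt k \<mu> c K = 1" "peel_wt k \<mu>' (c \<circ> pp j) K = 1"
      unfolding K_def by (simp_all only: peel_wt_self)
  qed
  have w1: "peel_wt k \<mu> b j = c0 * P j" "peel_wt k \<mu> (b \<circ> \<tau>) j = c0 * P j" if j: "j \<in> {1..k}" for j
  proof -
    have jk: "j \<noteq> k + 1" using j by simp
    show "peel_wt k \<mu> b j = c0 * P j"
      unfolding peel_wt_def using jk exp1[of b j] bK
      by (simp add: c0_def P_def a_def K_def)
    have "(b \<circ> \<tau>) j = b j" "(b \<circ> \<tau>) (k + 1) = i + 1"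
      using \<tau>small[OF j] \<tau>K bK by (simp_all add: K_def)
    moreover have "b j > i + 1 \<longleftrightarrow> b j > i" using small[OF j] by auto
    ultimately show "peel_wt k \<mu> (b \<circ> \<tau>) j = c0 * P j"
      unfolding peel_wt_def using jk exp1[of "b \<circ> \<tau>" j] xs_i[OF small[OF j]]
      by (simp add: c0_def P_def a_def K_def)
  qed
  have wt2: "peel_wt k \<mu>' (c \<circ> pp j) j' = c1 * q_K ^ (if v' > u then a else 0) *
      t_K powi (xs v' u + (1 + of_bool (v' > u) - of_bool (c j > u) - of_bool (v' > c j)))"
    if c: "c = b \<or> c = b \<circ> \<tau>" and j: "j \<in> {1..K}" "j' \<in> {1..k}" and v': "v' = (c \<circ> pp j) j'"
      and u: "u = c (K + 1)" for c j j' v' u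
  proof -
    have "j' \<noteq> k + 1" using j(2) by simp
    moreover have "(c \<circ> pp j) (k + 1) = u" using ppx[OF j(1), of K] kn u by (simp add: K_def)
    ultimately show ?thesis
      unfolding peel_wt_def exp2[OF c j(1) v' u] partK' by (simp only: v'[symmetric] c1_def if_False)
  qed
  have vals: "(c \<circ> pp K) j = c j" "(c \<circ> pp j) j = c K" "(c \<circ> pp j) K = c (K + 1)"
    "(c \<circ> pp K) K = c (K + 1)" "j' \<noteq> j \<Longrightarrow> (c \<circ> pp j) j' = c j'"
    if "j \<in> {1..k}" "j' \<in> {1..k}" for c :: "nat \<Rightarrow> nat" and j j'
    using that kn ppx[of j] ppx[of K] by (auto simp: K_def)
  have w2: "peel_wt k \<mu>' (b \<circ> pp K) j = c1 * P j * t_K"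
    "peel_wt k \<mu>' (b \<circ> pp j) j = c1"
    "peel_wt k \<mu>' (b \<circ> \<tau> \<circ> pp K) j = c1 * P j"
    "peel_wt k \<mu>' (b \<circ> \<tau> \<circ> pp j) j = c1 * Y"
    if j: "j \<in> {1..k}" for j
  proof -
    have jK: "j \<in> {1..K}" "K \<in> {1..K}" using j by (auto simp: K_def)
    have bt: "(b \<circ> \<tau>) j = b j" "(b \<circ> \<tau>) K = i + 1" "(b \<circ> \<tau>) (K + 1) = i"
      using \<tau>small[OF j] \<tau>K bK by simp_all
    note v = vals[OF j j]
    note z = small[OF j]
    have bj: "b j > i + 1 \<longleftrightarrow> b j > i" using z by auto
    note wb = wt2[OF disjI1[OF refl], OF _ j _ bK(2)[symmetric]]
    note wt = wt2[OF disjI2[OF refl], OF _ j _ bt(3)[symmetric]]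
    show "peel_wt k \<mu>' (b \<circ> pp K) j = c1 * P j * t_K"
      unfolding wb[OF jK(2) v(1)[symmetric]] bK xs_i[OF z] P_def
      using z by (auto simp: power_int_add)
    show "peel_wt k \<mu>' (b \<circ> pp j) j = c1"
      unfolding wb[OF jK(1) v(2)[symmetric]] bK xs_0 using z by auto
    show "peel_wt k \<mu>' (b \<circ> \<tau> \<circ> pp K) j = c1 * P j"
      unfolding wt[OF jK(2) v(1)[symmetric]] bt P_def using z by auto
    show "peel_wt k \<mu>' (b \<circ> \<tau> \<circ> pp j) j = c1 * Y"
      unfolding wt[OF jK(1) v(2)[symmetric]] bt xs_A Y_def using z by (auto simp: power_int_add)
  qed
  have w3: "peel_wt k \<mu>' (b \<circ> \<tau> \<circ> pp j) j' = peel_wt k \<mu>' (b \<circ> pp j) j'"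
    if j: "j \<in> {1..k}" "j' \<in> {1..k}" "j' \<noteq> j" for j j'
  proof -
    have jK: "j \<in> {1..K}" using j by (auto simp: K_def)
    have bt: "(b \<circ> \<tau>) j = b j" "(b \<circ> \<tau>) j' = b j'" "(b \<circ> \<tau>) (K + 1) = i"
      using \<tau>small j \<tau>K bK by simp_all
    note v = vals(5)[OF j]
    note z = small[OF j(1)] and z' = small[OF j(2)]
    have "b j' > i + 1 \<longleftrightarrow> b j' > i" "b j > i + 1 \<longleftrightarrow> b j > i" using z z' by auto
    then show ?thesis
      unfolding wt2[OF disjI1[OF refl] jK j(2) v[symmetric] bK(2)[symmetric]]
        wt2[OF disjI2[OF refl] jK j(2) v[symmetric] bt(3)[symmetric]] bt xs_i[OF z']
      by (simp only:)
  qed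
  \<comment> \<open>After both steps the two columns stand last, each of height a - 1, and their
    basement values may be exchanged.\<close>
  have last_swap: "E_gen (c \<circ> transpose (n - 1) n) \<mu>'' = E_gen c \<mu>''" if "c permutes {1..n}" for c
    using IH[of c] that by (simp only: n_def \<mu>'_def \<mu>''_def)
  have perm2: "c \<circ> pp j \<circ> pp j' permutes {1..n}" if "c permutes {1..n}" "j \<in> {1..K}" "j' \<in> {1..K}" for c j j'
    using that by (intro permutes_compose pp)
  have F_KK: "F (b \<circ> \<tau>) K K = F b K K"
  proof -
    have "b \<circ> \<tau> \<circ> pp K \<circ> pp K = b \<circ> pp K \<circ> pp K \<circ> transpose (n - 1) n"
      using kn ppx[of K] by (auto simp: fun_eq_iff \<tau>_def transpose_def K_def)
    then show ?thesis using last_swap[OF perm2[OF bp, of K K]] by (simp add: F_def K_def)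
  qed
  have F_jj: "F c K j = F c j j" if c: "c permutes {1..n}" and j: "j \<in> {1..k}" for c j
  proof -
    have "c \<circ> pp K \<circ> pp j = c \<circ> pp j \<circ> pp j \<circ> transpose (n - 1) n"
      using kn ppx[of K] ppx[of j] j by (auto simp: fun_eq_iff transpose_def K_def)
    then show ?thesis using last_swap[OF perm2[OF c, of j j]] j by (simp add: F_def K_def)
  qed
  have F_jK: "F (c \<circ> \<tau>) j K = F c j j" if j: "j \<in> {1..k}" for c j
  proof -
    have "c \<circ> \<tau> \<circ> pp j \<circ> pp K = c \<circ> pp j \<circ> pp j"
      using kn ppx[of K] ppx[of j] j by (auto simp: fun_eq_iff \<tau>_def transpose_def K_def)
    then show ?thesis by (simp only: F_def)
  qed
  have F_jj': "F (b \<circ> \<tau>) j j' = F b j j'" if j: "j \<in> {1..k}" "j' \<in> {1..k}" "j' \<noteq> j" for j j'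
  proof -
    have "b \<circ> \<tau> \<circ> pp j \<circ> pp j' = b \<circ> pp j \<circ> pp j' \<circ> transpose j j'"
      using kn ppx[of j] ppx[of j'] j by (auto simp: fun_eq_iff \<tau>_def transpose_def K_def)
    moreover have "E_gen (b \<circ> pp j \<circ> pp j' \<circ> transpose j j') \<mu>'' = E_gen (b \<circ> pp j \<circ> pp j') \<mu>''"
      using perm2[OF bp, of j j'] j kn part''
      by (intro E_gen_swap_zero_prefix[of _ _ k]) (auto simp: n' K_def)
    ultimately show ?thesis by (simp only: F_def)
  qed
  have \<tau>\<tau>: "b \<circ> \<tau> \<circ> \<tau> = b" by (simp add: comp_assoc \<tau>_def)
  have g_KK: "g (b \<circ> \<tau>) K K = g b K K"
  proof -
    have K: "K \<in> {1..K}" by (simp add: K_def)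
    have "(b \<circ> \<tau>) K = i + 1" "(b \<circ> \<tau> \<circ> pp K) K = i" "(b \<circ> pp K) K = i + 1"
      using \<tau>K bK ppx[OF K, of K] kn by (simp_all add: K_def)
    moreover have "W c K K = 1" if "c = b \<or> c = b \<circ> \<tau>" for c
      using w_first[OF that K] by (simp only: W_def mult_1_left)
    ultimately show ?thesis unfolding g_def F_KK bK by (simp only: mult_ac simp_thms)
  qed
  \<comment> \<open>The terms containing x_i match among themselves, as do those containing x_(i+1);
    in each group two terms on one side add up to a single term on the other.\<close>
  have g_single: "g (b \<circ> \<tau>) j K + g (b \<circ> \<tau>) K j + g (b \<circ> \<tau>) j j = g b j K + g b K j + g b j j"
    if j: "j \<in> {1..k}" for j
  proof -
    have jK: "j \<in> {1..K}" "K \<in> {1..K}" using j by (auto simp: K_def)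
    have bt': "(b \<circ> \<tau>) j = b j" "(b \<circ> \<tau>) K = i + 1" "(b \<circ> \<tau>) (K + 1) = i"
      using \<tau>small[OF j] \<tau>K bK by simp_all
    have W: "W b j K = c0 * P j" "W b K j = c1 * t_K * P j" "W b j j = c0 * c1 * P j"
      "W (b \<circ> \<tau>) j K = c0 * P j" "W (b \<circ> \<tau>) K j = c1 * P j" "W (b \<circ> \<tau>) j j = c0 * c1 * Y * P j"
      unfolding W_def using w_first[of b] w_first[of "b \<circ> \<tau>"] jK w1[OF j] w2[OF j]
      by (simp_all only: simp_thms mult_1_left mult_1_right mult_ac)
    define G where "G = F b j j"
    define H where "H = F (b \<circ> \<tau>) j j"
    have FG: "F b K j = G" "F (b \<circ> \<tau>) j K = G" "F (b \<circ> \<tau>) K j = H" "F b j K = H"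
      using F_jj[OF bp j] F_jK[OF j, of b] F_jj[OF bt j] F_jK[OF j, of "b \<circ> \<tau>"] \<tau>\<tau>
      by (simp_all only: G_def H_def)
    have gb: "g b j K = Cst (c0 * P j) * (X (b j) * X (i + 1)) * H"
      "g b K j = Cst (c1 * t_K * P j) * (X i * X (b j)) * G"
      "g b j j = Cst (c0 * c1 * P j) * (X (b j) * X i) * G"
      "g (b \<circ> \<tau>) j K = Cst (c0 * P j) * (X (b j) * X i) * G"
      "g (b \<circ> \<tau>) K j = Cst (c1 * P j) * (X (i + 1) * X (b j)) * H"
      "g (b \<circ> \<tau>) j j = Cst (c0 * c1 * Y * P j) * (X (b j) * X (i + 1)) * H"
      unfolding g_def W FG vals[OF j j] bt' bK G_def[symmetric] H_def[symmetric] by (rule refl)+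
    have 1: "g b K j + g b j j = g (b \<circ> \<tau>) j K"
    proof -
      have "g b K j + g b j j = Cst ((c1 * t_K + c0 * c1) * P j) * (X (b j) * X i) * G"
        unfolding gb by (simp add: Cst_hom algebra_simps)
      then show ?thesis unfolding c01 gb .
    qed
    have 2: "g (b \<circ> \<tau>) K j + g (b \<circ> \<tau>) j j = g b j K"
    proof -
      have "g (b \<circ> \<tau>) K j + g (b \<circ> \<tau>) j j = Cst ((c1 + c0 * c1 * Y) * P j) * (X (b j) * X (i + 1)) * H"
        unfolding gb by (simp add: Cst_hom algebra_simps)
      then show ?thesis unfolding c01 gb .
    qed
    show ?thesis unfolding add.assoc 1 2 by (rule add.commute)
  qed
  have g_pair: "g (b \<circ> \<tau>) j j' = g b j j'" if j: "j \<in> {1..k}" "j' \<in> {1..k}" "j' \<noteq> j" for j j'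
  proof -
    have "W (b \<circ> \<tau>) j j' = W b j j'"
      unfolding W_def using w1[OF j(1)] w3[OF j] by (simp only:)
    moreover have "(b \<circ> \<tau>) j = b j" "(b \<circ> \<tau> \<circ> pp j) j' = (b \<circ> pp j) j'"
      unfolding vals(5)[OF j] using \<tau>small j by simp_all
    ultimately show ?thesis unfolding g_def F_jj'[OF j] by (simp only:)
  qed
  have "(\<Sum>j\<in>{1..k}. g (b \<circ> \<tau>) j K + g (b \<circ> \<tau>) K j + g (b \<circ> \<tau>) j j) =
      (\<Sum>j\<in>{1..k}. g b j K + g b K j + g b j j)"
    by (rule sum.cong[OF refl g_single])
  moreover have "(\<Sum>j\<in>{1..k}. \<Sum>j'\<in>{1..k} - {j}. g (b \<circ> \<tau>) j j') =
      (\<Sum>j\<in>{1..k}. \<Sum>j'\<in>{1..k} - {j}. g b j j')"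
    by (intro sum.cong refl g_pair) simp_all
  moreover note trans[OF expand[OF bt] sum_square_split, folded K_def]
    trans[OF expand[OF bp] sum_square_split, folded K_def]
  ultimately show ?thesis unfolding sb by (simp only: g_KK)
qed


text \<open>By the action of the \<open>T\<^sub>i\<close>, it suffices to swap two columns whose basement values are
  consecutive.\<close>

lemma E_gen_swap_lift:
  assumes p: "1 \<le> p" "p + 1 \<le> length \<mu>" and eq: "part \<mu> p = part \<mu> (p + 1)"
    and step: "\<And>c i. c permutes {1..length \<mu>} \<Longrightarrow> c p = i \<Longrightarrow> c (p + 1) = i + 1 \<Longrightarrow>
      E_gen (simple_refl i \<circ> c) \<mu> = E_gen c \<mu>"
    and b: "b permutes {1..length \<mu>}"
  shows "E_gen (b \<circ> transpose p (p + 1)) \<mu> = E_gen b \<mu>"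
proof -
  let ?n = "length \<mu>" and ?\<tau> = "transpose p (p + 1)"
  have main: "E_gen (b \<circ> ?\<tau>) \<mu> = E_gen b \<mu>" if "b permutes {1..?n}" "b (p + 1) = b p + d" "d > 0" for b d
    using that
  proof (induction d arbitrary: b)
    case (Suc d)
    note b = Suc.prems(1)
    have binj: "b x = b y \<longleftrightarrow> x = y" for x y by (rule inj_eq[OF permutes_inj[OF b]])
    show ?case
    proof (cases "d = 0")
      case True
      then have e: "simple_refl (b p) \<circ> b = b \<circ> ?\<tau>"
        using Suc.prems by (intro simple_refl_comp_eq permutes_inj[OF b]) auto
      have "E_gen (simple_refl (b p) \<circ> b) \<mu> = E_gen b \<mu>"
        using Suc.prems True by (intro step[OF b]) simp_all
      then show ?thesis unfolding e .
    next
      case False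
      \<comment> \<open>\<open>i\<close> is one less than \<open>b (p + 1)\<close> and sits in some
        other column r. Exchanging it with \<open>b (p + 1)\<close> lowers the difference of the two
        values by one.\<close>
      define i where "i = b p + d"
      have bp1: "b (p + 1) = i + 1" using Suc.prems by (simp add: i_def)
      have range: "b p \<in> {1..?n}" "b (p + 1) \<in> {1..?n}"
        using permutes_in_image[OF b, of p] permutes_in_image[OF b, of "p + 1"] p by auto
      have i: "i \<in> {1..<?n}" using range bp1 by (auto simp: i_def)
      obtain r where r: "r \<in> {1..?n}" "b r = i"
        using permutes_image[OF b] i by (metis atLeastAtMost_iff atLeastLessThan_iff imageE less_imp_le)
      have rp: "r \<noteq> p" "r \<noteq> p + 1" using r(2) bp1 False binj by (auto simp: i_def)
      define c where "c = simple_refl i \<circ> b"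
      have c: "c permutes {1..?n}" unfolding c_def using b i by (rule simple_refl_comp_permutes)
      have cv: "c p = b p" "c (p + 1) = i" "c r = i + 1"
        using False r bp1 by (simp_all add: c_def simple_refl_apply i_def)
      have IH: "E_gen (c \<circ> ?\<tau>) \<mu> = E_gen c \<mu>"
        using False by (intro Suc.IH c) (simp_all only: cv, simp_all add: i_def)
      have bt: "b \<circ> ?\<tau> permutes {1..?n}" and ct: "c \<circ> ?\<tau> permutes {1..?n}"
        using b c p by (auto intro!: permutes_compose permutes_swap_id)
      have tv: "(b \<circ> ?\<tau>) p = i + 1" "(b \<circ> ?\<tau>) r = i" "(c \<circ> ?\<tau>) p = i" "(c \<circ> ?\<tau>) r = i + 1"
        using rp bp1 r cv by (simp_all add: transpose_def)
      have sbt: "simple_refl i \<circ> (b \<circ> ?\<tau>) = c \<circ> ?\<tau>" "simple_refl i \<circ> (c \<circ> ?\<tau>) = b \<circ> ?\<tau>"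
        "simple_refl i \<circ> b = c" "simple_refl i \<circ> c = b"
        by (simp_all add: c_def flip: comp_assoc)
      show ?thesis
      \<comment> \<open>T_i leads from \<open>b\<close> to \<open>c\<close> if r lies left of p, and
        from \<open>c\<close> to \<open>b\<close> otherwise. Columns p and p + 1 have equal height,
        so the powers of t agree with and without the swap; injectivity of T_i or cancellation of
        the power finishes.\<close>
      proof (cases "r < p")
        case True
        have "T_simple i (E_gen (b \<circ> ?\<tau>) \<mu>) = Cst (t_K ^ of_bool (part \<mu> r \<le> part \<mu> p)) * E_gen (c \<circ> ?\<tau>) \<mu>"
          by (rule T_simple_E_gen[OF bt _ True _ tv(2,1), unfolded sbt]) (use r p in auto)
        moreover have "T_simple i (E_gen b \<mu>) = Cst (t_K ^ of_bool (part \<mu> r \<le> part \<mu> (p + 1))) * E_gen c \<mu>"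
          by (rule T_simple_E_gen[OF b _ _ _ r(2) bp1, unfolded sbt]) (use True r p in auto)
        ultimately have "T_simple i (E_gen (b \<circ> ?\<tau>) \<mu>) = T_simple i (E_gen b \<mu>)"
          by (simp only: IH eq)
        then show ?thesis by (rule injD[OF T_simple_inj])
      next
        case False
        then have rp': "p + 1 < r" "p < r" using rp by auto
        have "T_simple i (E_gen (c \<circ> ?\<tau>) \<mu>) = Cst (t_K ^ of_bool (part \<mu> p \<le> part \<mu> r)) * E_gen (b \<circ> ?\<tau>) \<mu>"
          by (rule T_simple_E_gen[OF ct _ rp'(2) _ tv(3,4), unfolded sbt]) (use r p in auto)
        moreover have "T_simple i (E_gen c \<mu>) = Cst (t_K ^ of_bool (part \<mu> (p + 1) \<le> part \<mu> r)) * E_gen b \<mu>"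
          by (rule T_simple_E_gen[OF c _ rp'(1) _ cv(2,3), unfolded sbt]) (use r p in auto)
        ultimately have "Cst (t_K ^ of_bool (part \<mu> (p + 1) \<le> part \<mu> r)) * E_gen (b \<circ> ?\<tau>) \<mu> =
            Cst (t_K ^ of_bool (part \<mu> (p + 1) \<le> part \<mu> r)) * E_gen b \<mu>"
          by (simp only: IH eq)
        then show ?thesis by (rule Cst_t_K_cancel)
      qed
    qed
  qed simp
  have "b p \<noteq> b (p + 1)" using inj_eq[OF permutes_inj[OF b]] by simp
  then consider "b p < b (p + 1)" | "b (p + 1) < b p" by linarith
  then show ?thesis
  proof cases
    case 1 then show ?thesis using main[OF b, of "b (p + 1) - b p"] by simp
  next
    case 2
    have bt: "b \<circ> ?\<tau> permutes {1..?n}" using b p by (intro permutes_compose permutes_swap_id) auto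
    have "b \<circ> ?\<tau> \<circ> ?\<tau> = b" by (simp add: comp_assoc)
    then show ?thesis using main[OF bt, of "b p - b (p + 1)"] 2 by simp
  qed
qed

theorem E_gen_swap_equal_parts:
  assumes "b permutes {1..length \<mu>}" "1 \<le> p" "p + 1 \<le> length \<mu>" "part \<mu> p = part \<mu> (p + 1)"
  shows "E_gen (b \<circ> transpose p (p + 1)) \<mu> = E_gen b \<mu>"
  using assms
proof (induction \<mu> arbitrary: b p rule: shape_induct)
  case (zero \<mu>)
  have bt: "b \<circ> transpose p (p + 1) permutes {1..length \<mu>}"
    using zero.prems by (intro permutes_compose permutes_swap_id) auto
  show ?case
    by (simp only: E_gen_zero_shape[OF zero.hyps zero.prems(1)] E_gen_zero_shape[OF zero.hyps bt])
next
  case (peel k \<mu>)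
  let ?n = "length \<mu>" and ?\<mu>' = "peel_shape k \<mu>" and ?\<tau> = "transpose p (p + 1)"
  note k = peel.hyps(1) and zero = peel.hyps(2) and pos = peel.hyps(3)
  note b = peel.prems(1) and p = peel.prems(2,3) and eq = peel.prems(4)
  have "p \<noteq> k" using zero[of p] pos eq p by auto
  then consider "p + 1 \<le> k" | "p = k + 1" | "p > k + 1" by linarith
  then show ?case
  proof cases
    case 1
    show ?thesis
      by (rule E_gen_swap_zero_prefix[OF b zero, of k]) (use 1 p k in auto)
  next
    case 2
    have k2: "k + 1 < ?n" using 2 p by simp
    have n': "length ?\<mu>' = ?n" "length (peel_shape k ?\<mu>') = ?n" using k by (simp_all add: length_peel_shape)
    have "part ?\<mu>' (k + 1) = part \<mu> (k + 1)" using part_peel_shape[OF k, of "k + 1"] k2 eq 2 by simp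
    then have less: "sum_list (peel_shape k ?\<mu>') < sum_list \<mu>"
      using sum_list_peel_shape[OF k pos] sum_list_peel_shape[of k ?\<mu>'] k n' pos by simp
    have n1: "?n - 1 + 1 = ?n" using k2 by simp
    have "part (peel_shape k ?\<mu>') (?n - 1) = part (peel_shape k ?\<mu>') ?n"
    proof -
      have "part (peel_shape k ?\<mu>') (?n - 1) = (if ?n - 1 \<le> k then 0 else part ?\<mu>' ?n)"
        using part_peel_shape[of k ?\<mu>' "?n - 1"] k2 unfolding n' n1 by auto
      moreover have "part ?\<mu>' ?n = part \<mu> (k + 1) - 1" "part (peel_shape k ?\<mu>') ?n = part ?\<mu>' (k + 1) - 1"
        using part_peel_shape[OF k, of ?n] part_peel_shape[of k ?\<mu>' ?n] k n' by simp_all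
      ultimately show ?thesis using k2 \<open>part ?\<mu>' (k + 1) = part \<mu> (k + 1)\<close> by simp
    qed
    note last = this
    have IH: "E_gen (c \<circ> transpose (?n - 1) ?n) (peel_shape k ?\<mu>') = E_gen c (peel_shape k ?\<mu>')"
      if "c permutes {1..?n}" for c
      by (rule peel.IH[OF less, of c "?n - 1", unfolded n' n1]) (use that k2 last in auto)
    show ?thesis
    proof (rule E_gen_swap_lift[OF p eq _ b])
      fix c i assume c: "c permutes {1..?n}" "c p = i" "c (p + 1) = i + 1"
      show "E_gen (simple_refl i \<circ> c) \<mu> = E_gen c \<mu>"
        by (rule E_gen_swap_first_columns[OF k2 zero pos _ c(1) _ _ IH]) (use eq c 2 in auto)
    qed
  next
    case 3
    have bt: "b \<circ> ?\<tau> permutes {1..?n}" using b p by (intro permutes_compose permutes_swap_id) auto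
    have "peel_term k \<mu> (b \<circ> ?\<tau>) j = peel_term k \<mu> b j" if j: "j \<in> {1..k + 1}" for j
    proof -
      have fixed: "?\<tau> j = j" "?\<tau> (k + 1) = k + 1" using j 3 by (simp_all add: transpose_def)
      \<comment> \<open>Having equal height, columns p and p + 1 are both short or both not.\<close>
      have "?\<tau> permutes short_cols k \<mu> \<or> (\<forall>x\<in>short_cols k \<mu>. ?\<tau> x = x)"
      proof (cases "part \<mu> p < part \<mu> (k + 1)")
        case True
        then have "p \<in> short_cols k \<mu>" "p + 1 \<in> short_cols k \<mu>"
          using 3 p eq by (simp_all add: short_cols_def)
        then show ?thesis by (simp add: permutes_swap_id)
      next
        case False
        then have "p \<notin> short_cols k \<mu>" "p + 1 \<notin> short_cols k \<mu>"
          using eq by (simp_all add: short_cols_def)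
        then show ?thesis by (auto simp: transpose_def)
      qed
      then have "peel_exp k \<mu> (b \<circ> ?\<tau>) j = peel_exp k \<mu> b j"
      proof
        assume "?\<tau> permutes short_cols k \<mu>"
        from sum.permute[OF this, of "\<lambda>p. 1 + of_bool (b j > b (k + 1)) - of_bool (b p > b (k + 1)) -
            of_bool (b j > b p) :: int"]
        show ?thesis using fixed by (simp add: peel_exp_def comp_def)
      next
        assume "\<forall>x\<in>short_cols k \<mu>. ?\<tau> x = x"
        then show ?thesis unfolding peel_exp_def using fixed by (intro sum.cong refl) simp
      qed
      moreover have "E_gen (b \<circ> ?\<tau> \<circ> peel_perm k ?n j) ?\<mu>' = E_gen (b \<circ> peel_perm k ?n j) ?\<mu>'"
      proof -
        have "?\<tau> \<circ> peel_perm k ?n j = peel_perm k ?n j \<circ> transpose (p - 1) (p - 1 + 1)"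
        proof
          fix x
          have "peel_perm k ?n j (p - 1) = p" "peel_perm k ?n j p = p + 1" if "p < ?n"
            using peel_perm_apply[OF k j] 3 p by auto
          moreover have "inj (peel_perm k ?n j)"
            using peel_perm_permutes[OF k j] by (rule permutes_inj)
          ultimately show "(?\<tau> \<circ> peel_perm k ?n j) x = (peel_perm k ?n j \<circ> transpose (p - 1) (p - 1 + 1)) x"
            using transpose_apply_comp[of "peel_perm k ?n j" "p - 1" p x] p 3 by simp
        qed
        then have "b \<circ> ?\<tau> \<circ> peel_perm k ?n j = b \<circ> peel_perm k ?n j \<circ> transpose (p - 1) (p - 1 + 1)"
          by (simp add: comp_assoc)
        moreover have "E_gen (b \<circ> peel_perm k ?n j \<circ> transpose (p - 1) (p - 1 + 1)) ?\<mu>' =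
            E_gen (b \<circ> peel_perm k ?n j) ?\<mu>'"
        proof (rule peel.IH[OF sum_list_peel_shape[OF k pos]])
          show "b \<circ> peel_perm k ?n j permutes {1..length ?\<mu>'}"
            unfolding length_peel_shape[OF k] using b peel_perm_permutes[OF k j] by (intro permutes_compose)
          show "1 \<le> p - 1" "p - 1 + 1 \<le> length ?\<mu>'" using 3 p k by (simp_all add: length_peel_shape)
          show "part ?\<mu>' (p - 1) = part ?\<mu>' (p - 1 + 1)"
          proof -
            have "k < p - 1" "p - 1 < ?n" "p - 1 + 1 = p" "p - 1 \<in> {1..?n}" "p \<in> {1..?n}" using 3 p by auto
            then show ?thesis
              using part_peel_shape[OF k, of "p - 1"] part_peel_shape[OF k, of p] p eq by simp
          qed
        qed
        ultimately show ?thesis by simp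
      qed
      ultimately show ?thesis using fixed by (simp add: peel_term_def peel_wt_def)
    qed
    then have "(\<Sum>j\<in>{1..k + 1}. peel_term k \<mu> (b \<circ> ?\<tau>) j) = (\<Sum>j\<in>{1..k + 1}. peel_term k \<mu> b j)"
      by (rule sum.cong[OF refl])
    then show ?thesis
      using E_gen_eq_sum_peel_term[OF peel.hyps(1-3) bt] E_gen_eq_sum_peel_term[OF peel.hyps(1-3) b]
      by (simp only:)
  qed
qed

section \<open>The bar involution\<close>

text \<open>On {1..n} this is the reflection i \<mapsto> m + 1 - i modulo n, which reverses the
  cyclic order for every m.\<close>

definition block_reversal :: "nat \<Rightarrow> nat \<Rightarrow> nat \<Rightarrow> nat" where
  "block_reversal m n = reversal 1 m \<circ> reversal (m + 1) n"

lemma block_reversal_apply: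
  "block_reversal m n i =
    (if 1 \<le> i \<and> i \<le> m then m + 1 - i else if m < i \<and> i \<le> n then m + n + 1 - i else i)"
  by (auto simp: block_reversal_def reversal_def)

lemma block_reversal_permutes:
  assumes "m \<le> n"
  shows "block_reversal m n permutes {1..n}"
  unfolding block_reversal_def using assms
  by (intro permutes_compose permutes_subset[OF reversal_permutes]) auto

text \<open>The order is reversed inside each block and kept between blocks. In this form the
  corrections depend on x and y separately, so they telescope in the cyclic expression of
  \<open>peel_exp\<close>.\<close>

lemma block_reversal_less:
  assumes "x \<in> {1..n}" "y \<in> {1..n}" "x \<noteq> y"
  shows "(of_bool (block_reversal m n y < block_reversal m n x) :: int) =
    1 - of_bool (y < x) + of_bool (x > m) - of_bool (y > m)"
  using assms by (auto simp: block_reversal_apply)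

definition block_vars :: "nat \<Rightarrow> nat \<Rightarrow> nat \<Rightarrow> mpol" where
  "block_vars m n i = (if m < i \<and> i \<le> n then Cst q_K else 1) * X (block_reversal m n i)"

text \<open>The power of q that bar conjugation produces: the number of boxes in columns whose
  basement value belongs to the scaled block.\<close>

definition big_size :: "nat \<Rightarrow> (nat \<Rightarrow> nat) \<Rightarrow> nat list \<Rightarrow> nat" where
  "big_size m b \<mu> = (\<Sum>p\<in>{1..length \<mu>}. if b p > m then part \<mu> p else 0)"

text \<open>The shortened column, of height a - 1, stands over the value \<open>b j\<close> where
  the old one stood over \<open>b (k + 1)\<close>. Terms are placed so that no subtraction of sizes
  occurs.\<close>

lemma big_size_peel:
  assumes k: "k < length \<mu>" and zero: "\<And>i. 1 \<le> i \<Longrightarrow> i \<le> k \<Longrightarrow> part \<mu> i = 0"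
    and j: "j \<in> {1..k + 1}"
  shows "big_size m (b \<circ> peel_perm k (length \<mu>) j) (peel_shape k \<mu>) +
      (if b (k + 1) > m then part \<mu> (k + 1) else 0) =
    big_size m b \<mu> + (if b j > m then part \<mu> (k + 1) - 1 else 0)"
proof -
  let ?n = "length \<mu>" and ?a = "part \<mu> (k + 1)"
  let ?pp = "peel_perm k ?n j" and ?pos = "peel_pos k ?n j"
  have P: "?pp permutes {1..?n}" using k j by (rule peel_perm_permutes)
  have "big_size m (b \<circ> ?pp) (peel_shape k \<mu>) =
      (\<Sum>y\<in>{1..?n}. if b y > m then part (peel_shape k \<mu>) (?pos y) else 0)"
    unfolding big_size_def length_peel_shape[OF k]
  proof (rule sum.reindex_bij_witness[of _ ?pos ?pp])
    fix x assume x: "x \<in> {1..?n}"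
    then show ppx: "?pp x \<in> {1..?n}" using permutes_in_image[OF P] by simp
    have "?pp (?pos (?pp x)) = ?pp x" using peel_perm_peel_pos(1)[OF k j ppx] .
    then show pos: "?pos (?pp x) = x" using inj_eq[OF permutes_inj[OF P]] by simp
    then show "(if b (?pp x) > m then part (peel_shape k \<mu>) (?pos (?pp x)) else 0) =
        (if (b \<circ> ?pp) x > m then part (peel_shape k \<mu>) x else 0)" by simp
  next
    fix y assume y: "y \<in> {1..?n}"
    show "?pp (?pos y) = y" "?pos y \<in> {1..?n}" using peel_perm_peel_pos[OF k j y] by simp_all
  qed
  also have "\<dots> = (\<Sum>y\<in>{1..?n}. if b y > m then
      (if y = j then ?a - 1 else if y \<le> k + 1 then 0 else part \<mu> y) else 0)"
    by (intro sum.cong refl) (simp only: part_peel_pos[OF k j])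
  finally have 1: "big_size m (b \<circ> ?pp) (peel_shape k \<mu>) = \<dots>" .
  have 2: "(if b c > m then z else 0) = (\<Sum>y\<in>{1..?n}. if y = c then (if b y > m then z else 0) else 0)"
    if "c \<in> {1..?n}" for c z using that by (subst sum.delta) auto
  have in1: "k + 1 \<in> {1..?n}" "j \<in> {1..?n}" using k j by auto
  show ?thesis
    unfolding 1 unfolding big_size_def 2[OF in1(1)] 2[OF in1(2)] sum.distrib[symmetric]
    using zero j by (intro sum.cong refl) (auto simp: le_Suc_eq)
qed

text \<open>With Q = q^a t^A this is (1 - 1/t) / (1 - 1/(Q t)) = Q (1 - t) / (1 - Q t).\<close>

lemma bar_peel_factor:
  assumes "part \<mu> (k + 1) \<ge> 1"
  shows "bar_K (peel_factor k \<mu>) =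
    peel_factor k \<mu> * (q_K ^ part \<mu> (k + 1) * t_K ^ card (short_cols k \<mu>))"
proof -
  have *: "(1 - inverse t) / (1 - inverse Q * inverse t) = (1 - t) / (1 - Q * t) * Q"
    if "t \<noteq> 0" "Q \<noteq> 0" "1 - Q * t \<noteq> 0" for t Q :: coef
  proof -
    have "1 - inverse t = (t - 1) / t" "1 - inverse Q * inverse t = (Q * t - 1) / (Q * t)"
      using that by (simp_all add: field_simps)
    then have "(1 - inverse t) / (1 - inverse Q * inverse t) = (t - 1) * Q / (Q * t - 1)"
      using that by simp
    also have "\<dots> = (1 - t) / (1 - Q * t) * Q"
      using minus_divide_divide[of "t - 1" "Q * t - 1"] by simp
    finally show ?thesis .
  qed
  let ?Q = "q_K ^ part \<mu> (k + 1) * t_K ^ card (short_cols k \<mu>)"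
  have "1 - ?Q * t_K \<noteq> 0"
    using peel_factor_denom_nonzero[OF assms, of "card (short_cols k \<mu>) + 1"] by (simp add: mult_ac)
  then have "(1 - inverse t_K) / (1 - inverse ?Q * inverse t_K) = (1 - t_K) / (1 - ?Q * t_K) * ?Q"
    by (intro *) simp_all
  then show ?thesis
    by (simp add: peel_factor_def bar_K_divide bar_K_diff bar_K_mult bar_K_power power_inverse mult_ac)
qed

text \<open>Reflection replaces the set of short columns counted by \<open>peel_exp\<close> by its
  complement; the factor t^A from \<open>bar_peel_factor\<close> turns the inverted power of t into
  this complementary one.\<close>

lemma bar_peel_wt:
  assumes k: "k < length \<mu>" and pos: "part \<mu> (k + 1) \<ge> 1"
    and b: "b permutes {1..length \<mu>}" and j: "j \<in> {1..k}"
  shows "bar_K (peel_wt k \<mu> b j) *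
      q_K ^ ((if b (k + 1) < b j then part \<mu> (k + 1) else 0) +
        (if block_reversal m (length \<mu>) (b (k + 1)) < block_reversal m (length \<mu>) (b j)
          then part \<mu> (k + 1) else 0)) =
    q_K ^ part \<mu> (k + 1) * peel_wt k \<mu> (block_reversal m (length \<mu>) \<circ> b) j"
proof -
  let ?n = "length \<mu>" and ?\<psi> = "block_reversal m (length \<mu>)"
  have range: "b x \<in> {1..?n}" if "x \<in> {1..?n}" for x using permutes_in_image[OF b] that by simp
  have binj: "b x = b y \<longleftrightarrow> x = y" for x y by (rule inj_eq[OF permutes_inj[OF b]])
  have L: "(of_bool (?\<psi> (b y) < ?\<psi> (b x)) :: int) =
      1 - of_bool (b y < b x) + of_bool (b x > m) - of_bool (b y > m)"
    if "x \<in> {1..?n}" "y \<in> {1..?n}" "x \<noteq> y" for x y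
    using that by (intro block_reversal_less range) (simp_all only: binj not_False_eq_True)
  have e: "peel_exp k \<mu> (?\<psi> \<circ> b) j = int (card (short_cols k \<mu>)) - peel_exp k \<mu> b j"
  proof -
    have "peel_exp k \<mu> (?\<psi> \<circ> b) j = (\<Sum>p\<in>short_cols k \<mu>. 1 -
        (1 + of_bool (b j > b (k + 1)) - of_bool (b p > b (k + 1)) - of_bool (b j > b p)))"
      unfolding peel_exp_def
    proof (intro sum.cong refl)
      fix p assume p: "p \<in> short_cols k \<mu>"
      then have "p \<noteq> k + 1" "p \<noteq> j" "j \<noteq> k + 1" "p \<in> {1..?n}" "j \<in> {1..?n}" "k + 1 \<in> {1..?n}"
        using j k by (auto simp: short_cols_def)
      then have "(of_bool (?\<psi> (b (k + 1)) < ?\<psi> (b j)) :: int) =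
            1 - of_bool (b (k + 1) < b j) + of_bool (b j > m) - of_bool (b (k + 1) > m)"
        "(of_bool (?\<psi> (b (k + 1)) < ?\<psi> (b p)) :: int) =
            1 - of_bool (b (k + 1) < b p) + of_bool (b p > m) - of_bool (b (k + 1) > m)"
        "(of_bool (?\<psi> (b p) < ?\<psi> (b j)) :: int) =
            1 - of_bool (b p < b j) + of_bool (b j > m) - of_bool (b p > m)"
        using L by blast+
      then show "1 + of_bool ((?\<psi> \<circ> b) (k + 1) < (?\<psi> \<circ> b) j) - of_bool ((?\<psi> \<circ> b) (k + 1) < (?\<psi> \<circ> b) p) -
          of_bool ((?\<psi> \<circ> b) p < (?\<psi> \<circ> b) j) =
        (1::int) - (1 + of_bool (b j > b (k + 1)) - of_bool (b p > b (k + 1)) - of_bool (b j > b p))"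
        unfolding comp_apply by linarith
    qed
    then show ?thesis by (simp only: sum_subtractf peel_exp_def) simp
  qed
  have t: "t_K ^ card (short_cols k \<mu>) * inverse t_K powi peel_exp k \<mu> b j = t_K powi peel_exp k \<mu> (?\<psi> \<circ> b) j"
    unfolding e by (simp add: power_int_diff power_int_inverse divide_inverse)
  let ?a = "part \<mu> (k + 1)" and ?A = "card (short_cols k \<mu>)"
  define x where "x = (if b (k + 1) < b j then ?a else 0)"
  define y where "y = (if ?\<psi> (b (k + 1)) < ?\<psi> (b j) then ?a else 0)"
  have jk: "j \<noteq> k + 1" using j by simp
  have "bar_K (peel_wt k \<mu> b j) =
      peel_factor k \<mu> * (q_K ^ ?a * t_K ^ ?A) * inverse q_K ^ x * inverse t_K powi peel_exp k \<mu> b j"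
    using jk by (simp only: peel_wt_def bar_K_mult bar_K_power bar_K_power_int bar_peel_factor[OF pos]
        bar_K_q_K bar_K_t_K if_False x_def)
  then have "bar_K (peel_wt k \<mu> b j) * q_K ^ (x + y) = q_K ^ ?a * (peel_factor k \<mu> * q_K ^ y *
      (t_K ^ ?A * inverse t_K powi peel_exp k \<mu> b j)) * (inverse q_K ^ x * q_K ^ x)"
    by (simp only: power_add mult_ac)
  also have "inverse q_K ^ x * q_K ^ x = 1" by (simp flip: power_mult_distrib)
  also have "peel_factor k \<mu> * q_K ^ y * (t_K ^ ?A * inverse t_K powi peel_exp k \<mu> b j) =
      peel_wt k \<mu> (?\<psi> \<circ> b) j"
    using jk by (simp only: t peel_wt_def if_False y_def comp_apply)
  finally show ?thesis by (simp only: x_def y_def mult_1_right)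
qed

lemma subst_bar_E_gen:
  assumes "b permutes {1..length \<mu>}" "m \<le> length \<mu>"
  shows "subst (block_vars m (length \<mu>)) (bar (E_gen b \<mu>)) =
    Cst (q_K ^ big_size m b \<mu>) * E_gen (block_reversal m (length \<mu>) \<circ> b) \<mu>"
  using assms
proof (induction \<mu> arbitrary: b rule: shape_induct)
  case (zero \<mu>)
  have pb: "block_reversal m (length \<mu>) \<circ> b permutes {1..length \<mu>}"
    using zero.prems by (intro permutes_compose block_reversal_permutes)
  have "big_size m b \<mu> = 0" using zero.hyps by (simp add: big_size_def)
  moreover have "bar 1 = 1" using bar_Cst[of 1] by (simp add: Cst_hom)
  ultimately show ?case
    by (simp only: E_gen_zero_shape[OF zero.hyps zero.prems(1)] E_gen_zero_shape[OF zero.hyps pb]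
        subst_1 power_0 Cst_hom mult_1_left)
next
  case (peel k \<mu>)
  let ?n = "length \<mu>" and ?\<mu>' = "peel_shape k \<mu>" and ?\<psi> = "block_reversal m (length \<mu>)"
  let ?v = "block_vars m ?n"
  note k = peel.hyps(1) and zero = peel.hyps(2) and pos = peel.hyps(3) and b = peel.prems(1)
  have pb: "?\<psi> \<circ> b permutes {1..?n}" using peel.prems by (intro permutes_compose block_reversal_permutes)
  have "subst ?v (bar (peel_term k \<mu> b j)) =
      Cst (q_K ^ big_size m b \<mu>) * peel_term k \<mu> (?\<psi> \<circ> b) j" if j: "j \<in> {1..k + 1}" for j
  proof -
    let ?c = "b \<circ> peel_perm k ?n j"
    have c: "?c permutes {1..length ?\<mu>'}"
      unfolding length_peel_shape[OF k] using b peel_perm_permutes[OF k j] by (intro permutes_compose)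
    have IH: "subst ?v (bar (E_gen ?c ?\<mu>')) = Cst (q_K ^ big_size m ?c ?\<mu>') * E_gen (?\<psi> \<circ> b \<circ> peel_perm k ?n j) ?\<mu>'"
      using peel.IH[OF sum_list_peel_shape[OF k pos] c] peel.prems(2)
      unfolding length_peel_shape[OF k] comp_assoc by blast
    have bj: "b j \<in> {1..?n}" using permutes_in_image[OF b, of j] j k by simp
    have v: "?v (b j) = Cst (q_K ^ (if b j > m then 1 else 0)) * X ((?\<psi> \<circ> b) j)"
      using bj by (simp add: block_vars_def Cst_hom)
    have w: "bar_K (peel_wt k \<mu> b j) * q_K ^ (if b j > m then 1 else 0) * q_K ^ big_size m ?c ?\<mu>' =
        q_K ^ big_size m b \<mu> * peel_wt k \<mu> (?\<psi> \<circ> b) j"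
    proof (cases "j = k + 1")
      case True
      have "peel_wt k \<mu> b j = 1" "peel_wt k \<mu> (?\<psi> \<circ> b) j = 1"
        unfolding True using peel_wt_self permutes_inj[OF b] permutes_inj[OF pb] by blast+
      moreover have "(if b j > m then 1 else 0) + big_size m ?c ?\<mu>' = big_size m b \<mu>"
        using big_size_peel[OF k zero j, of m b] pos True by (auto split: if_splits)
      ultimately show ?thesis by (simp add: mult_ac flip: power_add)
    next
      case False
      then have jk: "j \<in> {1..k}" using j by auto
      let ?a = "part \<mu> (k + 1)"
      define x where "x = (if b (k + 1) < b j then ?a else 0) + (if ?\<psi> (b (k + 1)) < ?\<psi> (b j) then ?a else 0)"
      have bk: "b (k + 1) \<in> {1..?n}" using permutes_in_image[OF b, of "k + 1"] k by simp
      have "b j \<noteq> b (k + 1)" using False inj_eq[OF permutes_inj[OF b]] by simp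
      note less = block_reversal_less[OF bj bk this, of m]
      \<comment> \<open>By \<open>less\<close>, \<open>x\<close> is a times 1 + [b j > m] -
        [b (k + 1) > m], which is the correction in \<open>big_size_peel\<close>.\<close>
      have "(if b j > m then 1 else 0) + big_size m ?c ?\<mu>' + ?a = big_size m b \<mu> + x"
        using big_size_peel[OF k zero j, of m b] pos less unfolding x_def
        by (cases "b j > m"; cases "b (k + 1) > m"; cases "b (k + 1) < b j") (simp_all split: if_splits)
      then have q: "q_K ^ (if b j > m then 1 else 0) * q_K ^ big_size m ?c ?\<mu>' * q_K ^ ?a = q_K ^ big_size m b \<mu> * q_K ^ x"
        by (simp only: flip: power_add)
      have wt: "bar_K (peel_wt k \<mu> b j) * q_K ^ x = q_K ^ ?a * peel_wt k \<mu> (?\<psi> \<circ> b) j"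
        unfolding x_def by (rule bar_peel_wt[OF k pos b jk])
      have "bar_K (peel_wt k \<mu> b j) * q_K ^ (if b j > m then 1 else 0) * q_K ^ big_size m ?c ?\<mu>' * q_K ^ ?a =
          bar_K (peel_wt k \<mu> b j) * (q_K ^ big_size m b \<mu> * q_K ^ x)"
        unfolding q[symmetric] by (simp only: mult.assoc)
      also have "\<dots> = q_K ^ big_size m b \<mu> * (bar_K (peel_wt k \<mu> b j) * q_K ^ x)"
        by (simp only: mult_ac)
      also have "\<dots> = q_K ^ big_size m b \<mu> * peel_wt k \<mu> (?\<psi> \<circ> b) j * q_K ^ ?a"
        unfolding wt by (simp only: mult_ac)
      finally show ?thesis by simp
    qed
    have "subst ?v (bar (peel_term k \<mu> b j)) = Cst (bar_K (peel_wt k \<mu> b j)) * ?v (b j) * subst ?v (bar (E_gen ?c ?\<mu>'))"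
      by (simp add: peel_term_def bar_mult subst_mult)
    also have "\<dots> = Cst (bar_K (peel_wt k \<mu> b j) * q_K ^ (if b j > m then 1 else 0) * q_K ^ big_size m ?c ?\<mu>') *
        X ((?\<psi> \<circ> b) j) * E_gen (?\<psi> \<circ> b \<circ> peel_perm k ?n j) ?\<mu>'"
      unfolding IH v by (simp only: Cst_hom(4) mult_ac)
    also have "\<dots> = Cst (q_K ^ big_size m b \<mu>) * peel_term k \<mu> (?\<psi> \<circ> b) j"
      unfolding w peel_term_def by (simp only: Cst_hom(4) mult_ac)
    finally show ?thesis .
  qed
  then have "subst ?v (bar (\<Sum>j\<in>{1..k + 1}. peel_term k \<mu> b j)) =
      Cst (q_K ^ big_size m b \<mu>) * (\<Sum>j\<in>{1..k + 1}. peel_term k \<mu> (?\<psi> \<circ> b) j)"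
    unfolding bar_sum subst_sum sum_distrib_left by (rule sum.cong[OF refl])
  then have "subst ?v (bar (E_gen b \<mu>)) = Cst (q_K ^ big_size m b \<mu>) * E_gen (?\<psi> \<circ> b) \<mu>"
    by (simp only: E_gen_eq_sum_peel_term[OF peel.hyps(1-3) b] E_gen_eq_sum_peel_term[OF peel.hyps(1-3) pb])
  then show ?case .
qed

section \<open>Symmetrization\<close>

lemma foldr_T_simple_Cst: "foldr T_simple w (Cst c * f) = Cst c * foldr T_simple w f"
  by (induction w) (simp_all add: T_simple_Cst_mult)

lemma foldr_T_simple_inj: "inj (foldr T_simple w)"
proof (induction w)
  case (Cons i w)
  have "inj (T_simple i \<circ> foldr T_simple w)" using Cons T_simple_inj by (intro inj_compose)
  then show ?case by (simp add: comp_def)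
qed simp

lemma card_invs_filter_simple_refl:
  assumes "\<pi> permutes {1..n}" "i \<in> {1..<n}" "inv \<pi> i < inv \<pi> (i + 1)"
  shows "card {x \<in> invs n (simple_refl i \<circ> \<pi>). Q x} =
    of_bool (Q (inv \<pi> i, inv \<pi> (i + 1))) + card {x \<in> invs n \<pi>. Q x}"
proof -
  have "{x \<in> invs n (simple_refl i \<circ> \<pi>). Q x} =
      (if Q (inv \<pi> i, inv \<pi> (i + 1)) then {(inv \<pi> i, inv \<pi> (i + 1))} else {}) \<union> {x \<in> invs n \<pi>. Q x}"
    unfolding invs_simple_refl(1)[OF assms] by auto
  then show ?thesis using invs_simple_refl(2)[OF assms] by (simp add: card_insert_if)
qed

lemma inv_permutes_apply: "\<pi> permutes A \<Longrightarrow> \<pi> (inv \<pi> x) = x"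
  by (simp add: permutes_inverses)

lemma inv_permutes_range:
  assumes "\<pi> permutes A" "x \<in> A"
  shows "inv \<pi> x \<in> A"
  using permutes_in_image[OF permutes_inv[OF assms(1)]] assms(2) by blast

lemma T_simple_E_gen_inv:
  assumes b: "b permutes {1..length \<mu>}" and i: "i \<in> {1..<length \<mu>}" and less: "inv b i < inv b (i + 1)"
  shows "T_simple i (E_gen b \<mu>) =
    Cst (t_K ^ of_bool (part \<mu> (inv b i) \<le> part \<mu> (inv b (i + 1)))) * E_gen (simple_refl i \<circ> b) \<mu>"
proof -
  have "inv b i \<in> {1..length \<mu>}" "inv b (i + 1) \<in> {1..length \<mu>}"
    using i inv_permutes_range[OF b, of i] inv_permutes_range[OF b, of "i + 1"] by auto
  then show ?thesis
    using less by (intro T_simple_E_gen b) (simp_all add: inv_permutes_apply[OF b])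
qed

text \<open>Each letter creates one inversion and contributes t exactly if its left column is at
  most as high as its right one.\<close>

lemma foldr_T_simple_E_gen:
  assumes "reduced_word (length \<mu>) \<pi> w"
  shows "foldr T_simple w (E_gen id \<mu>) =
    Cst (t_K ^ card {x \<in> invs (length \<mu>) \<pi>. part \<mu> (fst x) \<le> part \<mu> (snd x)}) * E_gen \<pi> \<mu>"
  using assms
proof (induction rule: reduced_word_induct)
  case Nil
  then show ?case by (simp add: Cst_hom)
next
  case (Cons i \<pi> w)
  have "foldr T_simple (i # w) (E_gen id \<mu>) =
      Cst (t_K ^ card {x \<in> invs (length \<mu>) (simple_refl i \<circ> \<pi>). part \<mu> (fst x) \<le> part \<mu> (snd x)}) *
      E_gen (simple_refl i \<circ> \<pi>) \<mu>"
    unfolding foldr.simps comp_apply Cons.IH T_simple_Cst_mult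
      T_simple_E_gen_inv[OF Cons.hyps(2,1,3)] card_invs_filter_simple_refl[OF Cons.hyps(2,1,3)]
    by (simp only: power_add Cst_hom mult_ac fst_conv snd_conv)
  then show ?case .
qed

text \<open>Only pairs with right column beyond the first m are counted; on pairs inside the first m
  columns the sum over S_m itself equalizes the action of T_i.\<close>

definition cross :: "nat \<Rightarrow> (nat \<Rightarrow> nat) \<Rightarrow> nat list \<Rightarrow> nat" where
  "cross m c \<mu> = card {x \<in> invs (length \<mu>) c. m < snd x \<and> part \<mu> (fst x) \<le> part \<mu> (snd x)}"

text \<open>The power of \<open>t\<close> makes \<open>T\<^sub>i\<close> act on all summands by the same factor, although the heights of
  the columns concerned depend on \<open>\<tau>\<close>.\<close>

definition E_sym :: "nat \<Rightarrow> (nat \<Rightarrow> nat) \<Rightarrow> nat list \<Rightarrow> mpol" where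
  "E_sym m b \<mu> = (\<Sum>\<tau> | \<tau> permutes {1..m}. Cst (t_K ^ cross m (b \<circ> \<tau>) \<mu>) * E_gen (b \<circ> \<tau>) \<mu>)"

lemma sum_permutes_comp:
  assumes "\<rho> permutes A"
  shows "(\<Sum>\<tau> | \<tau> permutes A. f (\<rho> \<circ> \<tau>)) = (\<Sum>\<tau> | \<tau> permutes A. f \<tau>)"
proof (rule sum.reindex_bij_witness[of _ "\<lambda>\<tau>. inv \<rho> \<circ> \<tau>" "\<lambda>\<tau>. \<rho> \<circ> \<tau>"])
  have "inv \<rho> \<circ> \<rho> = id" "\<rho> \<circ> inv \<rho> = id"
    using permutes_inv_o[OF assms] by simp_all
  then show "inv \<rho> \<circ> (\<rho> \<circ> \<tau>) = \<tau>" "\<rho> \<circ> (inv \<rho> \<circ> \<tau>) = \<tau>" for \<tau>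
    by (simp_all flip: comp_assoc)
qed (use assms in \<open>auto intro: permutes_compose permutes_inv\<close>)

lemma E_sym_comp:
  assumes "\<rho> permutes {1..m}"
  shows "E_sym m (b \<circ> \<rho>) \<mu> = E_sym m b \<mu>"
  using sum_permutes_comp[OF assms, of "\<lambda>\<tau>. Cst (t_K ^ cross m (b \<circ> \<tau>) \<mu>) * E_gen (b \<circ> \<tau>) \<mu>"]
  by (simp add: E_sym_def comp_assoc)

lemma E_gen_stabilizer:
  assumes m: "m \<le> length \<mu>" and dec: "\<And>p p'. 1 \<le> p \<Longrightarrow> p < p' \<Longrightarrow> p' \<le> m \<Longrightarrow> part \<mu> p' \<le> part \<mu> p"
    and \<rho>: "\<rho> permutes {1..m}" "\<And>i. i \<in> {1..m} \<Longrightarrow> part \<mu> (\<rho> i) = part \<mu> i"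
    and c: "c permutes {1..length \<mu>}"
  shows "E_gen (c \<circ> \<rho>) \<mu> = E_gen c \<mu>"
proof -
  have "(\<forall>i\<in>{1..m}. part \<mu> (\<rho> i) = part \<mu> i) \<longrightarrow>
      (\<forall>c. c permutes {1..length \<mu>} \<longrightarrow> E_gen (c \<circ> \<rho>) \<mu> = E_gen c \<mu>)"
    using reduced_word_exists[OF \<rho>(1)]
  proof (induction rule: reduced_word_induct)
    case Nil then show ?case by simp
  next
    case (Cons i \<rho> w)
    show ?case
    proof (intro impI allI)
      fix c assume h: "\<forall>x\<in>{1..m}. part \<mu> ((simple_refl i \<circ> \<rho>) x) = part \<mu> x"
        and c: "c permutes {1..length \<mu>}"
      define x y where "x = inv \<rho> i" and "y = inv \<rho> (i + 1)"
      have xy: "x \<in> {1..m}" "y \<in> {1..m}" "x < y" "\<rho> x = i" "\<rho> y = i + 1"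
        using Cons.hyps inv_permutes_range[OF Cons.hyps(2)] inv_permutes_apply[OF Cons.hyps(2)]
        by (auto simp: x_def y_def)
      \<comment> \<open>Since x < y, weak decrease forces part i \<ge> part (i + 1) = part x \<ge>
        part y = part i: every letter of the word exchanges neighbours of equal height.\<close>
      have "part \<mu> (i + 1) = part \<mu> x" "part \<mu> i = part \<mu> y"
        using bspec[OF h xy(1)] bspec[OF h xy(2)] xy(4,5) by (simp_all add: simple_refl_apply)
      moreover have "part \<mu> y \<le> part \<mu> x" "part \<mu> (i + 1) \<le> part \<mu> i"
        using dec[of x y] dec[of i "i + 1"] xy Cons.hyps(1) by auto
      ultimately have eq: "part \<mu> i = part \<mu> (i + 1)" by simp
      have s: "part \<mu> (simple_refl i z) = part \<mu> z" for z using eq by (simp add: simple_refl_apply)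
      have "\<forall>x\<in>{1..m}. part \<mu> (\<rho> x) = part \<mu> x" using h by (simp add: s)
      moreover have cs: "c \<circ> simple_refl i permutes {1..length \<mu>}"
        using c Cons.hyps(1) m by (intro permutes_compose simple_refl_permutes) auto
      ultimately have "E_gen (c \<circ> simple_refl i \<circ> \<rho>) \<mu> = E_gen (c \<circ> simple_refl i) \<mu>"
        using Cons.IH by blast
      also have "\<dots> = E_gen c \<mu>"
        unfolding simple_refl_def using Cons.hyps(1) m eq by (intro E_gen_swap_equal_parts c) auto
      finally show "E_gen (c \<circ> (simple_refl i \<circ> \<rho>)) \<mu> = E_gen c \<mu>" by (simp only: comp_assoc)
    qed
  qed
  then show ?thesis using \<rho>(2) c by blast
qed

lemma Cst_of_nat_nonzero: "k \<noteq> 0 \<Longrightarrow> Cst (of_nat k) \<noteq> 0"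
proof -
  assume "k \<noteq> 0"
  have "(of_nat k :: coef) = to_fract (of_nat k)" by (simp add: of_nat_fract to_fract_def)
  then show ?thesis using \<open>k \<noteq> 0\<close> by simp
qed

text \<open>If the two columns have equal height, both polynomials coincide and T_i multiplies them
  by t. Otherwise T_i maps the one with i on the left to the other without a power of t, and the
  quadratic relation gives the image of the latter.\<close>

lemma T_simple_E_gen_pair:
  assumes m: "m \<le> length \<mu>" and dec: "\<And>p p'. 1 \<le> p \<Longrightarrow> p < p' \<Longrightarrow> p' \<le> m \<Longrightarrow> part \<mu> p' \<le> part \<mu> p"
    and c: "c permutes {1..length \<mu>}" and i: "i \<in> {1..<length \<mu>}"
    and r: "inv c i \<in> {1..m}" "inv c (i + 1) \<in> {1..m}"
  shows "cross m (simple_refl i \<circ> c) \<mu> = cross m c \<mu>"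
    and "T_simple i (E_gen c \<mu> + E_gen (simple_refl i \<circ> c) \<mu>) =
      Cst t_K * (E_gen c \<mu> + E_gen (simple_refl i \<circ> c) \<mu>)"
proof -
  have *: "cross m (simple_refl i \<circ> c) \<mu> = cross m c \<mu> \<and>
      T_simple i (E_gen c \<mu> + E_gen (simple_refl i \<circ> c) \<mu>) =
      Cst t_K * (E_gen c \<mu> + E_gen (simple_refl i \<circ> c) \<mu>)"
    if c: "c permutes {1..length \<mu>}" and r: "inv c i \<in> {1..m}" "inv c (i + 1) \<in> {1..m}"
      and less: "inv c i < inv c (i + 1)" for c
  proof
    show "cross m (simple_refl i \<circ> c) \<mu> = cross m c \<mu>"
      unfolding cross_def card_invs_filter_simple_refl[OF c i less] using r by simp
    let ?f = "E_gen c \<mu>" and ?g = "E_gen (simple_refl i \<circ> c) \<mu>"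
    have T: "T_simple i ?f = Cst (t_K ^ of_bool (part \<mu> (inv c i) \<le> part \<mu> (inv c (i + 1)))) * ?g"
      by (rule T_simple_E_gen_inv[OF c i less])
    have le: "part \<mu> (inv c (i + 1)) \<le> part \<mu> (inv c i)" using dec r less by auto
    show "T_simple i (?f + ?g) = Cst t_K * (?f + ?g)"
    proof (cases "part \<mu> (inv c i) = part \<mu> (inv c (i + 1))")
      case True
      have "simple_refl i \<circ> c = c \<circ> transpose (inv c i) (inv c (i + 1))"
        using permutes_inj[OF c] inv_permutes_apply[OF c] by (intro simple_refl_comp_eq) auto
      moreover have "E_gen (c \<circ> transpose (inv c i) (inv c (i + 1))) \<mu> = ?f"
        using r True by (intro E_gen_stabilizer[OF m dec _ _ c] permutes_swap_id)
          (auto simp: transpose_def)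
      ultimately have e: "?g = ?f" by (simp only:)
      have "T_simple i ?f = Cst t_K * ?f" using T True e by simp
      then show ?thesis unfolding e T_simple_add by (simp only: distrib_left)
    next
      case False
      then have "T_simple i ?f = ?g" using T le by (simp add: Cst_hom)
      moreover from this have "T_simple i ?g = (Cst t_K - 1) * ?g + Cst t_K * ?f"
        using T_simple_quadratic[of i ?f] by simp
      ultimately show ?thesis by (simp add: T_simple_add algebra_simps)
    qed
  qed
  have sc: "simple_refl i \<circ> c permutes {1..length \<mu>}" using c i by (rule simple_refl_comp_permutes)
  have ssc: "simple_refl i \<circ> (simple_refl i \<circ> c) = c" by (simp flip: comp_assoc)
  have "inv c i \<noteq> inv c (i + 1)" using inv_permutes_apply[OF c] by (metis n_not_Suc_n Suc_eq_plus1)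
  moreover have "inv (simple_refl i \<circ> c) i = inv c (i + 1)" "inv (simple_refl i \<circ> c) (i + 1) = inv c i"
    by (simp_all add: inv_simple_refl[OF c] simple_refl_apply)
  ultimately consider "inv c i < inv c (i + 1)"
    | "inv (simple_refl i \<circ> c) i < inv (simple_refl i \<circ> c) (i + 1)"
      "inv (simple_refl i \<circ> c) i \<in> {1..m}" "inv (simple_refl i \<circ> c) (i + 1) \<in> {1..m}"
    using r by fastforce
  then have "cross m (simple_refl i \<circ> c) \<mu> = cross m c \<mu> \<and>
      T_simple i (E_gen c \<mu> + E_gen (simple_refl i \<circ> c) \<mu>) =
      Cst t_K * (E_gen c \<mu> + E_gen (simple_refl i \<circ> c) \<mu>)"
  proof cases
    case 1 then show ?thesis using * c r by blast
  next
    case 2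
    from *[OF sc 2(2,3,1)] show ?thesis unfolding ssc by (simp add: add.commute)
  qed
  then show "cross m (simple_refl i \<circ> c) \<mu> = cross m c \<mu>"
    "T_simple i (E_gen c \<mu> + E_gen (simple_refl i \<circ> c) \<mu>) =
      Cst t_K * (E_gen c \<mu> + E_gen (simple_refl i \<circ> c) \<mu>)" by blast+
qed

text \<open>If i + 1 stands beyond the first m columns, the powers of t in the summands absorb the
  height-dependent factor. If both values stand within the first m columns, the summands are paired
  into eigenvectors of T_i.\<close>

lemma T_simple_E_sym:
  assumes m: "m \<le> length \<mu>" and dec: "\<And>p p'. 1 \<le> p \<Longrightarrow> p < p' \<Longrightarrow> p' \<le> m \<Longrightarrow> part \<mu> p' \<le> part \<mu> p"
    and b: "b permutes {1..length \<mu>}" and i: "i \<in> {1..<length \<mu>}" and less: "inv b i < inv b (i + 1)"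
  shows "T_simple i (E_sym m b \<mu>) =
    Cst (t_K ^ of_bool (inv b (i + 1) \<le> m)) * E_sym m (simple_refl i \<circ> b) \<mu>"
proof -
  let ?s = "simple_refl i"
  define p p' where "p = inv b i" and "p' = inv b (i + 1)"
  have sub: "{1..m} \<subseteq> {1..length \<mu>}" using m by auto
  have pp: "p \<in> {1..length \<mu>}" "p' \<in> {1..length \<mu>}" "p < p'"
    using i less inv_permutes_range[OF b] by (auto simp: p_def p'_def)
  have c: "b \<circ> \<tau> permutes {1..length \<mu>}" if "\<tau> permutes {1..m}" for \<tau>
    using permutes_subset[OF that sub] b by (intro permutes_compose)
  have inv_c: "inv (b \<circ> \<tau>) x = inv \<tau> (inv b x)" if "\<tau> permutes {1..m}" for \<tau> x
    using o_inv_distrib[OF permutes_bij[OF b] permutes_bij[OF that]] by simp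
  show ?thesis
  proof (cases "p' \<le> m")
    case False
    have "T_simple i (Cst (t_K ^ cross m (b \<circ> \<tau>) \<mu>) * E_gen (b \<circ> \<tau>) \<mu>) =
        Cst (t_K ^ cross m (?s \<circ> b \<circ> \<tau>) \<mu>) * E_gen (?s \<circ> b \<circ> \<tau>) \<mu>"
      if \<tau>: "\<tau> permutes {1..m}" for \<tau>
    proof -
      have "inv \<tau> p' = p'" using False by (intro permutes_not_in[OF permutes_inv[OF \<tau>]]) simp
      then have p'': "inv (b \<circ> \<tau>) (i + 1) = p'" by (simp only: inv_c[OF \<tau>] p'_def)
      \<comment> \<open>\<tau> fixes p' and moves p at most within the first m columns, so i stays
        left of i + 1 in every summand.\<close>
      have less': "inv (b \<circ> \<tau>) i < inv (b \<circ> \<tau>) (i + 1)"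
      proof (cases "p \<le> m")
        case True
        then have "inv \<tau> p \<in> {1..m}" using pp by (intro inv_permutes_range[OF \<tau>]) auto
        then show ?thesis using False unfolding p'' by (simp add: inv_c[OF \<tau>] p_def[symmetric])
      next
        case False
        then have "inv \<tau> p = p" by (intro permutes_not_in[OF permutes_inv[OF \<tau>]]) simp
        then show ?thesis using pp unfolding p'' by (simp add: inv_c[OF \<tau>] p_def[symmetric])
      qed
      have "cross m (?s \<circ> (b \<circ> \<tau>)) \<mu> =
          of_bool (part \<mu> (inv (b \<circ> \<tau>) i) \<le> part \<mu> (inv (b \<circ> \<tau>) (i + 1))) + cross m (b \<circ> \<tau>) \<mu>"
        unfolding cross_def card_invs_filter_simple_refl[OF c[OF \<tau>] i less'] using False p'' by simp
      then show ?thesis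
        unfolding T_simple_Cst_mult T_simple_E_gen_inv[OF c[OF \<tau>] i less'] comp_assoc
        by (simp only: power_add Cst_hom mult_ac)
    qed
    then have "T_simple i (E_sym m b \<mu>) = E_sym m (?s \<circ> b) \<mu>"
      unfolding E_sym_def T_simple_sum by (intro sum.cong) auto
    then show ?thesis using False by (simp add: p'_def Cst_hom)
  next
    case True
    then have pm: "p \<in> {1..m}" "p' \<in> {1..m}" using pp by auto
    define f where "f \<tau> = Cst (t_K ^ cross m (b \<circ> \<tau>) \<mu>) * E_gen (b \<circ> \<tau>) \<mu>" for \<tau>
    let ?\<rho> = "transpose p p'"
    have \<rho>: "?\<rho> permutes {1..m}" using pm by (intro permutes_swap_id)
    have sb: "?s \<circ> b = b \<circ> ?\<rho>"
      using permutes_inj[OF b] inv_permutes_apply[OF b] unfolding p_def p'_def by (intro simple_refl_comp_eq)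
    have T: "T_simple i (f \<tau> + f (?\<rho> \<circ> \<tau>)) = Cst t_K * (f \<tau> + f (?\<rho> \<circ> \<tau>))"
      if \<tau>: "\<tau> permutes {1..m}" for \<tau>
    proof -
      have r: "inv (b \<circ> \<tau>) i \<in> {1..m}" "inv (b \<circ> \<tau>) (i + 1) \<in> {1..m}"
        unfolding inv_c[OF \<tau>] p_def[symmetric] p'_def[symmetric] using pm
        by (intro inv_permutes_range[OF \<tau>]; simp)+
      have pair: "cross m (?s \<circ> (b \<circ> \<tau>)) \<mu> = cross m (b \<circ> \<tau>) \<mu>"
        "T_simple i (E_gen (b \<circ> \<tau>) \<mu> + E_gen (?s \<circ> (b \<circ> \<tau>)) \<mu>) =
          Cst t_K * (E_gen (b \<circ> \<tau>) \<mu> + E_gen (?s \<circ> (b \<circ> \<tau>)) \<mu>)"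
        by (rule T_simple_E_gen_pair[OF m _ c[OF \<tau>] i r], fact dec)+
      have e: "b \<circ> (?\<rho> \<circ> \<tau>) = ?s \<circ> (b \<circ> \<tau>)" by (simp add: sb flip: comp_assoc)
      have "f \<tau> + f (?\<rho> \<circ> \<tau>) = Cst (t_K ^ cross m (b \<circ> \<tau>) \<mu>) * (E_gen (b \<circ> \<tau>) \<mu> + E_gen (?s \<circ> (b \<circ> \<tau>)) \<mu>)"
        unfolding f_def e pair(1) by (simp only: distrib_left)
      then show ?thesis by (simp only: T_simple_Cst_mult pair(2) mult_ac)
    qed
    have E: "E_sym m b \<mu> = (\<Sum>\<tau> | \<tau> permutes {1..m}. f \<tau>)"
      "E_sym m b \<mu> = (\<Sum>\<tau> | \<tau> permutes {1..m}. f (?\<rho> \<circ> \<tau>))"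
      using sum_permutes_comp[OF \<rho>, of f] by (simp_all only: E_sym_def f_def)
    \<comment> \<open>Adding a reindexed copy of the sum pairs each \<tau> with
      \<open>?\<rho> \<circ> \<tau>\<close> without choosing representatives; the factor 2 is
      cancelled afterwards.\<close>
    have 2: "E_sym m b \<mu> + E_sym m b \<mu> = (\<Sum>\<tau> | \<tau> permutes {1..m}. f \<tau> + f (?\<rho> \<circ> \<tau>))"
      unfolding sum.distrib E(1)[symmetric] E(2)[symmetric] ..
    have two: "Cst (of_nat 2) = 1 + 1"
      by (simp only: numeral_2_eq_2 of_nat_Suc of_nat_0 add_0_right Cst_hom)
    have "T_simple i (E_sym m b \<mu> + E_sym m b \<mu>) = Cst t_K * (E_sym m b \<mu> + E_sym m b \<mu>)"
      unfolding 2 T_simple_sum sum_distrib_left by (rule sum.cong[OF refl], rule T) simp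
    then have "Cst (of_nat 2) * T_simple i (E_sym m b \<mu>) = Cst (of_nat 2) * (Cst t_K * E_sym m b \<mu>)"
      unfolding two by (simp only: T_simple_add distrib_left distrib_right mult_1_left)
    then have "T_simple i (E_sym m b \<mu>) = Cst t_K * E_sym m b \<mu>"
      using mult_left_cancel[OF Cst_of_nat_nonzero[of 2]] by simp
    moreover have "E_sym m (?s \<circ> b) \<mu> = E_sym m b \<mu>" unfolding sb by (rule E_sym_comp[OF \<rho>])
    ultimately show ?thesis using True by (simp add: p'_def)
  qed
qed

lemma foldr_T_simple_E_sym:
  assumes m: "m \<le> length \<mu>" and dec: "\<And>p p'. 1 \<le> p \<Longrightarrow> p < p' \<Longrightarrow> p' \<le> m \<Longrightarrow> part \<mu> p' \<le> part \<mu> p"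
    and w: "reduced_word (length \<mu>) \<pi> w"
  shows "foldr T_simple w (E_sym m id \<mu>) =
    Cst (t_K ^ card {x \<in> invs (length \<mu>) \<pi>. snd x \<le> m}) * E_sym m \<pi> \<mu>"
  using w
proof (induction rule: reduced_word_induct)
  case Nil
  then show ?case by (simp add: Cst_hom)
next
  case (Cons i \<pi> w)
  have T: "T_simple i (E_sym m \<pi> \<mu>) =
      Cst (t_K ^ of_bool (inv \<pi> (i + 1) \<le> m)) * E_sym m (simple_refl i \<circ> \<pi>) \<mu>"
    using Cons.hyps dec by (intro T_simple_E_sym m)
  have "foldr T_simple (i # w) (E_sym m id \<mu>) =
      Cst (t_K ^ card {x \<in> invs (length \<mu>) (simple_refl i \<circ> \<pi>). snd x \<le> m}) *
      E_sym m (simple_refl i \<circ> \<pi>) \<mu>"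
    unfolding foldr.simps comp_apply Cons.IH T_simple_Cst_mult
      T card_invs_filter_simple_refl[OF Cons.hyps(2,1,3)]
    by (simp only: power_add Cst_hom mult_ac snd_conv)
  then show ?case .
qed

section \<open>Minimal coset representatives\<close>

text \<open>Applying the reflection to positions embeds the inversions of the product into those of
  \<pi> and misses (r, r + 1).\<close>

lemma card_invs_comp_descent:
  assumes r: "1 \<le> r" "r + 1 \<le> n" and d: "\<pi> (r + 1) < \<pi> r"
  shows "card (invs n (\<pi> \<circ> simple_refl r)) < card (invs n \<pi>)"
proof -
  let ?f = "map_prod (simple_refl r) (simple_refl r)"
  have "inj_on ?f (invs n (\<pi> \<circ> simple_refl r))"
    by (rule inj_on_subset[OF prod.inj_map[of "simple_refl r" "simple_refl r"]])
      (simp_all add: simple_refl_def)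
  moreover have "?f ` invs n (\<pi> \<circ> simple_refl r) \<subseteq> invs n \<pi> - {(r, r + 1)}"
  proof (intro subsetI)
    fix z assume "z \<in> ?f ` invs n (\<pi> \<circ> simple_refl r)"
    then obtain x y where xy: "z = (simple_refl r x, simple_refl r y)" "x \<in> {1..n}" "y \<in> {1..n}" "x < y"
      "\<pi> (simple_refl r y) < \<pi> (simple_refl r x)" by (auto simp: invs_def)
    then have "\<not> (x = r \<and> y = r + 1)" using d by (auto simp: simple_refl_apply)
    then show "z \<in> invs n \<pi> - {(r, r + 1)}"
      using xy r by (auto simp: invs_def simple_refl_apply split: if_splits)
  qed
  ultimately have "card (invs n (\<pi> \<circ> simple_refl r)) \<le> card (invs n \<pi> - {(r, r + 1)})"
    by (intro card_inj_on_le) auto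
  also have "\<dots> < card (invs n \<pi>)"
    using r d by (intro card_Diff1_less finite_invs) (auto simp: invs_def)
  finally show ?thesis .
qed

lemma part_decreasing:
  assumes "sorted_wrt (\<ge>) lam" "1 \<le> p" "p < p'" "p' \<le> length lam"
  shows "part lam p' \<le> part lam p"
  using sorted_wrt_nth_less[OF assms(1), of "p - 1" "p' - 1"] assms by (simp add: part_def)

lemma stabilizer_comp:
  assumes "\<rho> \<in> stabilizer lam" "\<rho>' \<in> stabilizer lam"
  shows "\<rho> \<circ> \<rho>' \<in> stabilizer lam"
proof -
  have p: "\<rho> permutes {1..length lam}" "\<rho>' permutes {1..length lam}"
    using assms by (simp_all add: stabilizer_def)
  have "part lam (\<rho> (\<rho>' i)) = part lam i" if "i \<in> {1..length lam}" for i
    using assms permutes_in_image[OF p(2), of i] that by (auto simp: stabilizer_def)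
  then show ?thesis using permutes_compose[OF p(2,1)] unfolding stabilizer_def by simp
qed

lemma stabilizer_inv:
  assumes "\<rho> \<in> stabilizer lam"
  shows "inv \<rho> \<in> stabilizer lam"
proof -
  have p: "\<rho> permutes {1..length lam}" using assms by (simp add: stabilizer_def)
  have "part lam (inv \<rho> i) = part lam i" if "i \<in> {1..length lam}" for i
  proof -
    have "inv \<rho> i \<in> {1..length lam}" using p that by (rule inv_permutes_range)
    then have "part lam (\<rho> (inv \<rho> i)) = part lam (inv \<rho> i)" using assms by (auto simp: stabilizer_def)
    then show ?thesis by (simp add: inv_permutes_apply[OF p])
  qed
  then show ?thesis using permutes_inv[OF p] by (simp add: stabilizer_def)
qed

text \<open>All parts between p and p' are equal, so exchanging neighbours there stays in the coset;
  a descent would contradict minimality.\<close>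

lemma min_coset_rep_increasing:
  assumes s: "sorted_wrt (\<ge>) lam" and \<pi>: "\<pi> \<in> min_coset_reps lam"
    and p: "1 \<le> p" "p < p'" "p' \<le> length lam" "part lam p = part lam p'"
  shows "\<pi> p < \<pi> p'"
proof -
  let ?m = "length lam"
  have perm: "\<pi> permutes {1..?m}" using \<pi> by (simp add: min_coset_reps_def)
  have step: "\<pi> r < \<pi> (r + 1)" if r: "p \<le> r" "r < p'" for r
  proof (rule ccontr)
    assume "\<not> \<pi> r < \<pi> (r + 1)"
    then have d: "\<pi> (r + 1) < \<pi> r" using inj_eq[OF permutes_inj[OF perm], of r "r + 1"] by simp
    have "part lam p' \<le> part lam (r + 1)"
      using part_decreasing[OF s, of "r + 1" p'] r p by (cases "r + 1 = p'") auto
    moreover have "part lam (r + 1) \<le> part lam r"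
      using part_decreasing[OF s, of r "r + 1"] r p by auto
    moreover have "part lam r \<le> part lam p"
      using part_decreasing[OF s, of p r] r p by (cases "r = p") auto
    ultimately have "part lam r = part lam (r + 1)" using p by simp
    then have "simple_refl r \<in> stabilizer lam"
      using r p simple_refl_permutes[of r ?m] by (auto simp: stabilizer_def simple_refl_apply)
    then have "cox_length ?m \<pi> \<le> cox_length ?m (\<pi> \<circ> simple_refl r)"
      using \<pi> by (simp add: min_coset_reps_def)
    moreover have perm': "\<pi> \<circ> simple_refl r permutes {1..?m}"
      using r p by (intro permutes_compose simple_refl_permutes perm) auto
    ultimately have "card (invs ?m \<pi>) \<le> card (invs ?m (\<pi> \<circ> simple_refl r))"
      by (simp only: cox_length_eq_card_invs[OF perm] cox_length_eq_card_invs[OF perm'])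
    then show False using card_invs_comp_descent[of r ?m \<pi>] d r p by simp
  qed
  have "\<pi> p < \<pi> (p + Suc d)" if "p + Suc d \<le> p'" for d
    using that
  proof (induction d)
    case 0 then show ?case using step[of p] by simp
  next
    case (Suc d)
    then have "\<pi> p < \<pi> (p + Suc d)" by simp
    also have "\<dots> < \<pi> (p + Suc d + 1)" using Suc.prems by (intro step) auto
    finally show ?case by simp
  qed
  from this[of "p' - p - 1"] show ?thesis using p by simp
qed

text \<open>Surjectivity takes an element of least length in each coset. Injectivity amounts to a
  coset having only one such element.\<close>

lemma bij_betw_min_coset_reps:
  assumes s: "sorted_wrt (\<ge>) lam"
  shows "bij_betw (\<lambda>(\<pi>, \<rho>). \<pi> \<circ> \<rho>) (min_coset_reps lam \<times> stabilizer lam) {\<tau>. \<tau> permutes {1..length lam}}"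
proof -
  let ?m = "length lam"
  have Sp: "\<rho> permutes {1..?m}" if "\<rho> \<in> stabilizer lam" for \<rho> using that by (simp add: stabilizer_def)
  have Mp: "\<pi> permutes {1..?m}" if "\<pi> \<in> min_coset_reps lam" for \<pi> using that by (simp add: min_coset_reps_def)
  have "\<rho> = id" if \<pi>: "\<pi> \<in> min_coset_reps lam" "\<pi> \<circ> \<rho> \<in> min_coset_reps lam" and \<rho>: "\<rho> \<in> stabilizer lam" for \<pi> \<rho>
  proof (rule ccontr)
    assume "\<rho> \<noteq> id"
    then have ex: "\<exists>p. \<rho> p \<noteq> p" by auto
    \<comment> \<open>At the first point p moved by \<rho>, both \<open>\<rho> p\<close> and the
      preimage x of p lie to the right of p and have equal parts. Monotonicity of \<pi> and of
      \<open>\<pi> \<circ> \<rho>\<close> then orders \<open>\<pi> p\<close> and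
      \<open>\<pi> (\<rho> p)\<close> in opposite ways.\<close>
    define p where "p = (LEAST p. \<rho> p \<noteq> p)"
    have p: "\<rho> p \<noteq> p" unfolding p_def using ex by (rule LeastI_ex)
    have min: "\<rho> x = x" if "x < p" for x using not_less_Least[of x "\<lambda>p. \<rho> p \<noteq> p"] that by (auto simp: p_def)
    have inj: "\<rho> x = \<rho> y \<longleftrightarrow> x = y" for x y by (rule inj_eq[OF permutes_inj[OF Sp[OF \<rho>]]])
    have pm: "p \<in> {1..?m}" using p permutes_not_in[OF Sp[OF \<rho>]] by blast
    have "\<not> \<rho> p < p" using min[of "\<rho> p"] inj p by auto
    then have r: "p < \<rho> p" using p by simp
    define x where "x = inv \<rho> p"
    have x: "\<rho> x = p" "x \<in> {1..?m}"
      using inv_permutes_apply[OF Sp[OF \<rho>]] inv_permutes_range[OF Sp[OF \<rho>] pm] by (simp_all add: x_def)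
    have "\<not> x < p" using min[of x] x by auto
    moreover have "x \<noteq> p" using x p by auto
    ultimately have xp: "p < x" by simp
    have rm: "\<rho> p \<in> {1..?m}" using permutes_in_image[OF Sp[OF \<rho>]] pm by blast
    have eq: "part lam (\<rho> p) = part lam p" "part lam p = part lam x"
      using \<rho> pm x by (auto simp: stabilizer_def)
    have "\<pi> p < \<pi> (\<rho> p)"
      using min_coset_rep_increasing[OF s \<pi>(1), of p "\<rho> p"] r pm rm eq by simp
    moreover have "(\<pi> \<circ> \<rho>) p < (\<pi> \<circ> \<rho>) x"
      using min_coset_rep_increasing[OF s \<pi>(2), of p x] xp pm x(2) eq by simp
    ultimately show False by (simp add: x)
  qed
  note uniq = this
  show ?thesis
  proof (rule bij_betwI')
    fix z z' assume z: "z \<in> min_coset_reps lam \<times> stabilizer lam" "z' \<in> min_coset_reps lam \<times> stabilizer lam"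
    obtain \<pi> \<rho> \<pi>' \<rho>' where e: "z = (\<pi>, \<rho>)" "z' = (\<pi>', \<rho>')" by (metis prod.exhaust)
    have in1: "\<pi> \<in> min_coset_reps lam" "\<rho> \<in> stabilizer lam" "\<pi>' \<in> min_coset_reps lam" "\<rho>' \<in> stabilizer lam"
      using z e by auto
    show "((\<lambda>(\<pi>, \<rho>). \<pi> \<circ> \<rho>) z = (\<lambda>(\<pi>, \<rho>). \<pi> \<circ> \<rho>) z') = (z = z')"
    proof
      assume "(\<lambda>(\<pi>, \<rho>). \<pi> \<circ> \<rho>) z = (\<lambda>(\<pi>, \<rho>). \<pi> \<circ> \<rho>) z'"
      then have h: "\<pi> \<circ> \<rho> = \<pi>' \<circ> \<rho>'" by (simp add: e)
      have "\<pi> \<circ> (\<rho> \<circ> inv \<rho>') = \<pi>' \<circ> (\<rho>' \<circ> inv \<rho>')" unfolding comp_assoc[symmetric] h ..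
      then have h': "\<pi> \<circ> (\<rho> \<circ> inv \<rho>') = \<pi>'" using permutes_inv_o(1)[OF Sp[OF in1(4)]] by simp
      have M: "\<pi> \<circ> (\<rho> \<circ> inv \<rho>') \<in> min_coset_reps lam" unfolding h' by (rule in1(3))
      have "\<rho> \<circ> inv \<rho>' = id"
        by (rule uniq[OF in1(1) M stabilizer_comp[OF in1(2) stabilizer_inv[OF in1(4)]]])
      then have "\<pi> = \<pi>'" using h' by simp
      moreover have "\<rho> = \<rho>'"
      proof -
        have "\<rho> \<circ> (inv \<rho>' \<circ> \<rho>') = id \<circ> \<rho>'" unfolding comp_assoc[symmetric] \<open>\<rho> \<circ> inv \<rho>' = id\<close> ..
        then show ?thesis using permutes_inv_o(2)[OF Sp[OF in1(4)]] by simp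
      qed
      ultimately show "z = z'" by (simp add: e)
    qed simp
    show "(\<lambda>(\<pi>, \<rho>). \<pi> \<circ> \<rho>) z \<in> {\<tau>. \<tau> permutes {1..?m}}"
      using Sp Mp in1 by (auto simp: e intro: permutes_compose)
  next
    fix \<sigma> assume "\<sigma> \<in> {\<tau>. \<tau> permutes {1..?m}}"
    then have \<sigma>: "\<sigma> permutes {1..?m}" by simp
    have id: "id \<in> stabilizer lam" by (simp add: stabilizer_def permutes_id)
    obtain \<rho> where \<rho>: "\<rho> \<in> stabilizer lam"
      "\<And>\<rho>'. \<rho>' \<in> stabilizer lam \<Longrightarrow> cox_length ?m (\<sigma> \<circ> \<rho>) \<le> cox_length ?m (\<sigma> \<circ> \<rho>')"
      using ex_has_least_nat[of "\<lambda>\<rho>. \<rho> \<in> stabilizer lam" id "\<lambda>\<rho>. cox_length ?m (\<sigma> \<circ> \<rho>)"] id by blast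
    have "\<sigma> \<circ> \<rho> \<in> min_coset_reps lam"
      using \<rho> \<sigma> Sp stabilizer_comp by (auto simp: min_coset_reps_def comp_assoc intro: permutes_compose)
    moreover have "\<sigma> = (\<sigma> \<circ> \<rho>) \<circ> inv \<rho>"
      using permutes_inv_o(1)[OF Sp[OF \<rho>(1)]] by (simp add: comp_assoc)
    ultimately show "\<exists>z\<in>min_coset_reps lam \<times> stabilizer lam. \<sigma> = (\<lambda>(\<pi>, \<rho>). \<pi> \<circ> \<rho>) z"
      using stabilizer_inv[OF \<rho>(1)] by (intro bexI[of _ "(\<sigma> \<circ> \<rho>, inv \<rho>)"]) auto
  qed
qed

lemma poly_ring_prod: "(\<And>a. a \<in> A \<Longrightarrow> F a \<in> poly_ring n) \<Longrightarrow> prod F A \<in> poly_ring n"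
  using poly_ring_Cst[of 1 n]
  by (induction A rule: infinite_finite_induct) (auto simp: poly_ring_mult Cst_hom)

lemma E_gen_poly_ring: "E_gen b \<mu> \<in> poly_ring (length \<mu>)"
  unfolding E_gen_def
proof (intro poly_ring_sum poly_ring_mult poly_ring_Cst poly_ring_prod poly_ring_X)
  fix \<sigma> u assume "\<sigma> \<in> NAF b \<mu>" "u \<in> dg \<mu>"
  then show "\<sigma> u \<in> {1..length \<mu>}" by (auto simp: NAF_def aug_dg_def)
qed

lemma bar_poly_ring: "f \<in> poly_ring n \<Longrightarrow> bar f \<in> poly_ring n"
  by (auto simp: poly_ring_def in_keys_iff)

lemma E_sym_id:
  assumes "m \<le> length \<mu>"
  shows "E_sym m id \<mu> = (\<Sum>\<tau> | \<tau> permutes {1..m}. E_gen \<tau> \<mu>)"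
  unfolding E_sym_def
proof (rule sum.cong[OF refl])
  fix \<tau> assume "\<tau> \<in> {\<tau>. \<tau> permutes {1..m}}"
  then have "invs (length \<mu>) \<tau> \<subseteq> {(p, p'). 1 \<le> p \<and> p < p' \<and> p' \<le> m}"
    using invs_permutes_subset by blast
  then have "{x \<in> invs (length \<mu>) \<tau>. m < snd x \<and> part \<mu> (fst x) \<le> part \<mu> (snd x)} = {}" by auto
  then have "cross m (id \<circ> \<tau>) \<mu> = 0" by (simp add: cross_def)
  then show "Cst (t_K ^ cross m (id \<circ> \<tau>) \<mu>) * E_gen (id \<circ> \<tau>) \<mu> = E_gen \<tau> \<mu>" by (simp add: Cst_hom)
qed

text \<open>Minimal representatives increase on equal parts, so each of their inversions joins a
  higher column to a lower one and T_\<pi> yields no power of t. Exchanging equal columns costs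
  nothing, so each coset repeats one term as often as the stabilizer has elements.\<close>

lemma P_mac_eq_E_sym:
  assumes s: "sorted_wrt (\<ge>) lam"
  shows "Cst (of_nat (card (stabilizer lam))) * P_mac lam \<gamma> = E_sym (length lam) id (lam @ \<gamma>)"
proof -
  let ?m = "length lam" and ?\<mu> = "lam @ \<gamma>"
  let ?n = "length ?\<mu>"
  have part: "part ?\<mu> p = part lam p" if "1 \<le> p" "p \<le> ?m" for p
  proof -
    have "p - 1 < ?m" using that by linarith
    then show ?thesis by (simp add: part_def nth_append)
  qed
  have dec: "part ?\<mu> p' \<le> part ?\<mu> p" if "1 \<le> p" "p < p'" "p' \<le> ?m" for p p'
    using part_decreasing[OF s that] that part by simp
  have sub: "{1..?m} \<subseteq> {1..?n}" by auto
  have T: "T_op (?m + length \<gamma>) \<pi> (E_mac ?\<mu>) = E_gen \<pi> ?\<mu>" if \<pi>: "\<pi> \<in> min_coset_reps lam" for \<pi>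
  proof -
    have p: "\<pi> permutes {1..?m}" using \<pi> by (simp add: min_coset_reps_def)
    have "{x \<in> invs ?n \<pi>. part ?\<mu> (fst x) \<le> part ?\<mu> (snd x)} = {}"
    proof (rule equals0I)
      fix x assume x: "x \<in> {x \<in> invs ?n \<pi>. part ?\<mu> (fst x) \<le> part ?\<mu> (snd x)}"
      obtain y z where yz: "x = (y, z)" by (rule prod.exhaust)
      have h: "(y, z) \<in> invs ?n \<pi>" "part ?\<mu> y \<le> part ?\<mu> z" using x by (simp_all add: yz)
      then have r: "1 \<le> y" "y < z" "z \<le> ?m" using invs_permutes_subset[OF p, of ?n] by auto
      then have "part lam y = part lam z"
        using h(2) part part_decreasing[OF s r] by simp
      then have "\<pi> y < \<pi> z" using min_coset_rep_increasing[OF s \<pi> r] by simp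
      then show False using h(1) by (simp add: invs_def)
    qed
    from foldr_T_simple_E_gen[OF reduced_word_exists[OF permutes_subset[OF p sub]], unfolded this]
    show ?thesis
      by (simp only: T_op_def E_mac_eq_E_gen Cst_hom card.empty power_0 mult_1_left length_append)
  qed
  have inv: "E_gen (\<pi> \<circ> \<rho>) ?\<mu> = E_gen \<pi> ?\<mu>" if "\<pi> \<in> min_coset_reps lam" "\<rho> \<in> stabilizer lam" for \<pi> \<rho>
  proof (rule E_gen_stabilizer[of ?m])
    show \<rho>: "\<rho> permutes {1..?m}" using that by (simp add: stabilizer_def)
    show "part ?\<mu> (\<rho> i) = part ?\<mu> i" if i: "i \<in> {1..?m}" for i
      using permutes_in_image[OF \<rho>, of i] i part \<open>\<rho> \<in> stabilizer lam\<close> by (auto simp: stabilizer_def)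
    show "\<pi> permutes {1..?n}"
      using that permutes_subset[OF _ sub] by (auto simp: min_coset_reps_def)
  qed (use dec in auto)
  have "E_sym ?m id ?\<mu> = (\<Sum>(\<pi>, \<rho>)\<in>min_coset_reps lam \<times> stabilizer lam. E_gen (\<pi> \<circ> \<rho>) ?\<mu>)"
    using sum.reindex_bij_betw[OF bij_betw_min_coset_reps[OF s], of "\<lambda>\<tau>. E_gen \<tau> ?\<mu>"]
    by (simp add: E_sym_id case_prod_unfold)
  also have "\<dots> = (\<Sum>(\<pi>, \<rho>)\<in>min_coset_reps lam \<times> stabilizer lam. E_gen \<pi> ?\<mu>)"
    using inv by (intro sum.cong) auto
  also have "\<dots> = (\<Sum>\<pi>\<in>min_coset_reps lam. of_nat (card (stabilizer lam)) * E_gen \<pi> ?\<mu>)"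
    by (simp flip: sum.cartesian_product)
  also have "\<dots> = of_nat (card (stabilizer lam)) * P_mac lam \<gamma>"
    unfolding P_mac_def sum_distrib_left by (intro sum.cong refl) (simp only: T)
  also have "of_nat (card (stabilizer lam)) = Cst (of_nat (card (stabilizer lam)))"
    by (simp add: Cst_def)
  finally show ?thesis by (rule sym)
qed

section \<open>The main theorem\<close>

lemma bar_K_of_nat: "bar_K (of_nat k) = of_nat k"
  by (induction k) (simp_all add: bar_K_add)

lemma act_word_perm_invariant:
  assumes "\<And>i. i \<in> set w \<Longrightarrow> act (simple_refl i) f = f"
  shows "act (word_perm w) f = f"
  using assms
proof (induction w)
  case Nil show ?case unfolding word_perm_simps by (rule act_id)
next
  case (Cons i w)
  then show ?case unfolding word_perm_simps act_act[symmetric] by simp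
qed

lemma pair_inv_eq_card:
  "pair_inv lam \<gamma> = card {(p, p'). 1 \<le> p \<and> p < p' \<and> p' \<le> length lam + length \<gamma> \<and>
     length lam < p' \<and> part (lam @ \<gamma>) p > part (lam @ \<gamma>) p'}" (is "_ = card ?A")
  and comp_inv_eq_card:
  "comp_inv \<gamma> = card {(p, p'). length lam < p \<and> p < p' \<and> p' \<le> length lam + length \<gamma> \<and>
     part (lam @ \<gamma>) p > part (lam @ \<gamma>) p'}" (is "_ = card ?B")
proof -
  let ?m = "length lam"
  have part1: "part (lam @ \<gamma>) p = part lam p" if "1 \<le> p" "p \<le> ?m" for p
  proof -
    have "p - 1 < ?m" using that by linarith
    then show ?thesis by (simp add: part_def nth_append)
  qed
  have part2: "part (lam @ \<gamma>) p = part \<gamma> (p - ?m)" if "?m < p" for p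
  proof -
    have "\<not> p - 1 < ?m" "p - 1 - ?m = p - ?m - 1" using that by auto
    then show ?thesis by (simp add: part_def nth_append)
  qed
  let ?C = "{(i, j). 1 \<le> i \<and> i < j \<and> j \<le> length \<gamma> \<and> part \<gamma> i > part \<gamma> j}"
  let ?D = "{(i, j). i \<in> {1..?m} \<and> j \<in> {1..length \<gamma>} \<and> part lam i > part \<gamma> j}"
  let ?f = "\<lambda>(i, j). (?m + i, ?m + j)" and ?g = "\<lambda>(i, j). (i, ?m + j)"
  have B: "?B = ?f ` ?C"
  proof (intro set_eqI iffI)
    fix x assume "x \<in> ?B"
    then obtain p p' where x: "x = (p, p')" "?m < p" "p < p'" "p' \<le> ?m + length \<gamma>"
      "part (lam @ \<gamma>) p > part (lam @ \<gamma>) p'" by auto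
    then have "(p - ?m, p' - ?m) \<in> ?C" "x = ?f (p - ?m, p' - ?m)" using part2 by auto
    then show "x \<in> ?f ` ?C" by blast
  qed (auto simp: part2)
  show "comp_inv \<gamma> = card ?B"
    unfolding B comp_inv_def by (rule card_image[symmetric]) (auto simp: inj_on_def)
  have "?A = ?B \<union> ?g ` ?D"
  proof (intro set_eqI iffI)
    fix x assume "x \<in> ?A"
    then obtain p p' where x: "x = (p, p')" "1 \<le> p" "p < p'" "p' \<le> ?m + length \<gamma>" "?m < p'"
      "part (lam @ \<gamma>) p > part (lam @ \<gamma>) p'" by auto
    show "x \<in> ?B \<union> ?g ` ?D"
    proof (cases "p \<le> ?m")
      case True
      then have "(p, p' - ?m) \<in> ?D" "x = ?g (p, p' - ?m)" using x part1[of p] part2[of p'] by auto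
      then show ?thesis by blast
    qed (use x in auto)
  qed (auto simp: part1 part2)
  moreover have "?B \<inter> ?g ` ?D = {}" by auto
  moreover have "finite ?B"
    by (rule finite_subset[of _ "{..?m + length \<gamma>} \<times> {..?m + length \<gamma>}"]) auto
  moreover have "finite ?D"
    by (rule finite_subset[of _ "{..?m} \<times> {..length \<gamma>}"]) auto
  moreover have "card (?g ` ?D) = card ?D" by (rule card_image) (auto simp: inj_on_def)
  ultimately have "card ?A = card ?B + card ?D" by (simp add: card_Un_disjoint)
  then show "pair_inv lam \<gamma> = card ?A"
    unfolding pair_inv_def \<open>comp_inv \<gamma> = card ?B\<close> by simp
qed

lemma sum_list_eq_sum_part:
  "sum_list \<gamma> = (\<Sum>p\<in>{length lam + 1..length lam + length \<gamma>}. part (lam @ \<gamma>) p)"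
proof -
  have "sum_list \<gamma> = (\<Sum>i\<in>{0..<length \<gamma>}. \<gamma> ! i)" by (rule sum_list_sum_nth)
  also have "\<dots> = (\<Sum>p\<in>{length lam + 1..length lam + length \<gamma>}. part (lam @ \<gamma>) p)"
    by (rule sum.reindex_bij_witness[of _ "\<lambda>p. p - (length lam + 1)" "\<lambda>i. i + (length lam + 1)"])
      (auto simp: part_def nth_append)
  finally show ?thesis .
qed

lemma block_reversal_full: "block_reversal n n = reversal 1 n"
  by (auto simp: fun_eq_iff block_reversal_apply reversal_def)

lemma subst_block_vars_full: "subst (block_vars n n) = act (reversal 1 n)"
proof -
  have "block_vars n n = (\<lambda>i. X (reversal 1 n i))"
    by (auto simp: fun_eq_iff block_vars_def block_reversal_full)
  then show ?thesis by (simp add: act_def)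
qed

section \<open>Both identities for fixed compositions\<close>

context
  fixes lam \<gamma> :: "nat list" and m n :: nat and \<mu> :: "nat list"
  assumes dec: "sorted_wrt (\<ge>) lam"
  defines "m \<equiv> length lam" and "n \<equiv> length lam + length \<gamma>" and "\<mu> \<equiv> lam @ \<gamma>"
begin

lemma length_\<mu>: "length \<mu> = n" and m_le_n: "m \<le> n"
  by (simp_all add: \<mu>_def n_def m_def)

lemma part_\<mu>_decreasing: "1 \<le> p \<Longrightarrow> p < p' \<Longrightarrow> p' \<le> m \<Longrightarrow> part \<mu> p' \<le> part \<mu> p"
proof -
  assume p: "1 \<le> p" "p < p'" "p' \<le> m"
  then have "p - 1 < length lam" "p' - 1 < length lam" by (auto simp: m_def)
  then have "part \<mu> p = part lam p" "part \<mu> p' = part lam p'" by (simp_all add: \<mu>_def part_def nth_append)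
  then show ?thesis using part_decreasing[OF dec p(1,2)] p(3) by (simp add: m_def)
qed

text \<open>Multiplying by this nonzero constant turns \<open>P\<close> into the sum over all of
  S_m; identities are proved in multiplied form and then cancelled.\<close>

abbreviation "stab_card \<equiv> Cst (of_nat (card (stabilizer lam)))"

lemma stab_P_mac: "stab_card * P_mac lam \<gamma> = E_sym m id \<mu>"
  using P_mac_eq_E_sym[OF dec] by (simp only: m_def \<mu>_def)

lemma stab_P_mac_sum: "stab_card * P_mac lam \<gamma> = (\<Sum>\<tau> | \<tau> permutes {1..m}. E_gen \<tau> \<mu>)"
  using m_le_n by (simp only: stab_P_mac E_sym_id length_\<mu>)

lemma stab_card_nonzero: "stab_card \<noteq> 0"
proof (rule Cst_of_nat_nonzero)
  have "finite {\<rho>. \<rho> permutes {1..length lam}}" by (rule finite_permutations) simp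
  then have "finite (stabilizer lam)" by (rule rev_finite_subset) (auto simp: stabilizer_def)
  moreover have "id \<in> stabilizer lam" by (simp add: stabilizer_def permutes_id)
  ultimately show "card (stabilizer lam) \<noteq> 0" by auto
qed

lemma stab_cancel: "stab_card * f = stab_card * g \<Longrightarrow> f = g"
  using stab_card_nonzero by simp

lemma bar_stab: "bar (stab_card * f) = stab_card * bar f"
  by (simp add: bar_mult bar_K_of_nat)

lemma subst_stab: "subst g (stab_card * f) = stab_card * subst g f"
  by (simp add: subst_mult)

lemma T_op_Cst: "T_op n \<pi> (Cst c * f) = Cst c * T_op n \<pi> f"
  by (simp add: T_op_def foldr_T_simple_Cst)

lemma S_m_permutes: "\<tau> permutes {1..m} \<Longrightarrow> \<tau> permutes {1..n}"
  using m_le_n by (auto intro: permutes_subset)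

lemma P_mac_poly_ring: "P_mac lam \<gamma> \<in> poly_ring n"
proof -
  have "stab_card * P_mac lam \<gamma> \<in> poly_ring n"
    unfolding stab_P_mac_sum using E_gen_poly_ring[of _ \<mu>] by (intro poly_ring_sum) (simp add: length_\<mu>)
  then have "Cst (inverse (of_nat (card (stabilizer lam)))) * (stab_card * P_mac lam \<gamma>) \<in> poly_ring n"
    by (rule poly_ring_mult[OF poly_ring_Cst])
  moreover have "Cst (inverse (of_nat (card (stabilizer lam)))) * stab_card = 1"
  proof -
    have "(of_nat (card (stabilizer lam)) :: coef) \<noteq> 0" using stab_card_nonzero by simp
    then show ?thesis by (simp flip: Cst_hom(4)) (simp add: Cst_hom)
  qed
  ultimately show ?thesis by (simp only: mult.assoc[symmetric] mult_1_left)
qed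

lemma T_op_P_mac:
  assumes "\<pi> permutes {1..n}"
  shows "stab_card * T_op n \<pi> (P_mac lam \<gamma>) =
    Cst (t_K ^ card {x \<in> invs n \<pi>. snd x \<le> m}) * E_sym m \<pi> \<mu>"
proof -
  have "stab_card * T_op n \<pi> (P_mac lam \<gamma>) = T_op n \<pi> (E_sym m id \<mu>)"
    by (simp only: T_op_Cst[symmetric] stab_P_mac)
  also have "\<dots> = Cst (t_K ^ card {x \<in> invs (length \<mu>) \<pi>. snd x \<le> m}) * E_sym m \<pi> \<mu>"
    unfolding T_op_def
    by (rule foldr_T_simple_E_sym)
      (use m_le_n part_\<mu>_decreasing reduced_word_exists[OF assms] in \<open>simp_all add: length_\<mu>\<close>)
  finally show ?thesis by (simp only: length_\<mu>)
qed

text \<open>Applied with l = n and with l = m. In both cases the power of q is the same for all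
  summands and leaves the sum.\<close>

lemma subst_bar_P_mac:
  assumes l: "l \<le> n" and c: "\<And>\<tau>. \<tau> permutes {1..m} \<Longrightarrow> big_size l \<tau> \<mu> = c"
  shows "stab_card * subst (block_vars l n) (bar (P_mac lam \<gamma>)) =
    Cst (q_K ^ c) * (\<Sum>\<tau> | \<tau> permutes {1..m}. E_gen (block_reversal l n \<circ> \<tau>) \<mu>)"
proof -
  have "stab_card * subst (block_vars l n) (bar (P_mac lam \<gamma>)) =
      (\<Sum>\<tau> | \<tau> permutes {1..m}. subst (block_vars l n) (bar (E_gen \<tau> \<mu>)))"
    by (simp only: subst_stab[symmetric] bar_stab[symmetric] stab_P_mac_sum bar_sum subst_sum)
  also have "\<dots> = (\<Sum>\<tau> | \<tau> permutes {1..m}. Cst (q_K ^ c) * E_gen (block_reversal l n \<circ> \<tau>) \<mu>)"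
  proof (rule sum.cong[OF refl])
    fix \<tau> assume "\<tau> \<in> {\<tau>. \<tau> permutes {1..m}}"
    then have \<tau>: "\<tau> permutes {1..m}" by simp
    have "subst (block_vars l (length \<mu>)) (bar (E_gen \<tau> \<mu>)) =
        Cst (q_K ^ big_size l \<tau> \<mu>) * E_gen (block_reversal l (length \<mu>) \<circ> \<tau>) \<mu>"
      using S_m_permutes[OF \<tau>] l by (intro subst_bar_E_gen) (simp_all only: length_\<mu>)
    then show "subst (block_vars l n) (bar (E_gen \<tau> \<mu>)) = Cst (q_K ^ c) * E_gen (block_reversal l n \<circ> \<tau>) \<mu>"
      by (simp only: length_\<mu> c[OF \<tau>])
  qed
  finally show ?thesis by (simp only: sum_distrib_left)
qed

text \<open>After the reversal, the inversions that reach beyond the first m columns are all such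
  pairs starting at a or later, whatever \<tau> does inside those columns; the power of t is
  therefore common to all summands.\<close>

lemma E_sym_reversal:
  assumes "1 \<le> a" "a \<le> m + 1" and A: "A = {(p, p'). a \<le> p \<and> p < p' \<and> p' \<le> n \<and> m < p' \<and> part \<mu> p \<le> part \<mu> p'}"
    and pres: "a = 1 \<or> a = m + 1"
  shows "E_sym m (reversal a n) \<mu> =
    Cst (t_K ^ card A) * (\<Sum>\<tau> | \<tau> permutes {1..m}. E_gen (reversal a n \<circ> \<tau>) \<mu>)"
proof -
  have "cross m (reversal a n \<circ> \<tau>) \<mu> = card A" if \<tau>: "\<tau> permutes {1..m}" for \<tau>
  proof -
    have out: "\<tau> p = p" if "m < p" for p using permutes_not_in[OF \<tau>] that by simp
    have inn: "1 \<le> \<tau> p \<and> \<tau> p \<le> m" if "1 \<le> p" "p \<le> m" for p using permutes_in_image[OF \<tau>, of p] that by simp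
    have "(p, p') \<in> invs n (reversal a n \<circ> \<tau>) \<longleftrightarrow> a \<le> p \<and> p < p' \<and> p' \<le> n" if "m < p'" for p p'
    proof (cases "p \<le> m")
      case True
      then show ?thesis
        using that out[OF that] inn[of p] assms(1,2) pres m_le_n
        by (cases "1 \<le> p") (auto simp: invs_def reversal_def)
    next
      case False
      then show ?thesis
        using that out[of p] out[of p'] assms(1,2) pres
        by (auto simp: invs_def reversal_def)
    qed
    then have "{x \<in> invs n (reversal a n \<circ> \<tau>). m < snd x \<and> part \<mu> (fst x) \<le> part \<mu> (snd x)} = A"
      unfolding A by auto
    then show ?thesis by (simp only: cross_def length_\<mu>)
  qed
  then show ?thesis by (simp add: E_sym_def sum_distrib_left)
qed

text \<open>All pairs of columns are inversions of the longest element: M inside the first m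
  columns, N reaching beyond them with weakly increasing heights, and \<open>pair_inv\<close> with
  strictly decreasing heights. T_w0 accounts for t^(M+N), so \<open>pair_inv\<close> is what the
  normalization of the involution leaves over.\<close>

lemma KL_inv_P_mac: "KL_inv n (P_mac lam \<gamma>) = Cst (t_K ^ pair_inv lam \<gamma>) * P_mac lam \<gamma>"
proof -
  define w0 where "w0 = reversal 1 n"
  define N where "N = card {(p, p'). 1 \<le> p \<and> p < p' \<and> p' \<le> n \<and> m < p' \<and> part \<mu> p \<le> part \<mu> p'}"
  define M where "M = card {x \<in> invs n w0. snd x \<le> m}"
  have w0: "w0 permutes {1..n}" unfolding w0_def by (rule reversal_permutes)
  have w0l: "longest_elt n 1 n = w0" unfolding w0_def by (rule longest_elt_eq_reversal) auto
  have len: "cox_length n w0 = M + N + pair_inv lam \<gamma>"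
  proof -
    let ?I = "{(p, p'). 1 \<le> p \<and> p < p' \<and> p' \<le> n}"
    let ?I1 = "{x \<in> invs n w0. snd x \<le> m}"
    let ?I2 = "{(p, p'). 1 \<le> p \<and> p < p' \<and> p' \<le> n \<and> m < p' \<and> part \<mu> p \<le> part \<mu> p'}"
    let ?I3 = "{(p, p'). 1 \<le> p \<and> p < p' \<and> p' \<le> n \<and> m < p' \<and> part \<mu> p > part \<mu> p'}"
    have I: "invs n w0 = ?I" unfolding w0_def by (rule invs_reversal) auto
    have fin: "finite ?I" using finite_invs[of n w0] unfolding I .
    have "?I = ?I1 \<union> (?I2 \<union> ?I3)" unfolding I by auto
    moreover have "finite ?I1" "finite ?I2" "finite ?I3"
      by (rule finite_subset[OF _ fin]; use I in auto)+
    moreover have "?I1 \<inter> (?I2 \<union> ?I3) = {}" "?I2 \<inter> ?I3 = {}" by auto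
    ultimately have "card ?I = card ?I1 + (card ?I2 + card ?I3)"
      by (simp only: card_Un_disjoint finite_Un simp_thms)
    moreover have "pair_inv lam \<gamma> = card ?I3"
      unfolding pair_inv_eq_card by (simp only: n_def m_def \<mu>_def conj_ac)
    ultimately show ?thesis
      unfolding cox_length_eq_card_invs[OF w0] I M_def N_def by simp
  qed
  have S: "E_sym m w0 \<mu> = Cst (t_K ^ N) * (\<Sum>\<tau> | \<tau> permutes {1..m}. E_gen (w0 \<circ> \<tau>) \<mu>)"
    unfolding w0_def N_def by (rule E_sym_reversal) auto
  have "stab_card * T_op n w0 (P_mac lam \<gamma>) =
      Cst (t_K ^ (M + N)) * (\<Sum>\<tau> | \<tau> permutes {1..m}. E_gen (w0 \<circ> \<tau>) \<mu>)"
    unfolding T_op_P_mac[OF w0] S M_def by (simp only: power_add Cst_hom mult_ac)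
  also have "(\<Sum>\<tau> | \<tau> permutes {1..m}. E_gen (w0 \<circ> \<tau>) \<mu>) = stab_card * act w0 (bar (P_mac lam \<gamma>))"
  proof -
    have "big_size n \<tau> \<mu> = 0" if \<tau>: "\<tau> permutes {1..m}" for \<tau>
      unfolding big_size_def length_\<mu>
    proof (intro sum.neutral ballI)
      fix p assume "p \<in> {1..n}"
      then show "(if n < \<tau> p then part \<mu> p else 0) = 0"
        using permutes_in_image[OF S_m_permutes[OF \<tau>], of p] by simp
    qed
    from subst_bar_P_mac[OF order_refl this] show ?thesis
      by (simp only: subst_block_vars_full block_reversal_full w0_def power_0 Cst_hom mult_1_left)
  qed
  finally have "stab_card * T_op n w0 (P_mac lam \<gamma>) =
      stab_card * (Cst (t_K ^ (M + N)) * act w0 (bar (P_mac lam \<gamma>)))" by (simp only: mult_ac)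
  then have T: "T_op n w0 (P_mac lam \<gamma>) = Cst (t_K ^ (M + N)) * act w0 (bar (P_mac lam \<gamma>))"
    by (rule stab_cancel)
  \<comment> \<open>The explicit preimage; \<open>inv_into\<close> returns it because T_w0 is
    injective and \<open>z\<close> lies in the polynomial ring.\<close>
  define z where "z = Cst (inverse (t_K ^ (M + N))) * P_mac lam \<gamma>"
  have "T_op n w0 z = Cst (inverse (t_K ^ (M + N)) * t_K ^ (M + N)) * act w0 (bar (P_mac lam \<gamma>))"
    unfolding z_def T_op_Cst T by (simp only: Cst_hom mult.assoc)
  then have Tz: "act w0 (bar (P_mac lam \<gamma>)) = T_op n w0 z" by (simp add: Cst_hom)
  have "inj (T_op n w0)"
    using foldr_T_simple_inj[of "SOME w. reduced_word n w0 w"] unfolding T_op_def[abs_def] .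
  then have "inj_on (T_op n w0) (poly_ring n)" by (rule inj_on_subset) simp
  moreover have "z \<in> poly_ring n" unfolding z_def by (intro poly_ring_mult poly_ring_Cst P_mac_poly_ring)
  ultimately have "inv_into (poly_ring n) (T_op n w0) (act w0 (bar (P_mac lam \<gamma>))) = z"
    unfolding Tz by (rule inv_into_f_f)
  then have "KL_inv n (P_mac lam \<gamma>) = Cst (t_K ^ (M + N + pair_inv lam \<gamma>)) * z"
    unfolding KL_inv_def w0l Let_def len by simp
  also have "\<dots> = Cst (t_K ^ (M + N + pair_inv lam \<gamma>) * inverse (t_K ^ (M + N))) * P_mac lam \<gamma>"
    unfolding z_def by (simp only: Cst_hom mult.assoc)
  also have "t_K ^ (M + N + pair_inv lam \<gamma>) * inverse (t_K ^ (M + N)) = t_K ^ pair_inv lam \<gamma>"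
    unfolding power_add[of _ "M + N"] by simp
  finally show ?thesis .
qed

text \<open>The symmetrized sum is an eigenvector of T_i with eigenvalue t, hence symmetric in x_i
  and x_(i+1).\<close>

lemma act_P_mac:
  assumes "i \<in> {1..<m}"
  shows "act (simple_refl i) (P_mac lam \<gamma>) = P_mac lam \<gamma>"
proof (rule T_simple_eigen_imp_invariant, rule stab_cancel)
  have i: "i \<in> {1..<n}" using assms m_le_n by auto
  have s: "simple_refl i permutes {1..m}" using assms by (rule simple_refl_permutes)
  have "T_simple i (E_sym m id \<mu>) = Cst (t_K ^ of_bool (inv id (i + 1) \<le> m)) * E_sym m (simple_refl i \<circ> id) \<mu>"
    using i m_le_n by (intro T_simple_E_sym) (simp_all add: length_\<mu> part_\<mu>_decreasing permutes_id)
  also have "E_sym m (simple_refl i \<circ> id) \<mu> = E_sym m id \<mu>" using E_sym_comp[OF s, of id \<mu>] by simp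
  also have "of_bool (inv id (i + 1) \<le> m) = (1::nat)" using assms by simp
  finally have "T_simple i (stab_card * P_mac lam \<gamma>) = Cst t_K * (stab_card * P_mac lam \<gamma>)"
    by (simp only: stab_P_mac power_one_right)
  then show "stab_card * T_simple i (P_mac lam \<gamma>) = stab_card * (Cst t_K * P_mac lam \<gamma>)"
    unfolding T_simple_Cst_mult by (simp only: mult.left_commute)
qed

text \<open>The longest element of the second block has no inversion ending in the first m columns,
  so only t^N arises, with N its length minus the inversions of \<gamma>.\<close>

lemma subst_bar_P_mac_rotated:
  "subst (\<lambda>i. if i \<le> m then X i else Cst q_K * X (m + n + 1 - i)) (bar (P_mac lam \<gamma>)) =
     Cst (q_K ^ sum_list \<gamma> *
          t_K powi (int (comp_inv \<gamma>) - int (cox_length n (longest_elt n (m + 1) n)))) *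
       T_op n (longest_elt n (m + 1) n) (P_mac lam \<gamma>)"
    (is "subst ?\<phi> _ = _")
proof -
  define v where "v = reversal (m + 1) n"
  define r where "r = reversal 1 m"
  define N where "N = card {(p, p'). m + 1 \<le> p \<and> p < p' \<and> p' \<le> n \<and> m < p' \<and> part \<mu> p \<le> part \<mu> p'}"
  have vl: "longest_elt n (m + 1) n = v" unfolding v_def by (rule longest_elt_eq_reversal) auto
  have v: "v permutes {1..n}"
    unfolding v_def by (rule permutes_subset[OF reversal_permutes]) auto
  have r: "r permutes {1..m}" unfolding r_def by (rule reversal_permutes)
  have I: "invs n v = {(p, p'). m + 1 \<le> p \<and> p < p' \<and> p' \<le> n}"
    unfolding v_def by (rule invs_reversal) auto
  have len: "cox_length n v = N + comp_inv \<gamma>"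
  proof -
    let ?I2 = "{(p, p'). m + 1 \<le> p \<and> p < p' \<and> p' \<le> n \<and> m < p' \<and> part \<mu> p \<le> part \<mu> p'}"
    let ?I3 = "{(p, p'). m < p \<and> p < p' \<and> p' \<le> n \<and> part \<mu> p > part \<mu> p'}"
    have "invs n v = ?I2 \<union> ?I3" unfolding I by auto
    moreover have "finite ?I2" "finite ?I3"
      by (rule finite_subset[OF _ finite_invs[of n v]]; use I in auto)+
    moreover have "?I2 \<inter> ?I3 = {}" by auto
    ultimately have "card (invs n v) = card ?I2 + card ?I3"
      by (simp only: card_Un_disjoint)
    moreover have "comp_inv \<gamma> = card ?I3"
      unfolding comp_inv_eq_card[of \<gamma> lam] by (simp only: n_def m_def \<mu>_def)
    ultimately show ?thesis
      unfolding cox_length_eq_card_invs[OF v] N_def by simp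
  qed
  have "{x \<in> invs n v. snd x \<le> m} = {}" unfolding I by auto
  then have "stab_card * T_op n v (P_mac lam \<gamma>) = E_sym m v \<mu>"
    unfolding T_op_P_mac[OF v] by (simp only: card.empty power_0 Cst_hom mult_1_left)
  also have "\<dots> = Cst (t_K ^ N) * (\<Sum>\<tau> | \<tau> permutes {1..m}. E_gen (v \<circ> \<tau>) \<mu>)"
    unfolding v_def N_def by (rule E_sym_reversal) auto
  finally have T: "stab_card * T_op n v (P_mac lam \<gamma>) =
      Cst (t_K ^ N) * (\<Sum>\<tau> | \<tau> permutes {1..m}. E_gen (v \<circ> \<tau>) \<mu>)" .

  \<comment> \<open>The substitution fixes x_1, ..., x_m while \<open>block_vars\<close> reverses
    them; the symmetry of \<open>P\<close> in these variables bridges the difference.\<close>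
  have "act r (P_mac lam \<gamma>) = P_mac lam \<gamma>"
  proof -
    obtain w where "set w \<subseteq> {1..<m}" "word_perm w = r" using ex_word_perm[OF r] by blast
    then show ?thesis using act_word_perm_invariant[of w "P_mac lam \<gamma>"] act_P_mac by blast
  qed
  then have "bar (P_mac lam \<gamma>) = subst (\<lambda>i. X (r i)) (bar (P_mac lam \<gamma>))"
    using bar_act[of r "P_mac lam \<gamma>"] by (simp add: act_def)
  then have "subst ?\<phi> (bar (P_mac lam \<gamma>)) = subst (\<lambda>i. ?\<phi> (r i)) (bar (P_mac lam \<gamma>))"
    using subst_subst[of ?\<phi> "\<lambda>i. X (r i)" "bar (P_mac lam \<gamma>)"] by simp
  also have "\<dots> = subst (block_vars m n) (bar (P_mac lam \<gamma>))"
    by (rule subst_cong_poly_ring[OF bar_poly_ring[OF P_mac_poly_ring]])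
      (auto simp: r_def reversal_def block_vars_def block_reversal_apply)
  finally have \<phi>: "subst ?\<phi> (bar (P_mac lam \<gamma>)) = subst (block_vars m n) (bar (P_mac lam \<gamma>))" .
  have "big_size m \<tau> \<mu> = sum_list \<gamma>" if \<tau>: "\<tau> permutes {1..m}" for \<tau>
  proof -
    have big: "m < \<tau> p \<longleftrightarrow> m < p" if "p \<in> {1..n}" for p
      using permutes_in_image[OF \<tau>, of p] permutes_not_in[OF \<tau>, of p] that
      by (cases "p \<le> m") auto
    have "big_size m \<tau> \<mu> = (\<Sum>p\<in>{1..n}. if m < p then part \<mu> p else 0)"
      unfolding big_size_def length_\<mu> by (intro sum.cong refl) (simp only: big)
    also have "\<dots> = (\<Sum>p\<in>{m + 1..n}. part \<mu> p)"
      by (intro sum.mono_neutral_cong_right) auto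
    finally show ?thesis unfolding sum_list_eq_sum_part[of \<gamma> lam] by (simp only: m_def n_def \<mu>_def)
  qed
  from subst_bar_P_mac[OF m_le_n this]
  have "stab_card * subst ?\<phi> (bar (P_mac lam \<gamma>)) =
      Cst (q_K ^ sum_list \<gamma>) * (\<Sum>\<tau> | \<tau> permutes {1..m}. E_gen (block_reversal m n \<circ> \<tau>) \<mu>)"
    unfolding \<phi> .
  also have "(\<Sum>\<tau> | \<tau> permutes {1..m}. E_gen (block_reversal m n \<circ> \<tau>) \<mu>) =
      (\<Sum>\<tau> | \<tau> permutes {1..m}. E_gen (v \<circ> \<tau>) \<mu>)"
  proof -
    \<comment> \<open>The reversal of the first block is absorbed by the sum over S_m.\<close>
    have "block_reversal m n = v \<circ> r"
      by (auto simp: fun_eq_iff block_reversal_def v_def r_def reversal_def)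
    then show ?thesis
      using sum_permutes_comp[OF r, of "\<lambda>\<tau>. E_gen (v \<circ> \<tau>) \<mu>"] by (simp only: comp_assoc)
  qed
  finally have L: "stab_card * subst ?\<phi> (bar (P_mac lam \<gamma>)) =
      Cst (q_K ^ sum_list \<gamma>) * (\<Sum>\<tau> | \<tau> permutes {1..m}. E_gen (v \<circ> \<tau>) \<mu>)" .
  have t: "t_K powi (int (comp_inv \<gamma>) - int (N + comp_inv \<gamma>)) * t_K ^ N = 1"
    by (simp add: power_int_minus)
  have "stab_card * (Cst (q_K ^ sum_list \<gamma> * t_K powi (int (comp_inv \<gamma>) - int (N + comp_inv \<gamma>))) *
      T_op n v (P_mac lam \<gamma>)) =
    Cst (q_K ^ sum_list \<gamma> * t_K powi (int (comp_inv \<gamma>) - int (N + comp_inv \<gamma>))) *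
      (stab_card * T_op n v (P_mac lam \<gamma>))" by (simp only: mult_ac)
  also have "\<dots> = Cst (q_K ^ sum_list \<gamma> * (t_K powi (int (comp_inv \<gamma>) - int (N + comp_inv \<gamma>)) * t_K ^ N)) *
      (\<Sum>\<tau> | \<tau> permutes {1..m}. E_gen (v \<circ> \<tau>) \<mu>)"
    unfolding T by (simp only: Cst_hom(4) mult.assoc)
  also have "\<dots> = stab_card * subst ?\<phi> (bar (P_mac lam \<gamma>))" unfolding t L by simp
  finally show ?thesis unfolding vl len by (rule stab_cancel[symmetric])
qed

end

theorem theorem1p2:
  fixes m n :: nat and lam \<gamma> :: "nat list"
  assumes "m \<le> n"
    and "length lam = m"
    and "length \<gamma> = n - m"
    and "sorted_wrt (\<ge>) lam"
  shows "KL_inv n (P_mac lam \<gamma>) = Cst (t_K ^ pair_inv lam \<gamma>) * P_mac lam \<gamma> \<and>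
    (KL_inv n (P_mac lam \<gamma>) = Cst (t_K ^ pair_inv lam \<gamma>) * P_mac lam \<gamma> \<longleftrightarrow>
     subst (\<lambda>i. if i \<le> m then X i else Cst q_K * X (m + n + 1 - i)) (bar (P_mac lam \<gamma>)) =
       Cst (q_K ^ sum_list \<gamma> *
            t_K powi (int (comp_inv \<gamma>) - int (cox_length n (longest_elt n (m + 1) n)))) *
         T_op n (longest_elt n (m + 1) n) (P_mac lam \<gamma>))"
proof -
  have n: "n = length lam + length \<gamma>" using assms by simp
  \<comment> \<open>Both identities have been established independently, and the equivalence follows
    from their truth.\<close>
  show ?thesis
    using KL_inv_P_mac[OF assms(4), of \<gamma>] subst_bar_P_mac_rotated[OF assms(4), of \<gamma>]
    unfolding n assms(2)[symmetric] by blast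
qed

end
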